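(* Let $M=\Gamma\setminus\mathbb{H}_d$ be a compact Heisenberg manifold, let $\alpha\in\mathbb{R}$ with $-d\le\alpha\le d$, and let $\mathcal{G}_\alpha$ be the Green operator on $L^2(M)$ associated to $\mathcal{L}_\alpha=\mathcal{L}_0+i\alpha T$. Then for $r\ge 1$, the Schatten $r$-norm satisfies $\|\mathcal{G}_\alpha\|_r<\infty$ if and only if $r>d+1$.
   Context: Setting. $d\ge 1$ is an integer and $\mathbb{H}_d$ is the Heisenberg group with underlying manifold $\mathbb{C}^d\times\mathbb{R}$, center $\{0\}\times\mathbb{R}$, and quotient homomorphism $\pi:\mathbb{H}_d\to\mathbb{C}^d$, $\pi(z,t)=z$. $\Gamma$ is a lattice subgroup and $M=\Gamma\setminus\mathbb{H}_d$ is the compact quotient (a compact Heisenberg manifold). The center of $\Gamma$ is $(0,0,c\mathbb{Z})$ with $c>0$; $\Lambda=\pi(\Gamma)$ is a lattice in $\mathbb{C}^d\cong\mathbb{R}^{2d}$, and $\Lambda'$ is its dual lattice. Operators. $\mathcal{L}_0$ (the sub-Laplacian) and $i^{-1}T$ ($T$ a left-invariant vector field in the central direction) are the standard left-invariant self-adjoint operators; on $L^2(M)$ they strongly commute. Normalizations are those for which the following known theorem of Folland holds: $L^2(M)$ has an orthonormal basis of joint eigenvectors of $(\mathcal{L}_0,i^{-1}T)$, and the joint spectrum is $$\left\{\left(\tfrac{\pi|n|}{2c}(d+2j),\tfrac{\pi n}{2c}\right): j\in\mathbb{Z}_{\ge0},\ n\in\mathbb{Z}\setminus\{0\}\right\}\cup\left\{\left(\tfrac{\pi}{2}|\xi|^2,0\right):\xi\in\Lambda'\right\}.$$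 The multiplicity of $\left(\tfrac{\pi|n|}{2c}(d+2j),\tfrac{\pi n}{2c}\right)$ is $|n|^d K\binom{j+d-1}{d-1}$, where $K>0$ is a constant determined by $\Gamma$; the second family contributes one basis vector for each $\xi\in\Lambda'$ (so the multiplicity of $(\tfrac{\pi}{2}|\xi|^2,0)$ is the number of vectors of $\Lambda'$ having length $|\xi|$). (In these formulas, outside the map $\pi$, the symbol $\pi$ is the usual number.) For $\alpha\in\mathbb{R}$, $\mathcal{L}_\alpha=\mathcal{L}_0+i\alpha T$. Its eigenvalues are $\tfrac{\pi|n|}{2c}(d+2j-\alpha\operatorname{sgn} n)$ and $\tfrac{\pi}{2}|\xi|^2$, on the same joint eigenspaces. Green operator. Let $\{e_\ell\}$ be an orthonormal basis of $(\ker\mathcal{L}_\alpha)^\perp$ consisting of joint eigenvectors of $\mathcal{L}_0$ and $i^{-1}T$, with $\mathcal{L}_\alpha e_\ell=\lambda_\ell e_\ell$, $\lambda_\ell\neq0$. Then $\mathcal{G}_\alpha f=0$ for $f\in\ker\mathcal{L}_\alpha$ and $\mathcal{G}_\alpha f=\sum_\ell\frac{\langle f,e_\ell\rangle}{\lambda_\ell}e_\ell$ for $f\in(\ker\mathcal{L}_\alpha)^\perp$. Schatten norm. For $r\ge1$ and a positive semi-definite operator $A$ on a separable Hilbert space that is diagonalizable with countable non-negative point spectrum, $\|A\|_r=\left(\sum_k\lambda_k(A)^r\right)^{1/r}\in[0,\infty]$, where $\lambda_k(A)$ are the eigenvalues of $A$ listed with multiplicity. *)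

theory Defs
  imports "HOL-Analysis.Analysis" "HOL-Algebra.Coset"
begin

section \<open>The Heisenberg group and its compact quotients\<close>

type_synonym 'd heis = "(complex ^ 'd) \<times> real"

text \<open>
  The real number \<open>\<kappa> \<noteq> 0\<close> fixes the scale of the central coordinate; common conventions are
  \<open>\<kappa> = 2\<close> and \<open>\<kappa> = 1/2\<close>. All choices give isomorphic groups.
\<close>

definition heis :: "real \<Rightarrow> ('d::finite) heis monoid" where
  "heis \<kappa> = \<lparr>carrier = UNIV,
     mult = (\<lambda>(z, t) (w, u). (z + w, t + u + \<kappa> * Im (\<Sum>j\<in>UNIV. z $ j * cnj (w $ j)))),
     one = (0, 0)\<rparr>"

lemma group_heis: "group (heis \<kappa> :: ('d::finite) heis monoid)"
proof (rule groupI)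
  fix x y z :: "'d heis"
  show "(x \<otimes>\<^bsub>heis \<kappa>\<^esub> y) \<otimes>\<^bsub>heis \<kappa>\<^esub> z = x \<otimes>\<^bsub>heis \<kappa>\<^esub> (y \<otimes>\<^bsub>heis \<kappa>\<^esub> z)"
    by (cases x; cases y; cases z)
      (simp add: heis_def algebra_simps sum.distrib sum_subtractf)
next
  fix x :: "'d heis"
  have "Im (\<Sum>j\<in>UNIV. (- fst x) $ j * cnj (fst x $ j)) = 0"
    by (simp add: mult.commute)
  then have "(- fst x, - snd x) \<otimes>\<^bsub>heis \<kappa>\<^esub> x = \<one>\<^bsub>heis \<kappa>\<^esub>"
    by (cases x) (simp add: heis_def)
  then show "\<exists>y\<in>carrier (heis \<kappa>). y \<otimes>\<^bsub>heis \<kappa>\<^esub> x = \<one>\<^bsub>heis \<kappa>\<^esub>"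
    by (intro bexI[of _ "(- fst x, - snd x)"]) (auto simp: heis_def)
qed (auto simp: heis_def)

definition heis_quotient_topology :: "real \<Rightarrow> ('d::finite) heis set \<Rightarrow> 'd heis set topology" where
  "heis_quotient_topology \<kappa> \<Gamma> = topology (\<lambda>U. U \<subseteq> rcosets\<^bsub>heis \<kappa>\<^esub> \<Gamma> \<and> open {x. \<Gamma> #>\<^bsub>heis \<kappa>\<^esub> x \<in> U})"

lemma openin_heis_quotient_topology:
  "openin (heis_quotient_topology \<kappa> \<Gamma>) U \<longleftrightarrow>
     U \<subseteq> rcosets\<^bsub>heis \<kappa>\<^esub> \<Gamma> \<and> open {x. \<Gamma> #>\<^bsub>heis \<kappa>\<^esub> x \<in> U}"
proof -
  let ?L = "\<lambda>U. U \<subseteq> rcosets\<^bsub>heis \<kappa>\<^esub> \<Gamma> \<and> open {x. \<Gamma> #>\<^bsub>heis \<kappa>\<^esub> x \<in> U}"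
  have "istopology ?L"
    unfolding istopology_def
  proof (intro conjI allI impI)
    fix S T assume "?L S" "?L T"
    then show "S \<inter> T \<subseteq> rcosets\<^bsub>heis \<kappa>\<^esub> \<Gamma>" "open {x. \<Gamma> #>\<^bsub>heis \<kappa>\<^esub> x \<in> S \<inter> T}"
      by (auto intro: open_Collect_conj)
  next
    fix \<K> assume *: "\<forall>K\<in>\<K>. ?L K"
    then show "\<Union>\<K> \<subseteq> rcosets\<^bsub>heis \<kappa>\<^esub> \<Gamma>" by blast
    have "{x. \<Gamma> #>\<^bsub>heis \<kappa>\<^esub> x \<in> \<Union>\<K>} = (\<Union>K\<in>\<K>. {x. \<Gamma> #>\<^bsub>heis \<kappa>\<^esub> x \<in> K})" by auto
    with * show "open {x. \<Gamma> #>\<^bsub>heis \<kappa>\<^esub> x \<in> \<Union>\<K>}" by auto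
  qed
  then show ?thesis
    unfolding heis_quotient_topology_def by (simp add: topology_inverse')
qed

definition heis_lattice :: "real \<Rightarrow> ('d::finite) heis set \<Rightarrow> bool" where
  "heis_lattice \<kappa> \<Gamma> \<longleftrightarrow>
     subgroup \<Gamma> (heis \<kappa>) \<and> discrete \<Gamma> \<and> compact_space (heis_quotient_topology \<kappa> \<Gamma>)"

definition heis_center :: "real \<Rightarrow> ('d::finite) heis set \<Rightarrow> 'd heis set" where
  "heis_center \<kappa> \<Gamma> = {g \<in> \<Gamma>. \<forall>h\<in>\<Gamma>. g \<otimes>\<^bsub>heis \<kappa>\<^esub> h = h \<otimes>\<^bsub>heis \<kappa>\<^esub> g}"

text \<open>The dual lattice, with respect to the real inner product \<open>Re (\<Sum>j. \<xi>\<^sub>j * cnj \<mu>\<^sub>j)\<close>.\<close>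

definition dual_lattice :: "(complex ^ 'd::finite) set \<Rightarrow> (complex ^ 'd) set" where
  "dual_lattice \<Lambda> = {\<xi>. \<forall>\<mu>\<in>\<Lambda>. \<xi> \<bullet> \<mu> \<in> \<int>}"

definition fundamental_domain :: "real \<Rightarrow> ('d::finite) heis set \<Rightarrow> 'd heis set \<Rightarrow> bool" where
  "fundamental_domain \<kappa> \<Gamma> F \<longleftrightarrow>
     F \<in> sets borel \<and> (\<forall>x. \<exists>!\<gamma>. \<gamma> \<in> \<Gamma> \<and> \<gamma> \<otimes>\<^bsub>heis \<kappa>\<^esub> x \<in> F)"

text \<open>
  Lebesgue measure is a Haar measure of the (unimodular) Heisenberg group. The invariant measure
  it induces on the space of cosets is its restriction to a fundamental domain \<open>F\<close>, transported by
  the projection; it does not depend on \<open>F\<close>.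
\<close>

definition heis_quotient :: "real \<Rightarrow> ('d::finite) heis set \<Rightarrow> 'd heis set \<Rightarrow> 'd heis set measure" where
  "heis_quotient \<kappa> \<Gamma> F =
     distr (restrict_space lborel F)
       (sigma (rcosets\<^bsub>heis \<kappa>\<^esub> \<Gamma>)
          {E. E \<subseteq> rcosets\<^bsub>heis \<kappa>\<^esub> \<Gamma> \<and> {x. \<Gamma> #>\<^bsub>heis \<kappa>\<^esub> x \<in> E} \<in> sets borel})
       (\<lambda>x. \<Gamma> #>\<^bsub>heis \<kappa>\<^esub> x)"


section \<open>Square-integrable functions and operators\<close>

text \<open>
  Elements of \<open>L\<^sup>2\<close> are represented by functions, so that identities between them are meant almost
  everywhere. Unbounded operators are given by their graphs; the operators below have graphs that
  are closed under changing functions on null sets.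
\<close>

definition l2 :: "'a measure \<Rightarrow> ('a \<Rightarrow> complex) set" where
  "l2 N = {f \<in> borel_measurable N. integrable N (\<lambda>x. (norm (f x))\<^sup>2)}"

definition l2_inner :: "'a measure \<Rightarrow> ('a \<Rightarrow> complex) \<Rightarrow> ('a \<Rightarrow> complex) \<Rightarrow> complex" where
  "l2_inner N f g = (LINT x|N. f x * cnj (g x))"

definition l2_norm :: "'a measure \<Rightarrow> ('a \<Rightarrow> complex) \<Rightarrow> real" where
  "l2_norm N f = sqrt (LINT x|N. (norm (f x))\<^sup>2)"

definition l2_converges :: "'a measure \<Rightarrow> (nat \<Rightarrow> 'a \<Rightarrow> complex) \<Rightarrow> ('a \<Rightarrow> complex) \<Rightarrow> bool" where
  "l2_converges N u f \<longleftrightarrow>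
     (\<forall>k. u k \<in> l2 N) \<and> f \<in> l2 N \<and> (\<lambda>k. l2_norm N (\<lambda>x. u k x - f x)) \<longlonglongrightarrow> 0"

type_synonym 'a l2_operator = "(('a \<Rightarrow> complex) \<times> ('a \<Rightarrow> complex)) set"

definition l2_closure :: "'a measure \<Rightarrow> 'a l2_operator \<Rightarrow> 'a l2_operator" where
  "l2_closure N A = {(f, g). \<exists>u v. (\<forall>k. (u k, v k) \<in> A) \<and> l2_converges N u f \<and> l2_converges N v g}"

definition eigenvector :: "'a measure \<Rightarrow> 'a l2_operator \<Rightarrow> real \<Rightarrow> ('a \<Rightarrow> complex) \<Rightarrow> bool" where
  "eigenvector N A \<mu> f \<longleftrightarrow> f \<in> l2 N \<and> l2_norm N f \<noteq> 0 \<and> (f, \<lambda>x. of_real \<mu> * f x) \<in> A"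

definition l2_kernel :: "'a measure \<Rightarrow> 'a l2_operator \<Rightarrow> ('a \<Rightarrow> complex) set" where
  "l2_kernel N A = {f \<in> l2 N. (f, \<lambda>x. 0) \<in> A}"

definition l2_orthogonal :: "'a measure \<Rightarrow> ('a \<Rightarrow> complex) set \<Rightarrow> ('a \<Rightarrow> complex) set" where
  "l2_orthogonal N V = {f \<in> l2 N. \<forall>g\<in>V. l2_inner N f g = 0}"

definition l2_orthonormal_basis ::
  "'a measure \<Rightarrow> ('a \<Rightarrow> complex) set \<Rightarrow> 'i set \<Rightarrow> ('i \<Rightarrow> 'a \<Rightarrow> complex) \<Rightarrow> bool" where
  "l2_orthonormal_basis N V I e \<longleftrightarrow>
     (\<forall>i\<in>I. e i \<in> V) \<and>
     (\<forall>i\<in>I. \<forall>j\<in>I. l2_inner N (e i) (e j) = (if i = j then 1 else 0)) \<and>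
     (\<forall>f\<in>V. \<forall>\<epsilon>>0. \<exists>J a. finite J \<and> J \<subseteq> I \<and> l2_norm N (\<lambda>x. f x - (\<Sum>i\<in>J. a i * e i x)) < \<epsilon>)"

text \<open>
  The multiplicity of an eigenvalue is the dimension of its eigenspace modulo null functions,
  computed as the supremum of the sizes of its finite orthonormal subsets.
\<close>

definition eigen_multiplicity :: "'a measure \<Rightarrow> 'a l2_operator \<Rightarrow> real \<Rightarrow> ennreal" where
  "eigen_multiplicity N A \<mu> =
     (SUP S \<in> {S. finite S \<and> (\<forall>f\<in>S. eigenvector N A \<mu> f) \<and>
                 (\<forall>f\<in>S. \<forall>g\<in>S. l2_inner N f g = (if f = g then 1 else 0))}. of_nat (card S))"

text \<open>
  For positive semi-definite diagonalizable \<open>A\<close>. The eigenvalue \<open>0\<close> contributes nothing, also when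
  its multiplicity is infinite.
\<close>

definition schatten_norm :: "'a measure \<Rightarrow> 'a l2_operator \<Rightarrow> real \<Rightarrow> ennreal" where
  "schatten_norm N A r =
     (let S = (\<Sum>\<^sub>\<infinity>\<mu>\<in>{\<mu>. \<exists>f. eigenvector N A \<mu> f}. eigen_multiplicity N A \<mu> * ennreal (\<mu> powr r))
      in if S = \<infinity> then \<infinity> else ennreal (enn2real S powr (1 / r)))"


section \<open>Left-invariant differential operators\<close>

primrec C_k :: "nat \<Rightarrow> ('a::real_normed_vector \<Rightarrow> complex) \<Rightarrow> bool" where
  "C_k 0 f \<longleftrightarrow> continuous_on UNIV f"
| "C_k (Suc n) f \<longleftrightarrow>
     (\<forall>x. f differentiable at x) \<and> (\<forall>v. C_k n (\<lambda>x. frechet_derivative f (at x) v))"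

definition C_infinity :: "('a::real_normed_vector \<Rightarrow> complex) \<Rightarrow> bool" where
  "C_infinity f \<longleftrightarrow> (\<forall>n. C_k n f)"

text \<open>
  The left-invariant vector field with value \<open>v\<close> at the identity; the one-parameter subgroups
  of the Heisenberg group are the lines \<open>\<sigma> \<mapsto> \<sigma> v\<close>.
\<close>

definition heis_field :: "real \<Rightarrow> ('d::finite) heis \<Rightarrow> ('d heis \<Rightarrow> complex) \<Rightarrow> 'd heis \<Rightarrow> complex" where
  "heis_field \<kappa> v u x = vector_derivative (\<lambda>\<sigma>. u (x \<otimes>\<^bsub>heis \<kappa>\<^esub> (\<sigma> *\<^sub>R v))) (at 0)"

definition heis_T :: "real \<Rightarrow> real \<Rightarrow> (('d::finite) heis \<Rightarrow> complex) \<Rightarrow> 'd heis \<Rightarrow> complex" where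
  "heis_T \<kappa> \<tau> u x = of_real \<tau> * heis_field \<kappa> (0, 1) u x"

text \<open>
  With \<open>z = x + \<i> y\<close>, the directions \<open>axis j 1\<close> and \<open>axis j \<i>\<close> give the fields usually called
  \<open>X\<^sub>j\<close> and \<open>Y\<^sub>j\<close>. In terms of \<open>Z\<^sub>j = (X\<^sub>j - \<i> Y\<^sub>j) / 2\<close> the operator below is
  \<open>- 2 s (\<Sum>j. Z\<^sub>j Z\<^sub>j\<^sup>* + Z\<^sub>j\<^sup>* Z\<^sub>j)\<close>, where \<open>Z\<^sub>j\<^sup>* = (X\<^sub>j + \<i> Y\<^sub>j) / 2\<close> is the conjugate field.
\<close>

definition heis_sublaplacian ::
  "real \<Rightarrow> real \<Rightarrow> (('d::finite) heis \<Rightarrow> complex) \<Rightarrow> 'd heis \<Rightarrow> complex" where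
  "heis_sublaplacian \<kappa> s u x =
     - of_real s * (\<Sum>j\<in>UNIV. heis_field \<kappa> (axis j 1, 0) (heis_field \<kappa> (axis j 1, 0) u) x
                           + heis_field \<kappa> (axis j \<i>, 0) (heis_field \<kappa> (axis j \<i>, 0) u) x)"

text \<open>
  A left-invariant differential operator \<open>D\<close> acts on smooth functions on the quotient through their
  lifts to the group. The operator on \<open>L\<^sup>2\<close> is the closure of this action.
\<close>

definition quotient_operator ::
  "real \<Rightarrow> ('d::finite) heis set \<Rightarrow> 'd heis set \<Rightarrow> (('d heis \<Rightarrow> complex) \<Rightarrow> 'd heis \<Rightarrow> complex)
    \<Rightarrow> 'd heis set l2_operator" where
  "quotient_operator \<kappa> \<Gamma> F D =
     l2_closure (heis_quotient \<kappa> \<Gamma> F)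
       {(f, g). C_infinity (\<lambda>x. f (\<Gamma> #>\<^bsub>heis \<kappa>\<^esub> x)) \<and>
                (\<lambda>x. g (\<Gamma> #>\<^bsub>heis \<kappa>\<^esub> x)) = D (\<lambda>x. f (\<Gamma> #>\<^bsub>heis \<kappa>\<^esub> x))}"

definition L0_op :: "real \<Rightarrow> real \<Rightarrow> ('d::finite) heis set \<Rightarrow> 'd heis set \<Rightarrow> 'd heis set l2_operator" where
  "L0_op \<kappa> s \<Gamma> F = quotient_operator \<kappa> \<Gamma> F (heis_sublaplacian \<kappa> s)"

definition T_op :: "real \<Rightarrow> real \<Rightarrow> ('d::finite) heis set \<Rightarrow> 'd heis set \<Rightarrow> 'd heis set l2_operator" where
  "T_op \<kappa> \<tau> \<Gamma> F = quotient_operator \<kappa> \<Gamma> F (heis_T \<kappa> \<tau>)"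

definition iT_op :: "real \<Rightarrow> real \<Rightarrow> ('d::finite) heis set \<Rightarrow> 'd heis set \<Rightarrow> 'd heis set l2_operator" where
  "iT_op \<kappa> \<tau> \<Gamma> F = {(f, \<lambda>x. inverse \<i> * g x) | f g. (f, g) \<in> T_op \<kappa> \<tau> \<Gamma> F}"

text \<open>
  The sum of the strongly commuting self-adjoint operators \<open>L\<^sub>0\<close> and \<open>\<i> \<alpha> T\<close> need not be closed on
  the intersection of the domains; the self-adjoint operator is its closure.
\<close>

definition L_op ::
  "real \<Rightarrow> real \<Rightarrow> real \<Rightarrow> ('d::finite) heis set \<Rightarrow> 'd heis set \<Rightarrow> real \<Rightarrow> 'd heis set l2_operator" where
  "L_op \<kappa> s \<tau> \<Gamma> F \<alpha> =
     l2_closure (heis_quotient \<kappa> \<Gamma> F)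
       {(f, \<lambda>x. g x + \<i> * of_real \<alpha> * h x) | f g h. (f, g) \<in> L0_op \<kappa> s \<Gamma> F \<and> (f, h) \<in> T_op \<kappa> \<tau> \<Gamma> F}"

definition joint_eigenvector ::
  "real \<Rightarrow> real \<Rightarrow> real \<Rightarrow> ('d::finite) heis set \<Rightarrow> 'd heis set \<Rightarrow> real \<times> real
    \<Rightarrow> ('d heis set \<Rightarrow> complex) \<Rightarrow> bool" where
  "joint_eigenvector \<kappa> s \<tau> \<Gamma> F p f \<longleftrightarrow>
     eigenvector (heis_quotient \<kappa> \<Gamma> F) (L0_op \<kappa> s \<Gamma> F) (fst p) f \<and>
     eigenvector (heis_quotient \<kappa> \<Gamma> F) (iT_op \<kappa> \<tau> \<Gamma> F) (snd p) f"

text \<open>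
  Folland's description of the joint spectrum of \<open>L\<^sub>0\<close> and \<open>\<i>\<^sup>-\<^sup>1 T\<close>, with multiplicities. It holds
  for suitable normalizing constants \<open>\<kappa>\<close>, \<open>s\<close>, \<open>\<tau>\<close>: up to the signs of \<open>\<kappa>\<close> and \<open>\<tau>\<close> these are
  \<open>\<kappa> = pi\<close>, \<open>s = 1 / (8 pi)\<close>, \<open>\<tau> = 1 / 4\<close>. The constant \<open>K\<close> is an integer, being
  the multiplicity for \<open>n = 1\<close>, \<open>j = 0\<close>; the third index \<open>m\<close> enumerates a basis of the joint eigenspace.
\<close>

definition folland_spectrum ::
  "real \<Rightarrow> real \<Rightarrow> real \<Rightarrow> ('d::finite) heis set \<Rightarrow> 'd heis set \<Rightarrow> real \<Rightarrow> nat \<Rightarrow> bool" where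
  "folland_spectrum \<kappa> s \<tau> \<Gamma> F c K \<longleftrightarrow>
     (let I = {(n, j, m). n \<noteq> 0 \<and> m < nat \<bar>n\<bar> ^ CARD('d) * K * ((j + CARD('d) - 1) choose (CARD('d) - 1))};
          \<Lambda>' = dual_lattice (fst ` \<Gamma>)
      in \<exists>b :: (int \<times> nat \<times> nat) + (complex ^ 'd) \<Rightarrow> 'd heis set \<Rightarrow> complex.
           l2_orthonormal_basis (heis_quotient \<kappa> \<Gamma> F) (l2 (heis_quotient \<kappa> \<Gamma> F)) (I <+> \<Lambda>') b \<and>
           (\<forall>(n, j, m)\<in>I. joint_eigenvector \<kappa> s \<tau> \<Gamma> F
              (pi * of_int \<bar>n\<bar> / (2 * c) * (real CARD('d) + 2 * real j), pi * of_int n / (2 * c))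
              (b (Inl (n, j, m)))) \<and>
           (\<forall>\<xi>\<in>\<Lambda>'. joint_eigenvector \<kappa> s \<tau> \<Gamma> F (pi / 2 * (norm \<xi>)\<^sup>2, 0) (b (Inr \<xi>))))"


section \<open>The Green operator\<close>

definition green_basis ::
  "real \<Rightarrow> real \<Rightarrow> real \<Rightarrow> ('d::finite) heis set \<Rightarrow> 'd heis set \<Rightarrow> real
    \<Rightarrow> (nat \<Rightarrow> 'd heis set \<Rightarrow> complex) \<Rightarrow> (nat \<Rightarrow> real) \<Rightarrow> bool" where
  "green_basis \<kappa> s \<tau> \<Gamma> F \<alpha> e ev \<longleftrightarrow>
     (let N = heis_quotient \<kappa> \<Gamma> F; L = L_op \<kappa> s \<tau> \<Gamma> F \<alpha>
      in l2_orthonormal_basis N (l2_orthogonal N (l2_kernel N L)) UNIV e \<and>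
         (\<forall>l. (\<exists>p. joint_eigenvector \<kappa> s \<tau> \<Gamma> F p (e l)) \<and> eigenvector N L (ev l) (e l) \<and> ev l \<noteq> 0))"

text \<open>
  Linear extension, along the orthogonal decomposition into the kernel and its complement, of
  \<open>0\<close> on the kernel and of the eigenvector expansion on the complement.
\<close>

definition green_op ::
  "real \<Rightarrow> real \<Rightarrow> real \<Rightarrow> ('d::finite) heis set \<Rightarrow> 'd heis set \<Rightarrow> real
    \<Rightarrow> (nat \<Rightarrow> 'd heis set \<Rightarrow> complex) \<Rightarrow> (nat \<Rightarrow> real) \<Rightarrow> 'd heis set l2_operator" where
  "green_op \<kappa> s \<tau> \<Gamma> F \<alpha> e ev =
     (let N = heis_quotient \<kappa> \<Gamma> F; V = l2_kernel N (L_op \<kappa> s \<tau> \<Gamma> F \<alpha>)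
      in {(f, g). f \<in> l2 N \<and>
           (\<exists>h\<in>V. \<exists>u\<in>l2_orthogonal N V. (AE x in N. f x = h x + u x) \<and>
              l2_converges N (\<lambda>k x. \<Sum>l<k. l2_inner N u (e l) / of_real (ev l) * e l x) g)})"

end

theory Submission
  imports Defs
begin

text \<open>
  Left-invariant fields have vanishing integral over the compact quotient, so integration by parts
  makes \<open>L\<^sub>\<alpha>\<close> symmetric: its eigenvectors for different eigenvalues are orthogonal. Expanding the
  given eigenbasis of \<open>(ker L\<^sub>\<alpha>)\<^sup>\<bottom>\<close> in Folland's basis, and conversely, Parseval's identity shows that
  both bases have the same eigenvalues with the same multiplicities. Hence the \<open>r\<close>-th power of the
  Schatten norm is the sum of \<open>\<lambda> powr - r\<close> over the nonzero eigenvalues in Folland's list. Up to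
  constants, the part with \<open>n \<noteq> 0\<close> is the product of \<open>\<Sum>n. n powr (d - r)\<close> and
  \<open>\<Sum>j. j powr (d - 1 - r)\<close>, which is finite exactly for \<open>r > d + 1\<close>; the sum over the dual
  lattice converges already for \<open>r > d\<close>.
\<close>

section \<open>Square-integrable functions\<close>

text \<open>The basis \<open>e\<close> is arbitrary, and coinciding eigenvalues permit any rotation
  inside an eigenspace, so it cannot be matched with Folland's basis vector by vector. Only the
  squared moduli of mutual Fourier coefficients enter. Sums are integrals over counting measures
  because nonnegative double sums can then be exchanged without knowing summability or countability;
  the eigenvalues in \<open>schatten_norm\<close> range over a set of reals.

  A second obstacle is that eigenvectors lie in graphs of closures and need not be smooth. Besides
  the eigenvector equations only symmetry of the operator is used; it is verified on smooth lifts
  and survives both closures. The vanishing integrals rest on invariance under right translations: a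
  right translate of a fundamental domain is again one, and Lebesgue measure is invariant on both
  sides.

  The bounds on \<alpha> make all eigenvalues nonnegative. At \<alpha> = \<open>d\<close> or
  \<alpha> = \<open>- d\<close> infinitely many of those with \<open>j = 0\<close> vanish, so the
  kernel is infinite-dimensional and the estimates have to step around it.\<close>

lemma borel_measurable_cnj [measurable (raw)]:
  "f \<in> borel_measurable N \<Longrightarrow> (\<lambda>x. cnj (f x)) \<in> borel_measurable N"
  by (rule borel_measurable_continuous_on) (auto intro: continuous_intros)

lemma l2_integrable_mult_cnj:
  assumes "f \<in> l2 N" "g \<in> l2 N"
  shows "integrable N (\<lambda>x. f x * cnj (g x))"
proof (rule Bochner_Integration.integrable_bound)
  show "integrable N (\<lambda>x. (norm (f x))\<^sup>2 + (norm (g x))\<^sup>2)"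
    using assms by (auto simp: l2_def)
  show "(\<lambda>x. f x * cnj (g x)) \<in> borel_measurable N"
    using assms by (auto simp: l2_def)
  have "norm (f x * cnj (g x)) \<le> norm ((norm (f x))\<^sup>2 + (norm (g x))\<^sup>2)" for x
    using sum_squares_bound[of "norm (f x)" "norm (g x)"] mult_nonneg_nonneg[of "norm (f x)" "norm (g x)"]
    unfolding norm_mult mult.assoc complex_mod_cnj real_norm_def by linarith
  then show "AE x in N. norm (f x * cnj (g x)) \<le> norm ((norm (f x))\<^sup>2 + (norm (g x))\<^sup>2)"
    by auto
qed

lemma l2_add:
  assumes "f \<in> l2 N" "g \<in> l2 N"
  shows "(\<lambda>x. f x + g x) \<in> l2 N"
proof -
  have "integrable N (\<lambda>x. (norm (f x + g x))\<^sup>2)"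
  proof (rule Bochner_Integration.integrable_bound)
    show "integrable N (\<lambda>x. 2 * (norm (f x))\<^sup>2 + 2 * (norm (g x))\<^sup>2)"
      using assms by (auto simp: l2_def)
    show "(\<lambda>x. (norm (f x + g x))\<^sup>2) \<in> borel_measurable N"
      using assms by (auto simp: l2_def)
    have "(norm (f x + g x))\<^sup>2 \<le> 2 * (norm (f x))\<^sup>2 + 2 * (norm (g x))\<^sup>2" for x
    proof -
      have "(norm (f x + g x))\<^sup>2 \<le> (norm (f x) + norm (g x))\<^sup>2"
        by (simp add: norm_triangle_ineq power_mono)
      also have "\<dots> \<le> 2 * (norm (f x))\<^sup>2 + 2 * (norm (g x))\<^sup>2"
        using sum_squares_bound[of "norm (f x)" "norm (g x)"] by (simp add: power2_sum)
      finally show ?thesis .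
    qed
    then show "AE x in N. norm ((norm (f x + g x))\<^sup>2) \<le> norm (2 * (norm (f x))\<^sup>2 + 2 * (norm (g x))\<^sup>2)"
      by auto
  qed
  then show ?thesis
    using assms by (auto simp: l2_def)
qed

lemma l2_cmult: "f \<in> l2 N \<Longrightarrow> (\<lambda>x. a * f x) \<in> l2 N"
  by (auto simp: l2_def norm_mult power_mult_distrib)

lemma l2_zero: "(\<lambda>x. 0) \<in> l2 N"
  by (auto simp: l2_def)

lemma l2_sum: "(\<And>i. i \<in> J \<Longrightarrow> f i \<in> l2 N) \<Longrightarrow> (\<lambda>x. \<Sum>i\<in>J. f i x) \<in> l2 N"
  by (induction J rule: infinite_finite_induct) (auto intro: l2_zero l2_add)

lemma l2_diff: "f \<in> l2 N \<Longrightarrow> g \<in> l2 N \<Longrightarrow> (\<lambda>x. f x - g x) \<in> l2 N"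
  using l2_add[of f N "\<lambda>x. -1 * g x"] l2_cmult[of g N "-1"] by simp

lemma l2_inner_cnj: "l2_inner N g f = cnj (l2_inner N f g)"
  unfolding l2_inner_def
  by (subst Bochner_Integration.integral_cnj[symmetric]) (simp add: mult.commute)

lemma l2_inner_add_left:
  "f \<in> l2 N \<Longrightarrow> g \<in> l2 N \<Longrightarrow> h \<in> l2 N \<Longrightarrow>
     l2_inner N (\<lambda>x. f x + g x) h = l2_inner N f h + l2_inner N g h"
  unfolding l2_inner_def by (simp add: distrib_right l2_integrable_mult_cnj)

lemma l2_inner_cmult_left: "l2_inner N (\<lambda>x. a * f x) h = a * l2_inner N f h"
  unfolding l2_inner_def by (simp add: mult.assoc)

lemma l2_inner_cmult_right: "l2_inner N h (\<lambda>x. a * f x) = cnj a * l2_inner N h f"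
  by (subst (1 2) l2_inner_cnj) (simp add: l2_inner_cmult_left)

lemma l2_inner_add_right:
  assumes "f \<in> l2 N" "g \<in> l2 N" "h \<in> l2 N"
  shows "l2_inner N h (\<lambda>x. f x + g x) = l2_inner N h f + l2_inner N h g"
  by (subst (1 2 3) l2_inner_cnj) (simp add: l2_inner_add_left assms)

lemma l2_inner_diff_left:
  "f \<in> l2 N \<Longrightarrow> g \<in> l2 N \<Longrightarrow> h \<in> l2 N \<Longrightarrow>
     l2_inner N (\<lambda>x. f x - g x) h = l2_inner N f h - l2_inner N g h"
  unfolding l2_inner_def by (simp add: left_diff_distrib l2_integrable_mult_cnj)

lemma l2_inner_diff_right:
  assumes "f \<in> l2 N" "g \<in> l2 N" "h \<in> l2 N"
  shows "l2_inner N h (\<lambda>x. f x - g x) = l2_inner N h f - l2_inner N h g"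
  by (subst (1 2 3) l2_inner_cnj) (simp add: l2_inner_diff_left assms)

lemma l2_inner_zero_left: "l2_inner N (\<lambda>x. 0) f = 0"
  by (simp add: l2_inner_def)

lemma l2_inner_sum_left:
  assumes "\<And>i. i \<in> J \<Longrightarrow> f i \<in> l2 N" "h \<in> l2 N"
  shows "l2_inner N (\<lambda>x. \<Sum>i\<in>J. f i x) h = (\<Sum>i\<in>J. l2_inner N (f i) h)"
  using assms by (induction J rule: infinite_finite_induct) (auto simp: l2_inner_zero_left l2_inner_add_left l2_sum)

section \<open>The seminorm and the Cauchy-Schwarz inequality\<close>

lemma l2_norm_nonneg: "0 \<le> l2_norm N f"
  by (simp add: l2_norm_def)

lemma l2_norm_power2: "(l2_norm N f)\<^sup>2 = (LINT x|N. (norm (f x))\<^sup>2)"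
  unfolding l2_norm_def by (rule real_sqrt_pow2) (simp add: integral_nonneg_AE)

lemma l2_inner_self: "l2_inner N f f = of_real ((l2_norm N f)\<^sup>2)"
proof -
  have "l2_inner N f f = (LINT x|N. of_real ((norm (f x))\<^sup>2))"
    unfolding l2_inner_def by (intro Bochner_Integration.integral_cong) (simp_all only: complex_norm_square)
  then show ?thesis
    by (simp add: l2_norm_power2 del: of_real_power)
qed

lemma l2_norm_zero_iff:
  assumes "f \<in> l2 N"
  shows "l2_norm N f = 0 \<longleftrightarrow> (AE x in N. f x = 0)"
  using integral_nonneg_eq_0_iff_AE[of N "\<lambda>x. (norm (f x))\<^sup>2"] assms
  by (simp add: l2_norm_def l2_def)

text \<open>Nonnegativity of the squared norm of \<open>f - (a / q) g\<close>, the part of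
  \<open>f\<close> orthogonal to \<open>g\<close>: it equals the squared norm of \<open>f\<close>
  minus \<open>(norm a)\<^sup>2 / q\<close>.\<close>

lemma l2_cauchy_schwarz:
  assumes f: "f \<in> l2 N" and g: "g \<in> l2 N"
  shows "norm (l2_inner N f g) \<le> l2_norm N f * l2_norm N g"
proof (cases "l2_norm N g = 0")
  case True
  \<comment> \<open>Norm zero only makes \<open>g\<close> a null function, so the product vanishes
    almost everywhere.\<close>
  then have "AE x in N. f x * cnj (g x) = 0"
    using l2_norm_zero_iff[OF g] by auto
  then have "l2_inner N f g = 0"
    unfolding l2_inner_def using f g
    by (subst integral_cong_AE[where g = "\<lambda>_. 0"]) (auto simp: l2_def)
  with True show ?thesis by simp
next
  case False
  define a where "a = l2_inner N f g"
  define q where "q = (l2_norm N g)\<^sup>2"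
  have q: "q > 0" using False by (simp add: q_def)
  let ?h = "\<lambda>x. f x - (a / of_real q) * g x"
  have h: "(\<lambda>x. (a / of_real q) * g x) \<in> l2 N"
    by (rule l2_cmult[OF g])
  have "l2_inner N ?h ?h =
      l2_inner N f f - cnj (a / of_real q) * a - (a / of_real q) * cnj a
        + (a / of_real q) * cnj (a / of_real q) * of_real q"
    unfolding l2_inner_diff_left[OF f h l2_diff[OF f h]] l2_inner_diff_right[OF f h f]
      l2_inner_diff_right[OF f h g] l2_inner_cmult_left l2_inner_cmult_right
      l2_inner_cnj[of N g f] l2_inner_self[of N g] a_def[symmetric] q_def[symmetric]
    by (simp add: algebra_simps)
  also have "\<dots> = of_real ((l2_norm N f)\<^sup>2 - (norm a)\<^sup>2 / q)"
    using q by (simp add: l2_inner_self complex_norm_square divide_simps mult.commute del: of_real_power)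
  finally have "(l2_norm N ?h)\<^sup>2 = (l2_norm N f)\<^sup>2 - (norm a)\<^sup>2 / q"
    unfolding l2_inner_self of_real_eq_iff .
  then have "(norm a)\<^sup>2 / q \<le> (l2_norm N f)\<^sup>2"
    using zero_le_power2[of "l2_norm N ?h"] by linarith
  then have "(norm a)\<^sup>2 \<le> (l2_norm N f * l2_norm N g)\<^sup>2"
    using q by (simp add: q_def divide_simps power_mult_distrib)
  then show ?thesis
    unfolding a_def by (rule power2_le_imp_le) (simp add: l2_norm_nonneg)
qed

text \<open>Cauchy-Schwarz applied to \<open>u k - f\<close>. Convergence of inner products is all
  that the later limit arguments take from \<open>l2_converges\<close>.\<close>

lemma l2_converges_inner:
  assumes "l2_converges N u f" "g \<in> l2 N"
  shows "(\<lambda>k. l2_inner N (u k) g) \<longlonglongrightarrow> l2_inner N f g"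
proof (rule Lim_null[THEN iffD2, OF Lim_null_comparison])
  show "\<forall>\<^sub>F k in sequentially.
      norm (l2_inner N (u k) g - l2_inner N f g) \<le> l2_norm N (\<lambda>x. u k x - f x) * l2_norm N g"
    using assms l2_cauchy_schwarz[of "\<lambda>x. u _ x - f x" N g]
    by (auto simp: l2_converges_def l2_diff l2_inner_diff_left[symmetric])
  show "(\<lambda>k. l2_norm N (\<lambda>x. u k x - f x) * l2_norm N g) \<longlonglongrightarrow> 0"
    using assms by (intro tendsto_mult_left_zero) (auto simp: l2_converges_def)
qed

section \<open>Closures of graphs and symmetric operators\<close>

lemma l2_converges_const: "f \<in> l2 N \<Longrightarrow> l2_converges N (\<lambda>k. f) f"
  by (auto simp: l2_converges_def l2_norm_def)

text \<open>Constant sequences. Membership in \<open>l2\<close> must be supplied because the graph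
  may relate arbitrary functions; the set closed in \<open>quotient_operator\<close> carries no such
  condition.\<close>

lemma l2_closure_superset:
  "(f, g) \<in> A \<Longrightarrow> f \<in> l2 N \<Longrightarrow> g \<in> l2 N \<Longrightarrow> (f, g) \<in> l2_closure N A"
  unfolding l2_closure_def using l2_converges_const by fastforce

lemma l2_closure_subset_l2: "(f, g) \<in> l2_closure N A \<Longrightarrow> f \<in> l2 N \<and> g \<in> l2 N"
  by (auto simp: l2_closure_def l2_converges_def)

text \<open>With \<open>\<epsilon> = 1\<close> this is symmetry, with \<open>\<epsilon> = - 1\<close> antisymmetry.\<close>

definition l2_symmetric :: "'a measure \<Rightarrow> complex \<Rightarrow> 'a l2_operator \<Rightarrow> bool" where
  "l2_symmetric N \<epsilon> A \<longleftrightarrow>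
     (\<forall>(f, g)\<in>A. \<forall>(f', g')\<in>A. f \<in> l2 N \<longrightarrow> g \<in> l2 N \<longrightarrow> f' \<in> l2 N \<longrightarrow> g' \<in> l2 N \<longrightarrow>
        l2_inner N g f' = \<epsilon> * l2_inner N f g')"

lemma l2_symmetricD:
  "l2_symmetric N \<epsilon> A \<Longrightarrow> (f, g) \<in> A \<Longrightarrow> (f', g') \<in> A \<Longrightarrow> f \<in> l2 N \<Longrightarrow> g \<in> l2 N \<Longrightarrow>
     f' \<in> l2 N \<Longrightarrow> g' \<in> l2 N \<Longrightarrow> l2_inner N g f' = \<epsilon> * l2_inner N f g'"
  unfolding l2_symmetric_def by fast

text \<open>The limits are taken one pair at a time, so that continuity of the inner product in each
  slot is enough: with \<open>(u k, v k)\<close> fixed the second pair tends to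
  \<open>(f', g')\<close>, and then \<open>k\<close> tends to infinity.\<close>

lemma l2_symmetric_closure:
  assumes A: "l2_symmetric N \<epsilon> A"
  shows "l2_symmetric N \<epsilon> (l2_closure N A)"
  unfolding l2_symmetric_def
proof (safe)
  fix f g f' g'
  assume "(f, g) \<in> l2_closure N A" "(f', g') \<in> l2_closure N A"
  then obtain u v u' v' where A_uv: "\<And>k. (u k, v k) \<in> A" "\<And>k. (u' k, v' k) \<in> A"
    and conv: "l2_converges N u f" "l2_converges N v g" "l2_converges N u' f'" "l2_converges N v' g'"
    unfolding l2_closure_def by blast
  have mem: "u k \<in> l2 N" "v k \<in> l2 N" "u' k \<in> l2 N" "v' k \<in> l2 N" "f' \<in> l2 N" "g' \<in> l2 N" for k
    using conv by (auto simp: l2_converges_def)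
  have right: "(\<lambda>k. l2_inner N w (a k)) \<longlonglongrightarrow> l2_inner N w b" if "l2_converges N a b" "w \<in> l2 N" for w a b
    using tendsto_cnj[OF l2_converges_inner[OF that]] unfolding l2_inner_cnj[symmetric] .
  have 1: "l2_inner N (v k) f' = \<epsilon> * l2_inner N (u k) g'" for k
  proof -
    have "(\<lambda>m. l2_inner N (v k) (u' m)) \<longlonglongrightarrow> l2_inner N (v k) f'"
      "(\<lambda>m. \<epsilon> * l2_inner N (u k) (v' m)) \<longlonglongrightarrow> \<epsilon> * l2_inner N (u k) g'"
      using conv mem by (auto intro!: right tendsto_intros)
    moreover have "l2_inner N (v k) (u' m) = \<epsilon> * l2_inner N (u k) (v' m)" for m
      using l2_symmetricD[OF A A_uv(1,2)] mem by auto
    ultimately show ?thesis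
      using LIMSEQ_unique by auto
  qed
  have "(\<lambda>k. l2_inner N (v k) f') \<longlonglongrightarrow> l2_inner N g f'"
    "(\<lambda>k. \<epsilon> * l2_inner N (u k) g') \<longlonglongrightarrow> \<epsilon> * l2_inner N f g'"
    using conv mem by (auto intro!: l2_converges_inner tendsto_intros)
  then show "l2_inner N g f' = \<epsilon> * l2_inner N f g'"
    unfolding 1 using LIMSEQ_unique by auto
qed

text \<open>Moving \<open>A\<close> across the inner product gives \<mu> times it equal to \<nu>
  times it; no conjugate appears because eigenvalues are real by definition.\<close>

lemma l2_symmetric_eigenvector_inner:
  assumes A: "l2_symmetric N 1 A" and f: "eigenvector N A \<mu> f" and g: "eigenvector N A \<nu> g"
  shows "\<mu> = \<nu> \<or> l2_inner N f g = 0"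
proof -
  have "of_real \<mu> * l2_inner N f g = of_real \<nu> * l2_inner N f g"
    using l2_symmetricD[OF A, of f "\<lambda>x. of_real \<mu> * f x" g "\<lambda>x. of_real \<nu> * g x"] f g
    by (auto simp: eigenvector_def l2_cmult l2_inner_cmult_left l2_inner_cmult_right)
  then show ?thesis by auto
qed

text \<open>The part of \<open>l2_orthonormal_basis\<close> that Bessel's inequality needs. It also
  serves for finite sets of functions indexed by themselves, as they occur in
  \<open>eigen_multiplicity\<close>.\<close>

definition l2_orthonormal :: "'a measure \<Rightarrow> 'i set \<Rightarrow> ('i \<Rightarrow> 'a \<Rightarrow> complex) \<Rightarrow> bool" where
  "l2_orthonormal N I e \<longleftrightarrow>
     (\<forall>i\<in>I. e i \<in> l2 N) \<and> (\<forall>i\<in>I. \<forall>j\<in>I. l2_inner N (e i) (e j) = (if i = j then 1 else 0))"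

lemma l2_orthonormal_subset: "l2_orthonormal N I e \<Longrightarrow> J \<subseteq> I \<Longrightarrow> l2_orthonormal N J e"
  unfolding l2_orthonormal_def by (metis subsetD)

text \<open>Completing the square in the coefficients. The Fourier coefficients give Bessel's
  inequality; general \<open>a\<close> is needed for Parseval, because density in
  \<open>l2_orthonormal_basis\<close> provides approximating coefficients of unknown form.\<close>

lemma l2_norm_orthonormal_expansion:
  assumes e: "l2_orthonormal N J e" and f: "f \<in> l2 N" and "finite J"
  shows "(l2_norm N (\<lambda>x. f x - (\<Sum>i\<in>J. a i * e i x)))\<^sup>2 =
    (l2_norm N f)\<^sup>2 - (\<Sum>i\<in>J. (norm (l2_inner N f (e i)))\<^sup>2) + (\<Sum>i\<in>J. (norm (a i - l2_inner N f (e i)))\<^sup>2)"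
proof -
  let ?s = "\<lambda>x. \<Sum>i\<in>J. a i * e i x"
  let ?c = "\<lambda>i. l2_inner N f (e i)"
  have mem: "\<And>i. i \<in> J \<Longrightarrow> e i \<in> l2 N" and s: "?s \<in> l2 N"
    using e by (auto simp: l2_orthonormal_def intro!: l2_sum l2_cmult)
  have sl: "l2_inner N ?s h = (\<Sum>i\<in>J. a i * l2_inner N (e i) h)" if "h \<in> l2 N" for h
    using l2_inner_sum_left[of J "\<lambda>i x. a i * e i x" N h] mem that by (simp add: l2_cmult l2_inner_cmult_left)
  have sf: "l2_inner N ?s f = (\<Sum>i\<in>J. a i * cnj (?c i))"
    using sl[OF f] l2_inner_cnj[of N _ f] by (simp cong: sum.cong)
  have "l2_inner N ?s (e j) = a j" if "j \<in> J" for j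
  proof -
    have "l2_inner N ?s (e j) = (\<Sum>i\<in>J. if i = j then a i else 0)"
      unfolding sl[OF mem[OF that]] using e that by (intro sum.cong) (auto simp: l2_orthonormal_def)
    also have "\<dots> = a j" using \<open>finite J\<close> that by simp
    finally show ?thesis .
  qed
  then have "l2_inner N (e j) ?s = cnj (a j)" if "j \<in> J" for j
    using that l2_inner_cnj[of N "e j" ?s] by simp
  then have ss: "l2_inner N ?s ?s = (\<Sum>i\<in>J. a i * cnj (a i))"
    by (simp add: sl[OF s])
  have "l2_inner N (\<lambda>x. f x - ?s x) (\<lambda>x. f x - ?s x) =
      l2_inner N f f - cnj (l2_inner N ?s f) - l2_inner N ?s f + l2_inner N ?s ?s"
    using f s by (simp add: l2_inner_diff_left l2_inner_diff_right l2_diff l2_inner_cnj[of N f ?s])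
  also have "\<dots> = of_real ((l2_norm N f)\<^sup>2 - (\<Sum>i\<in>J. (norm (?c i))\<^sup>2) + (\<Sum>i\<in>J. (norm (a i - ?c i))\<^sup>2))"
    unfolding sf ss unfolding l2_inner_self
    by (simp add: complex_norm_square sum.distrib sum_subtractf algebra_simps del: of_real_power)
  finally show ?thesis
    unfolding l2_inner_self of_real_eq_iff .
qed

lemma l2_bessel_finite:
  assumes e: "l2_orthonormal N J e" and f: "f \<in> l2 N" and "finite J"
  shows "(\<Sum>i\<in>J. (norm (l2_inner N f (e i)))\<^sup>2) \<le> (l2_norm N f)\<^sup>2"
  using l2_norm_orthonormal_expansion[OF assms, of "\<lambda>i. l2_inner N f (e i)"]
    zero_le_power2[of "l2_norm N (\<lambda>x. f x - (\<Sum>i\<in>J. l2_inner N f (e i) * e i x))"] by simp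

section \<open>Sums over counting measures\<close>

lemma sum_le_nn_integral_count_space:
  fixes g :: "'i \<Rightarrow> ennreal"
  assumes "finite J" "J \<subseteq> I"
  shows "sum g J \<le> (\<integral>\<^sup>+i. g i \<partial>count_space I)"
proof -
  have "sum g J = (\<integral>\<^sup>+i. g i * indicator J i \<partial>count_space I)"
    using assms by (subst nn_integral_indicator_finite) (auto intro!: sum.cong simp: subset_iff)
  also have "\<dots> \<le> (\<integral>\<^sup>+i. g i \<partial>count_space I)"
    by (intro nn_integral_mono) (auto split: split_indicator)
  finally show ?thesis .
qed

text \<open>If \<open>C\<close> is finite, a simple function \<open>h\<close> below \<open>g\<close>
  is nonzero at finitely many points only: a nonzero value taken infinitely often would push finite
  sums past \<open>C\<close>. So the integral of \<open>h\<close> is a finite sum, for index sets of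
  any cardinality.\<close>

lemma nn_integral_count_space_leI:
  fixes g :: "'i \<Rightarrow> ennreal"
  assumes le: "\<And>J. finite J \<Longrightarrow> J \<subseteq> I \<Longrightarrow> sum g J \<le> C"
  shows "(\<integral>\<^sup>+i. g i \<partial>count_space I) \<le> C"
proof (cases "C = \<infinity>")
  case False
  show ?thesis
    unfolding nn_integral_def
  proof (rule SUP_least, safe)
    fix h assume h: "simple_function (count_space I) h" "h \<le> g"
    have fin: "finite {x\<in>I. h x = y}" if "y \<noteq> 0" for y
    proof (rule ccontr)
      assume inf: "infinite {x\<in>I. h x = y}"
      have "of_nat n * y \<le> C" for n
      proof -
        obtain J where J: "J \<subseteq> {x\<in>I. h x = y}" "finite J" "card J = n"
          using infinite_arbitrarily_large[OF inf] by blast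
        then have "of_nat n * y = sum h J" by (auto simp: sum_constant[symmetric] intro!: sum.cong simp del: sum_constant)
        also have "\<dots> \<le> sum g J" using h(2) by (intro sum_mono) (auto simp: le_fun_def)
        also have "\<dots> \<le> C" using J by (intro le) auto
        finally show ?thesis .
      qed
      then have "(SUP n. of_nat n) * y \<le> C"
        by (simp add: SUP_mult_right_ennreal SUP_le_iff)
      then show False
        using that False by (simp add: ennreal_SUP_of_nat_eq_top ennreal_top_mult top_unique)
    qed
    have "{x\<in>I. h x \<noteq> 0} = (\<Union>y\<in>h ` I - {0}. {x\<in>I. h x = y})" by auto
    then have fin': "finite {x\<in>I. h x \<noteq> 0}"
      using h(1) fin by auto
    have "integral\<^sup>S (count_space I) h = (\<integral>\<^sup>+i. h i \<partial>count_space I)"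
      by (rule nn_integral_eq_simple_integral[symmetric, OF h(1)])
    also have "\<dots> = sum h {x\<in>I. h x \<noteq> 0}"
      using fin' by (intro nn_integral_count_space') auto
    also have "\<dots> \<le> sum g {x\<in>I. h x \<noteq> 0}"
      using h(2) by (intro sum_mono) (auto simp: le_fun_def)
    also have "\<dots> \<le> C" using fin' by (intro le) auto
    finally show "integral\<^sup>S (count_space I) h \<le> C" .
  qed
qed auto

text \<open>Both sides are the least upper bound of the finite partial sums. The Schatten norm is an
  \<open>infsum\<close>, whereas exchanges and regroupings are done with integrals.\<close>

lemma infsum_ennreal_eq_nn_integral:
  fixes g :: "'i \<Rightarrow> ennreal"
  shows "infsum g I = (\<integral>\<^sup>+i. g i \<partial>count_space I)"
  unfolding nonneg_infsum_complete[OF zero_le]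
  by (intro antisym SUP_least nn_integral_count_space_leI SUP_upper)
    (auto intro: sum_le_nn_integral_count_space)

text \<open>Tonelli for arbitrary index sets: once these are encoded by indicators, both iterated
  sums become the sum over all pairs.\<close>

lemma nn_integral_count_space_swap:
  fixes f :: "'i \<Rightarrow> 'j \<Rightarrow> ennreal"
  shows "(\<integral>\<^sup>+i. \<integral>\<^sup>+j. f i j \<partial>count_space J \<partial>count_space I) = (\<integral>\<^sup>+j. \<integral>\<^sup>+i. f i j \<partial>count_space I \<partial>count_space J)"
proof -
  let ?g = "\<lambda>(i, j). f i j * indicator I i * indicator J j"
  have "(\<integral>\<^sup>+i. \<integral>\<^sup>+j. f i j \<partial>count_space J \<partial>count_space I) =
      (\<integral>\<^sup>+i. (\<integral>\<^sup>+j. f i j * indicator J j \<partial>count_space UNIV) * indicator I i \<partial>count_space UNIV)"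
    by (simp add: nn_integral_count_space_indicator)
  also have "\<dots> = (\<integral>\<^sup>+i. \<integral>\<^sup>+j. ?g (i, j) \<partial>count_space UNIV \<partial>count_space UNIV)"
    by (simp add: nn_integral_cmult[symmetric] ac_simps)
  also have "\<dots> = (\<integral>\<^sup>+j. \<integral>\<^sup>+i. ?g (i, j) \<partial>count_space UNIV \<partial>count_space UNIV)"
    unfolding nn_integral_fst_count_space nn_integral_snd_count_space ..
  also have "\<dots> = (\<integral>\<^sup>+j. (\<integral>\<^sup>+i. f i j * indicator I i \<partial>count_space UNIV) * indicator J j \<partial>count_space UNIV)"
    by (simp add: nn_integral_multc[symmetric])
  also have "\<dots> = (\<integral>\<^sup>+j. \<integral>\<^sup>+i. f i j \<partial>count_space I \<partial>count_space J)"
    by (simp add: nn_integral_count_space_indicator)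
  finally show ?thesis .
qed

text \<open>Writing \<open>g (h i)\<close> as the sum over \<open>j\<close> of \<open>g j\<close> at
  \<open>h i = j\<close> and exchanging the sums collects the terms by fibres;
  \<open>emeasure\<close> counts a fibre and allows it to be infinite.\<close>

lemma nn_integral_count_space_fibres:
  fixes g :: "'j \<Rightarrow> ennreal"
  shows "(\<integral>\<^sup>+i. g (h i) \<partial>count_space I) =
    (\<integral>\<^sup>+j. emeasure (count_space UNIV) {i\<in>I. h i = j} * g j \<partial>count_space UNIV)"
proof -
  have "(\<integral>\<^sup>+i. g (h i) \<partial>count_space I) = (\<integral>\<^sup>+i. \<integral>\<^sup>+j. g j * indicator {h i} j \<partial>count_space UNIV \<partial>count_space I)"
    by (simp add: nn_integral_indicator_singleton)
  also have "\<dots> = (\<integral>\<^sup>+j. \<integral>\<^sup>+i. g j * indicator {h i} j \<partial>count_space I \<partial>count_space UNIV)"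
    by (rule nn_integral_count_space_swap)
  also have "\<dots> = (\<integral>\<^sup>+j. emeasure (count_space UNIV) {i\<in>I. h i = j} * g j \<partial>count_space UNIV)"
  proof (rule nn_integral_cong)
    fix j
    show "(\<integral>\<^sup>+i. g j * indicator {h i} j \<partial>count_space I) = emeasure (count_space UNIV) {i\<in>I. h i = j} * g j"
    proof -
      have "(\<integral>\<^sup>+i. g j * indicator {h i} j \<partial>count_space I) = (\<integral>\<^sup>+i. g j * indicator {i\<in>I. h i = j} i \<partial>count_space UNIV)"
      by (auto simp: nn_integral_count_space_indicator intro!: nn_integral_cong split: split_indicator)
      then show ?thesis by (simp add: nn_integral_cmult_indicator mult.commute)
    qed
  qed
  finally show ?thesis .
qed

section \<open>Bessel and Parseval\<close>

lemma l2_bessel: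
  assumes e: "l2_orthonormal N I e" and f: "f \<in> l2 N"
  shows "(\<integral>\<^sup>+i. ennreal ((norm (l2_inner N f (e i)))\<^sup>2) \<partial>count_space I) \<le> ennreal ((l2_norm N f)\<^sup>2)"
  using l2_bessel_finite[OF l2_orthonormal_subset[OF e] f]
  by (intro nn_integral_count_space_leI) (simp add: sum_ennreal ennreal_leI)

lemma l2_orthonormal_basis_imp_orthonormal:
  "l2_orthonormal_basis N V I e \<Longrightarrow> V \<subseteq> l2 N \<Longrightarrow> l2_orthonormal N I e"
  by (auto simp: l2_orthonormal_basis_def l2_orthonormal_def)

text \<open>One half is Bessel. For the other, an approximation with squared error at most
  \<epsilon> leaves, by the expansion formula, at most \<epsilon> between the squared norm and a
  finite partial sum: coefficients other than the Fourier ones only enlarge the error.\<close>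

lemma l2_parseval:
  assumes e: "l2_orthonormal_basis N V I e" and V: "V \<subseteq> l2 N" and f: "f \<in> V"
  shows "(\<integral>\<^sup>+i. ennreal ((norm (l2_inner N f (e i)))\<^sup>2) \<partial>count_space I) = ennreal ((l2_norm N f)\<^sup>2)"
proof (rule antisym)
  have on: "l2_orthonormal N I e" and f': "f \<in> l2 N"
    using e V f by (auto intro: l2_orthonormal_basis_imp_orthonormal)
  show "(\<integral>\<^sup>+i. ennreal ((norm (l2_inner N f (e i)))\<^sup>2) \<partial>count_space I) \<le> ennreal ((l2_norm N f)\<^sup>2)"
    by (rule l2_bessel[OF on f'])
  show "ennreal ((l2_norm N f)\<^sup>2) \<le> (\<integral>\<^sup>+i. ennreal ((norm (l2_inner N f (e i)))\<^sup>2) \<partial>count_space I)"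
  proof (rule ennreal_le_epsilon)
    fix \<epsilon> :: real assume "\<epsilon> > 0"
    then obtain J a where J: "finite J" "J \<subseteq> I" and a: "l2_norm N (\<lambda>x. f x - (\<Sum>i\<in>J. a i * e i x)) < sqrt \<epsilon>"
      using e f unfolding l2_orthonormal_basis_def by (metis real_sqrt_gt_zero)
    let ?S = "\<Sum>i\<in>J. (norm (l2_inner N f (e i)))\<^sup>2"
    have "(l2_norm N (\<lambda>x. f x - (\<Sum>i\<in>J. a i * e i x)))\<^sup>2 \<le> \<epsilon>"
      using a \<open>\<epsilon> > 0\<close> power_mono[OF less_imp_le[OF a] l2_norm_nonneg, of 2] by simp
    then have "(l2_norm N f)\<^sup>2 \<le> ?S + \<epsilon>"
      using l2_norm_orthonormal_expansion[OF l2_orthonormal_subset[OF on J(2)] f' J(1), of a]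
        sum_nonneg[of J "\<lambda>i. (norm (a i - l2_inner N f (e i)))\<^sup>2"] by auto
    then have "ennreal ((l2_norm N f)\<^sup>2) \<le> ennreal ?S + ennreal \<epsilon>"
      using \<open>\<epsilon> > 0\<close> by (simp add: ennreal_plus[symmetric] sum_nonneg ennreal_leI del: ennreal_plus)
    also have "ennreal ?S \<le> (\<integral>\<^sup>+i. ennreal ((norm (l2_inner N f (e i)))\<^sup>2) \<partial>count_space I)"
      using sum_le_nn_integral_count_space[OF J, of "\<lambda>i. ennreal ((norm (l2_inner N f (e i)))\<^sup>2)"]
      by (simp add: sum_ennreal)
    finally show "ennreal ((l2_norm N f)\<^sup>2) \<le> (\<integral>\<^sup>+i. ennreal ((norm (l2_inner N f (e i)))\<^sup>2) \<partial>count_space I) + ennreal \<epsilon>"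
      by (simp add: add_right_mono)
  qed
qed

section \<open>Diagonalizable symmetric operators and their Green operators\<close>

lemma l2_orthogonal_subset: "l2_orthogonal N V \<subseteq> l2 N"
  by (auto simp: l2_orthogonal_def)

lemma l2_norm_orthonormal:
  assumes "l2_orthonormal N I e" "i \<in> I"
  shows "l2_norm N (e i) = 1"
proof -
  have "of_real ((l2_norm N (e i))\<^sup>2) = (1 :: complex)"
    using assms unfolding l2_inner_self[symmetric] by (simp add: l2_orthonormal_def)
  then have "(l2_norm N (e i))\<^sup>2 = 1"
    by (simp only: of_real_eq_1_iff)
  then show ?thesis
    using l2_norm_nonneg[of N "e i"] by (simp add: power2_eq_1_iff)
qed

lemma l2_inner_cong_AE:
  assumes "AE x in N. f x = f' x" "f \<in> l2 N" "f' \<in> l2 N" "g \<in> l2 N"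
  shows "l2_inner N f g = l2_inner N f' g"
  unfolding l2_inner_def using assms by (intro integral_cong_AE) (auto simp: l2_def)

text \<open>Orthogonality for the eigenvalues \<mu> and 0, proved directly because kernel elements
  may be null functions, which \<open>eigenvector\<close> excludes.\<close>

lemma eigenvector_ne0_orthogonal_kernel:
  assumes A: "l2_symmetric N 1 A" and f: "eigenvector N A \<mu> f" and "\<mu> \<noteq> 0"
  shows "f \<in> l2_orthogonal N (l2_kernel N A)"
  unfolding l2_orthogonal_def
proof safe
  show "f \<in> l2 N" using f by (simp add: eigenvector_def)
  fix g assume "g \<in> l2_kernel N A"
  then have "l2_inner N (\<lambda>x. of_real \<mu> * f x) g = 0"
    using l2_symmetricD[OF A, of f "\<lambda>x. of_real \<mu> * f x" g "\<lambda>x. 0"] f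
    by (auto simp: eigenvector_def l2_kernel_def l2_cmult l2_zero l2_inner_def)
  then show "l2_inner N f g = 0" using \<open>\<mu> \<noteq> 0\<close> by (simp add: l2_inner_cmult_left)
qed

text \<open>Here \<open>b\<close> and \<open>lam\<close> stand for an explicitly known eigenbasis of
  the whole space, \<open>e\<close> and \<open>ev\<close> for an unspecified one of the complement
  of the kernel. The two lists are linked only through the symmetry of \<open>A\<close>.\<close>

locale diagonalized_operator =
  fixes N :: "'a measure" and A :: "'a l2_operator"
    and I :: "'i set" and b :: "'i \<Rightarrow> 'a \<Rightarrow> complex" and lam :: "'i \<Rightarrow> real"
    and e :: "nat \<Rightarrow> 'a \<Rightarrow> complex" and ev :: "nat \<Rightarrow> real"
  assumes symmetric: "l2_symmetric N 1 A"
    and basis: "l2_orthonormal_basis N (l2 N) I b"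
    and basis_eigenvector: "\<And>i. i \<in> I \<Longrightarrow> eigenvector N A (lam i) (b i)"
    and range_basis: "l2_orthonormal_basis N (l2_orthogonal N (l2_kernel N A)) UNIV e"
    and range_eigenvector: "\<And>l. eigenvector N A (ev l) (e l)"
    and ev_nonzero: "\<And>l. ev l \<noteq> 0"
begin

lemma orthonormal_b: "l2_orthonormal N I b"
  using basis by (rule l2_orthonormal_basis_imp_orthonormal) simp

lemma orthonormal_e: "l2_orthonormal N UNIV e"
  using range_basis l2_orthogonal_subset by (rule l2_orthonormal_basis_imp_orthonormal)

lemma e_orthogonal: "e l \<in> l2_orthogonal N (l2_kernel N A)"
  using range_basis by (auto simp: l2_orthonormal_basis_def)

lemma e_mem: "e l \<in> l2 N"
  using e_orthogonal l2_orthogonal_subset by blast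

lemma parseval_e:
  "f \<in> l2_orthogonal N (l2_kernel N A) \<Longrightarrow>
    (\<integral>\<^sup>+l. ennreal ((norm (l2_inner N f (e l)))\<^sup>2) \<partial>count_space UNIV) = ennreal ((l2_norm N f)\<^sup>2)"
  using l2_parseval[OF range_basis l2_orthogonal_subset] .

lemma parseval_b:
  "f \<in> l2 N \<Longrightarrow>
    (\<integral>\<^sup>+i. ennreal ((norm (l2_inner N f (b i)))\<^sup>2) \<partial>count_space I) = ennreal ((l2_norm N f)\<^sup>2)"
  using l2_parseval[OF basis order_refl] .

lemma inner_e_b: "i \<in> I \<Longrightarrow> l2_inner N (e l) (b i) \<noteq> 0 \<Longrightarrow> ev l = lam i"
  using l2_symmetric_eigenvector_inner[OF symmetric range_eigenvector basis_eigenvector] by blast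

text \<open>
  Both sides equal the double sum of \<open>g (ev l) * \<bar>\<langle>e l, b i\<rangle>\<bar>\<^sup>2\<close>, whose terms vanish unless
  \<open>ev l = lam i\<close>.
\<close>

lemma sum_ev_eq_sum_lam:
  fixes g :: "real \<Rightarrow> ennreal"
  shows "(\<integral>\<^sup>+l. g (ev l) \<partial>count_space UNIV) = (\<integral>\<^sup>+i. (if lam i = 0 then 0 else g (lam i)) \<partial>count_space I)"
proof -
  let ?c = "\<lambda>l i. ennreal ((norm (l2_inner N (e l) (b i)))\<^sup>2)"
  \<comment> \<open>\<open>?g\<close> agrees with \<open>g\<close> at the nonzero
    \<open>ev l\<close>; the value 0 at 0 removes the \<open>b i\<close> in the kernel, which
    \<open>e\<close> does not expand. The factor inserted next is the Parseval sum 1 of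
    \<open>e l\<close> in the basis \<open>b\<close>.\<close>
  let ?g = "\<lambda>x. if x = 0 then 0 else g x"
  have "(\<integral>\<^sup>+l. g (ev l) \<partial>count_space UNIV) = (\<integral>\<^sup>+l. \<integral>\<^sup>+i. ?g (ev l) * ?c l i \<partial>count_space I \<partial>count_space UNIV)"
    using parseval_b[OF e_mem] l2_norm_orthonormal[OF orthonormal_e] ev_nonzero
    by (simp add: nn_integral_cmult)
  also have "\<dots> = (\<integral>\<^sup>+i. \<integral>\<^sup>+l. ?g (ev l) * ?c l i \<partial>count_space UNIV \<partial>count_space I)"
    by (rule nn_integral_count_space_swap)
  also have "\<dots> = (\<integral>\<^sup>+i. ?g (lam i) \<partial>count_space I)"
  proof (intro nn_integral_cong)
    fix i assume "i \<in> space (count_space I)"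
    then have i: "i \<in> I" by simp
    have "(\<integral>\<^sup>+l. ?g (ev l) * ?c l i \<partial>count_space UNIV) = (\<integral>\<^sup>+l. ?g (lam i) * ?c l i \<partial>count_space UNIV)"
      using inner_e_b[OF i] by (intro nn_integral_cong) (metis norm_zero ennreal_0 mult_zero_right zero_power2)
    also have "\<dots> = ?g (lam i) * (\<integral>\<^sup>+l. ?c l i \<partial>count_space UNIV)"
      by (simp add: nn_integral_cmult)
    also have "\<dots> = ?g (lam i)"
    \<comment> \<open>Only for nonzero \<open>lam i\<close> is \<open>b i\<close> known to be
      orthogonal to the kernel, so that Parseval in \<open>e\<close> applies.\<close>
    proof (cases "lam i = 0")
      case False
      have "(\<integral>\<^sup>+l. ?c l i \<partial>count_space UNIV) = 1"
        using parseval_e[OF eigenvector_ne0_orthogonal_kernel[OF symmetric basis_eigenvector[OF i] False]]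
          l2_norm_orthonormal[OF orthonormal_b i]
        by (subst l2_inner_cnj) simp
      then show ?thesis by simp
    qed simp
    finally show "(\<integral>\<^sup>+l. ?g (ev l) * ?c l i \<partial>count_space UNIV) = ?g (lam i)" .
  qed
  finally show ?thesis .
qed

text \<open>The body of \<open>green_op\<close> for abstract \<open>N\<close> and \<open>A\<close>;
  for the Heisenberg quotient the two agree by unfolding.\<close>

definition green :: "'a l2_operator" where
  "green = {(f, g). f \<in> l2 N \<and>
     (\<exists>h\<in>l2_kernel N A. \<exists>u\<in>l2_orthogonal N (l2_kernel N A). (AE x in N. f x = h x + u x) \<and>
        l2_converges N (\<lambda>k x. \<Sum>l<k. l2_inner N u (e l) / of_real (ev l) * e l x) g)}"

lemma partial_sum_inner:
  assumes "w \<in> l2 N"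
  shows "l2_inner N (\<lambda>x. \<Sum>l<k. c l * e l x) w = (\<Sum>l<k. c l * l2_inner N (e l) w)"
  using l2_inner_sum_left[of "{..<k}" "\<lambda>l x. c l * e l x" N w] assms
  by (simp add: l2_cmult e_mem l2_inner_cmult_left)

text \<open>The partial sums are orthogonal to the kernel component \<open>h\<close> of
  \<open>f\<close>, hence so is their limit, a nonzero multiple of \<open>f\<close>; this makes
  \<open>h\<close> null. Up to null sets \<open>f\<close> thus lies in the complement of the kernel,
  where Parseval in \<open>e\<close> holds, and comparing coefficients leaves only those with
  \<open>inverse (ev l) = \<mu>\<close>.\<close>

lemma green_eigenvector_expansion:
  assumes f: "eigenvector N green \<mu> f" and "\<mu> \<noteq> 0"
  shows "(\<integral>\<^sup>+l. ennreal ((norm (l2_inner N f (e l)))\<^sup>2) \<partial>count_space UNIV) = ennreal ((l2_norm N f)\<^sup>2)"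
    and "l2_inner N f (e l) \<noteq> 0 \<Longrightarrow> inverse (ev l) = \<mu>"
proof -
  obtain h u where f_mem: "f \<in> l2 N" and h: "h \<in> l2_kernel N A"
    and u: "u \<in> l2_orthogonal N (l2_kernel N A)" and f_eq: "AE x in N. f x = h x + u x"
    and conv: "l2_converges N (\<lambda>k x. \<Sum>l<k. l2_inner N u (e l) / of_real (ev l) * e l x) (\<lambda>x. of_real \<mu> * f x)"
    using f unfolding eigenvector_def green_def by auto
  have h_mem: "h \<in> l2 N" and u_mem: "u \<in> l2 N"
    using h u by (auto simp: l2_kernel_def l2_orthogonal_def)
  have hu: "l2_inner N h w = 0" if "w \<in> l2_orthogonal N (l2_kernel N A)" for w
    using that h by (subst l2_inner_cnj) (auto simp: l2_orthogonal_def)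
  have split: "l2_inner N f w = l2_inner N h w + l2_inner N u w" if "w \<in> l2 N" for w
    using l2_inner_cong_AE[OF f_eq f_mem _ that] that h_mem u_mem
    by (simp add: l2_add l2_inner_add_left)
  have lim: "(\<lambda>k. \<Sum>l<k. l2_inner N u (e l) / of_real (ev l) * l2_inner N (e l) w) \<longlonglongrightarrow> of_real \<mu> * l2_inner N f w"
    if "w \<in> l2 N" for w
    using l2_converges_inner[OF conv that] unfolding partial_sum_inner[OF that] l2_inner_cmult_left .
  have "l2_inner N (e l) h = 0" for l
    using e_orthogonal h by (auto simp: l2_orthogonal_def)
  then have "of_real \<mu> * l2_inner N f h = 0"
    using LIMSEQ_unique[OF lim[OF h_mem], of 0] by simp
  then have "l2_inner N h h = 0"
    using split[OF h_mem] u h \<open>\<mu> \<noteq> 0\<close> by (auto simp: l2_orthogonal_def)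
  then have "l2_norm N h = 0"
    by (simp add: l2_inner_self)
  then have fu: "AE x in N. f x = u x"
    using l2_norm_zero_iff[OF h_mem] f_eq by auto
  have f_u: "l2_inner N f w = l2_inner N u w" if "w \<in> l2 N" for w
    using l2_inner_cong_AE[OF fu f_mem u_mem that] .
  have "l2_norm N f = l2_norm N u"
    unfolding l2_norm_def using fu f_mem u_mem
    by (intro arg_cong[where f = sqrt] integral_cong_AE) (auto simp: l2_def)
  then show "(\<integral>\<^sup>+l. ennreal ((norm (l2_inner N f (e l)))\<^sup>2) \<partial>count_space UNIV) = ennreal ((l2_norm N f)\<^sup>2)"
    using parseval_e[OF u] f_u[OF e_mem] by simp
  \<comment> \<open>Tested against \<open>e l\<close>, the partial sums are constant from index
    \<open>Suc l\<close> on.\<close>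
  have "l2_inner N u (e l) / of_real (ev l) = of_real \<mu> * l2_inner N f (e l)" for l
  proof (rule LIMSEQ_unique[OF _ lim[OF e_mem]])
    have "(\<Sum>m<k. l2_inner N u (e m) / of_real (ev m) * l2_inner N (e m) (e l)) = l2_inner N u (e l) / of_real (ev l)"
      if "k > l" for k
    proof -
      have "(\<Sum>m<k. l2_inner N u (e m) / of_real (ev m) * l2_inner N (e m) (e l)) =
          (\<Sum>m<k. if m = l then l2_inner N u (e l) / of_real (ev l) else 0)"
        using orthonormal_e by (intro sum.cong) (auto simp: l2_orthonormal_def)
      then show ?thesis using that by simp
    qed
    then show "(\<lambda>k. \<Sum>m<k. l2_inner N u (e m) / of_real (ev m) * l2_inner N (e m) (e l))
        \<longlonglongrightarrow> l2_inner N u (e l) / of_real (ev l)"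
      by (intro tendsto_eventually eventually_sequentiallyI[of "Suc l"]) auto
  qed
  from this[of l] show "inverse (ev l) = \<mu>" if "l2_inner N f (e l) \<noteq> 0"
    using that ev_nonzero[of l] unfolding f_u[OF e_mem]
    by (simp add: field_simps) (metis of_real_eq_iff of_real_mult of_real_1)
qed

text \<open>With kernel component 0 and \<open>u = e l\<close> the Green series has a single nonzero
  term. The hypothesis is explicit because the graph \<open>A\<close> is an abstract set of pairs,
  so its kernel need not contain the zero function.\<close>

lemma e_green_eigenvector:
  assumes "(\<lambda>x. 0) \<in> l2_kernel N A"
  shows "eigenvector N green (inverse (ev l)) (e l)"
proof -
  let ?g = "\<lambda>x. of_real (inverse (ev l)) * e l x"
  have "(\<Sum>m<k. l2_inner N (e l) (e m) / of_real (ev m) * e m x) = ?g x" if "k > l" for k x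
  proof -
    have "(\<Sum>m<k. l2_inner N (e l) (e m) / of_real (ev m) * e m x) = (\<Sum>m<k. if m = l then ?g x else 0)"
      using orthonormal_e by (intro sum.cong) (auto simp: l2_orthonormal_def divide_inverse)
    then show ?thesis using that by simp
  qed
  then have "eventually (\<lambda>k. l2_norm N (\<lambda>x. (\<Sum>m<k. l2_inner N (e l) (e m) / of_real (ev m) * e m x) - ?g x) = 0) sequentially"
    by (intro eventually_sequentiallyI[of "Suc l"]) (simp add: l2_norm_def)
  then have "l2_converges N (\<lambda>k x. \<Sum>m<k. l2_inner N (e l) (e m) / of_real (ev m) * e m x) ?g"
    unfolding l2_converges_def
    by (intro conjI allI l2_sum l2_cmult e_mem tendsto_eventually)
  then have "(e l, ?g) \<in> green"
    unfolding green_def mem_Collect_eq prod.case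
    by (intro conjI e_mem, rule_tac bexI[OF _ assms], rule_tac bexI[OF _ e_orthogonal[of l]]) simp
  then show ?thesis
    using l2_norm_orthonormal[OF orthonormal_e, of l] by (simp add: eigenvector_def e_mem)
qed

text \<open>A finite orthonormal set \<open>S\<close> of eigenvectors is counted by the double sum
  of squared coefficients: each \<open>f\<close> contributes 1 by Parseval, while each
  \<open>l\<close> contributes at most 1 by Bessel and nothing outside \<open>?L\<close>. Conversely
  the \<open>e l\<close> with \<open>l\<close> in \<open>?L\<close> are orthonormal eigenvectors.
  This avoids dimensions of spaces modulo null functions.\<close>

lemma green_multiplicity:
  assumes "(\<lambda>x. 0) \<in> l2_kernel N A" and "\<mu> \<noteq> 0"
  shows "eigen_multiplicity N green \<mu> = emeasure (count_space UNIV) {l. inverse (ev l) = \<mu>}"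
proof (rule antisym)
  let ?L = "{l. inverse (ev l) = \<mu>}"
  show "eigen_multiplicity N green \<mu> \<le> emeasure (count_space UNIV) ?L"
    unfolding eigen_multiplicity_def
  proof (rule SUP_least, safe)
    fix S assume S: "finite S" and eig: "\<forall>f\<in>S. eigenvector N green \<mu> f"
      and on: "\<forall>f\<in>S. \<forall>g\<in>S. l2_inner N f g = (if f = g then 1 else 0)"
    have ons: "l2_orthonormal N S (\<lambda>f. f)"
      using eig on by (auto simp: l2_orthonormal_def eigenvector_def)
    let ?c = "\<lambda>f l. ennreal ((norm (l2_inner N f (e l)))\<^sup>2)"
    have "of_nat (card S) = (\<Sum>f\<in>S. \<integral>\<^sup>+l. ?c f l \<partial>count_space UNIV)"
    proof -
      have "(\<integral>\<^sup>+l. ?c f l \<partial>count_space UNIV) = 1" if "f \<in> S" for f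
        using green_eigenvector_expansion(1)[of \<mu> f] eig that \<open>\<mu> \<noteq> 0\<close> l2_norm_orthonormal[OF ons that] by simp
      then show ?thesis by simp
    qed
    also have "\<dots> = (\<integral>\<^sup>+l. (\<Sum>f\<in>S. ?c f l) \<partial>count_space UNIV)"
      by (rule nn_integral_sum[symmetric]) simp
    also have "\<dots> \<le> (\<integral>\<^sup>+l. indicator ?L l \<partial>count_space UNIV)"
    proof (rule nn_integral_mono)
      fix l
      show "(\<Sum>f\<in>S. ?c f l) \<le> indicator ?L l"
      proof (cases "l \<in> ?L")
        case True
        have "(\<Sum>f\<in>S. (norm (l2_inner N (e l) f))\<^sup>2) \<le> 1"
          using l2_bessel_finite[OF ons e_mem[of l] S] l2_norm_orthonormal[OF orthonormal_e, of l] by simp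
        moreover have "norm (l2_inner N (e l) f) = norm (l2_inner N f (e l))" for f
          by (subst l2_inner_cnj) simp
        ultimately show ?thesis
          using True by (simp add: sum_ennreal ennreal_le_1)
      next
        case False
        then have "l2_inner N f (e l) = 0" if "f \<in> S" for f
          using green_eigenvector_expansion(2)[of \<mu> f l] eig that \<open>\<mu> \<noteq> 0\<close> by auto
        then show ?thesis by simp
      qed
    qed
    also have "\<dots> = emeasure (count_space UNIV) ?L" by simp
    finally show "of_nat (card S) \<le> emeasure (count_space UNIV) ?L" .
  qed
  have card_le: "of_nat (card J) \<le> eigen_multiplicity N green \<mu>" if J: "finite J" "J \<subseteq> ?L" for J
  proof -
    \<comment> \<open>Multiplicity counts sets of functions, so distinct indices must give distinct
      functions: equal ones would have inner product both 0 and 1.\<close>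
    have inj: "inj e"
      using orthonormal_e by (auto simp: l2_orthonormal_def inj_def) (metis zero_neq_one)
    then have "card (e ` J) = card J"
      by (meson card_image inj_on_subset subset_UNIV)
    moreover have "of_nat (card (e ` J)) \<le> eigen_multiplicity N green \<mu>"
      unfolding eigen_multiplicity_def
      using J e_green_eigenvector[OF assms(1)] orthonormal_e inj
      by (intro SUP_upper) (auto simp: l2_orthonormal_def inj_eq)
    ultimately show ?thesis by simp
  qed
  have "emeasure (count_space UNIV) ?L = (\<integral>\<^sup>+l. 1 \<partial>count_space ?L)"
    by (subst nn_integral_count_space_indicator) simp_all
  also have "\<dots> \<le> eigen_multiplicity N green \<mu>"
    using card_le by (intro nn_integral_count_space_leI) simp
  finally show "emeasure (count_space UNIV) ?L \<le> eigen_multiplicity N green \<mu>" .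
qed

text \<open>The sum over eigenvalues with multiplicity is regrouped into a sum over the index
  \<open>l\<close> and then transferred to the known list \<open>lam\<close>.\<close>

lemma green_schatten_sum:
  assumes zero: "(\<lambda>x. 0) \<in> l2_kernel N A"
  shows "(\<Sum>\<^sub>\<infinity>\<mu>\<in>{\<mu>. \<exists>f. eigenvector N green \<mu> f}. eigen_multiplicity N green \<mu> * ennreal (\<mu> powr r)) =
    (\<integral>\<^sup>+i. (if lam i = 0 then 0 else ennreal (inverse (lam i) powr r)) \<partial>count_space I)"
proof -
  let ?E = "{\<mu>. \<exists>f. eigenvector N green \<mu> f}"
  have "(\<Sum>\<^sub>\<infinity>\<mu>\<in>?E. eigen_multiplicity N green \<mu> * ennreal (\<mu> powr r)) =
      (\<integral>\<^sup>+\<mu>. eigen_multiplicity N green \<mu> * ennreal (\<mu> powr r) * indicator ?E \<mu> \<partial>count_space UNIV)"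
    by (simp add: infsum_ennreal_eq_nn_integral nn_integral_count_space_indicator)
  also have "\<dots> = (\<integral>\<^sup>+\<mu>. emeasure (count_space UNIV) {l\<in>UNIV. inverse (ev l) = \<mu>} * ennreal (\<mu> powr r) \<partial>count_space UNIV)"
  proof (rule nn_integral_cong)
    fix \<mu>
    show "eigen_multiplicity N green \<mu> * ennreal (\<mu> powr r) * indicator ?E \<mu> =
        emeasure (count_space UNIV) {l\<in>UNIV. inverse (ev l) = \<mu>} * ennreal (\<mu> powr r)"
    \<comment> \<open>At \<mu> = 0 both sides vanish because \<open>0 powr r\<close> is 0; at a
      number that is no eigenvalue the fibre of \<open>ev\<close> is empty.\<close>
    proof (cases "\<mu> \<in> ?E")
      case True
      then show ?thesis
        using green_multiplicity[OF zero, of \<mu>] by (cases "\<mu> = 0") simp_all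
    next
      case False
      then have "{l. inverse (ev l) = \<mu>} = {}"
        using e_green_eigenvector[OF zero] by auto
      then show ?thesis using False by simp
    qed
  qed
  also have "\<dots> = (\<integral>\<^sup>+l. ennreal (inverse (ev l) powr r) \<partial>count_space UNIV)"
    by (rule nn_integral_count_space_fibres[symmetric])
  also have "\<dots> = (\<integral>\<^sup>+i. (if lam i = 0 then 0 else ennreal (inverse (lam i) powr r)) \<partial>count_space I)"
    by (rule sum_ev_eq_sum_lam)
  finally show ?thesis .
qed

end

section \<open>Smooth functions\<close>

lemma C_infinity_differentiable: "C_infinity f \<Longrightarrow> f differentiable at x"
  using C_k.simps(2)[of 0 f] unfolding C_infinity_def by metis

lemma C_infinity_continuous: "C_infinity f \<Longrightarrow> continuous_on UNIV f"
  unfolding C_infinity_def by (metis C_k.simps(1))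

lemma C_infinity_derivative: "C_infinity f \<Longrightarrow> C_infinity (\<lambda>x. frechet_derivative f (at x) v)"
  unfolding C_infinity_def using C_k.simps(2) by metis

lemma C_infinity_has_derivative:
  "C_infinity f \<Longrightarrow> (f has_derivative frechet_derivative f (at x)) (at x)"
  using C_infinity_differentiable frechet_derivative_works by blast

text \<open>\<open>frechet_derivative\<close> is a choice operator; uniqueness of derivatives
  replaces it by the explicit \<open>f'\<close>.\<close>

lemma C_k_SucI:
  assumes "\<And>x. (f has_derivative f' x) (at x)" and "\<And>v. C_k n (\<lambda>x. f' x v)"
  shows "C_k (Suc n) f"
proof -
  have "frechet_derivative f (at x) = f' x" for x
    using frechet_derivative_at[OF assms(1)] by simp
  then show ?thesis
    using assms by (auto simp: differentiable_def)
qed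

lemma C_infinity_zero: "C_infinity (\<lambda>x. 0)"
proof -
  have "C_k n (\<lambda>x::'a. 0)" for n
    by (induction n) (auto intro!: C_k_SucI[where f' = "\<lambda>_ _. 0"] simp del: C_k.simps(2))
  then show ?thesis by (simp add: C_infinity_def)
qed

lemma C_k_add: "C_k n f \<Longrightarrow> C_k n g \<Longrightarrow> C_k n (\<lambda>x. f x + g x)"
proof (induction n arbitrary: f g)
  case 0
  then show ?case by (auto intro: continuous_intros)
next
  case (Suc n)
  have "(f has_derivative frechet_derivative f (at x)) (at x)"
    "(g has_derivative frechet_derivative g (at x)) (at x)" for x
    using Suc.prems by (simp_all add: frechet_derivative_works)
  then show ?case
    using Suc.prems by (intro C_k_SucI[OF has_derivative_add] Suc.IH) auto
qed

lemma C_infinity_add: "C_infinity f \<Longrightarrow> C_infinity g \<Longrightarrow> C_infinity (\<lambda>x. f x + g x)"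
  by (simp add: C_infinity_def C_k_add)

lemma C_infinity_cmult:
  fixes f :: "'a::real_normed_vector \<Rightarrow> complex"
  assumes "C_infinity f"
  shows "C_infinity (\<lambda>x. c * f x)"
proof -
  have step: "C_infinity f \<Longrightarrow> C_k n (\<lambda>x. c * f x)" for n f
  proof (induction n arbitrary: f)
    case 0
    then show ?case using C_infinity_continuous[OF 0] by (auto intro!: continuous_intros)
  next
    case (Suc n)
    show ?case
      by (rule C_k_SucI[OF has_derivative_mult_right[OF C_infinity_has_derivative[OF Suc.prems]]])
        (intro Suc.IH C_infinity_derivative Suc.prems)
  qed
  show ?thesis unfolding C_infinity_def using step[OF assms] by blast
qed

text \<open>Left-invariant fields have coefficients linear in the point, so this product rule is
  enough to keep them within smooth functions. The derivative is \<open>l\<close> times a derivative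
  of \<open>f\<close> plus a constant multiple of \<open>f\<close>, which closes the
  induction.\<close>

lemma C_infinity_linear_mult:
  fixes f :: "'a::real_normed_vector \<Rightarrow> complex" and l :: "'a \<Rightarrow> real"
  assumes "C_infinity f" and l: "bounded_linear l"
  shows "C_infinity (\<lambda>x. of_real (l x) * f x)"
proof -
  have step: "C_infinity f \<Longrightarrow> C_k n (\<lambda>x. of_real (l x) * f x)" for n f
  proof (induction n arbitrary: f)
    case 0
    then show ?case
      using C_infinity_continuous[OF 0] by (auto intro!: continuous_intros linear_continuous_on[OF l])
  next
    case (Suc n)
    let ?f' = "\<lambda>x v. of_real (l x) * frechet_derivative f (at x) v + of_real (l v) * f x"
    show ?case
    proof (rule C_k_SucI)
      show "((\<lambda>x. of_real (l x) * f x) has_derivative ?f' x) (at x)" for x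
        by (rule has_derivative_mult[OF has_derivative_of_real[OF bounded_linear_imp_has_derivative[OF l]]
              C_infinity_has_derivative[OF Suc.prems]])
      show "C_k n (\<lambda>x. ?f' x v)" for v
        using C_infinity_cmult[OF Suc.prems, of "of_real (l v)"]
        by (intro C_k_add Suc.IH C_infinity_derivative Suc.prems) (simp add: C_infinity_def)
    qed
  qed
  show ?thesis unfolding C_infinity_def using step[OF assms(1)] by blast
qed

section \<open>Translations of the Heisenberg group\<close>

lemma heis_mult:
  "x \<otimes>\<^bsub>heis \<kappa>\<^esub> y = (fst x + fst y, snd x + snd y + \<kappa> * Im (\<Sum>j\<in>UNIV. fst x $ j * cnj (fst y $ j)))"
  by (simp add: heis_def case_prod_beta)

lemma carrier_heis [simp]: "carrier (heis \<kappa>) = UNIV"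
  by (simp add: heis_def)

lemma one_heis [simp]: "\<one>\<^bsub>heis \<kappa>\<^esub> = 0"
  by (simp add: heis_def zero_prod_def)

lemmas heis_assoc = monoid.m_assoc[OF group.is_monoid[OF group_heis], simplified]
lemmas heis_l_inv = group.l_inv[OF group_heis, simplified]
lemmas heis_r_inv = group.r_inv[OF group_heis, simplified]
lemmas heis_l_one = monoid.l_one[OF group.is_monoid[OF group_heis], simplified]
lemmas heis_r_one = monoid.r_one[OF group.is_monoid[OF group_heis], simplified]

lemma heis_inv_cancel:
  "inv\<^bsub>heis \<kappa>\<^esub> g \<otimes>\<^bsub>heis \<kappa>\<^esub> (g \<otimes>\<^bsub>heis \<kappa>\<^esub> x) = x" "g \<otimes>\<^bsub>heis \<kappa>\<^esub> (inv\<^bsub>heis \<kappa>\<^esub> g \<otimes>\<^bsub>heis \<kappa>\<^esub> x) = x"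
  "(x \<otimes>\<^bsub>heis \<kappa>\<^esub> g) \<otimes>\<^bsub>heis \<kappa>\<^esub> inv\<^bsub>heis \<kappa>\<^esub> g = x"
  "(x \<otimes>\<^bsub>heis \<kappa>\<^esub> inv\<^bsub>heis \<kappa>\<^esub> g) \<otimes>\<^bsub>heis \<kappa>\<^esub> g = x"
     apply (simp add: heis_assoc[symmetric] heis_l_inv heis_l_one)
    apply (simp add: heis_assoc[symmetric] heis_r_inv heis_l_one)
   apply (simp add: heis_assoc heis_r_inv heis_r_one)
  apply (simp add: heis_assoc heis_l_inv heis_r_one)
  done

lemma continuous_on_heis_mult [continuous_intros]:
  fixes f g :: "'a::topological_space \<Rightarrow> ('d::finite) heis"
  assumes "continuous_on S f" "continuous_on S g"
  shows "continuous_on S (\<lambda>x. f x \<otimes>\<^bsub>heis \<kappa>\<^esub> g x)"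
  unfolding heis_mult using assms by (intro continuous_intros) auto

lemma nn_integral_lborel_translate:
  fixes g :: "'a::euclidean_space \<Rightarrow> ennreal"
  assumes [measurable]: "g \<in> borel_measurable borel"
  shows "(\<integral>\<^sup>+y. g (c + y) \<partial>lborel) = (\<integral>\<^sup>+y. g y \<partial>lborel)"
proof -
  have "(\<integral>\<^sup>+y. g y \<partial>lborel) = (\<integral>\<^sup>+y. g y \<partial>distr lborel borel ((+) c))"
    by (simp add: lborel_distr_plus)
  also have "\<dots> = (\<integral>\<^sup>+y. g (c + y) \<partial>lborel)"
    by (rule nn_integral_distr) auto
  finally show ?thesis by simp
qed

text \<open>By Fubini: for a fixed first coordinate the real one is translated by a constant, and
  then the first one by \<open>a\<close>. Left and right Heisenberg translations both have this
  form.\<close>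

lemma lborel_distr_shear:
  fixes q :: "'a::euclidean_space \<Rightarrow> real"
  assumes q: "q \<in> borel_measurable borel"
  shows "distr lborel borel (\<lambda>x. (a + fst x, q (fst x) + snd x)) = lborel"
proof (rule measure_eqI)
  note [measurable] = q
  let ?S = "\<lambda>x. (a + fst x, q (fst x) + snd x)"
  fix A assume "A \<in> sets (distr lborel borel ?S)"
  then have A': "A \<in> sets borel" by simp
  then have A [measurable]: "A \<in> sets (borel \<Otimes>\<^sub>M borel)" unfolding borel_prod .
  have S: "?S \<in> borel \<rightarrow>\<^sub>M borel"
    unfolding borel_prod[symmetric] by measurable
  have "emeasure (distr lborel borel ?S) A = (\<integral>\<^sup>+x. indicator A x \<partial>distr lborel borel ?S)"
    using A' by simp
  also have "\<dots> = (\<integral>\<^sup>+x. indicator A (?S x) \<partial>lborel)"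
    using S A' by (intro nn_integral_distr) auto
  also have "\<dots> = (\<integral>\<^sup>+z. \<integral>\<^sup>+t. indicator A (?S (z, t)) \<partial>lborel \<partial>lborel)"
    unfolding lborel_prod[symmetric] by (subst lborel.nn_integral_fst[symmetric]) simp_all
  also have "\<dots> = (\<integral>\<^sup>+z. \<integral>\<^sup>+t. indicator A (a + z, t) \<partial>lborel \<partial>lborel)"
  proof (rule nn_integral_cong)
    fix z
    show "(\<integral>\<^sup>+t. indicator A (?S (z, t)) \<partial>lborel) = (\<integral>\<^sup>+t. indicator A (a + z, t) \<partial>lborel)"
      using nn_integral_lborel_translate[of "\<lambda>t. indicator A (a + z, t)" "q z"] by simp
  qed
  also have "\<dots> = (\<integral>\<^sup>+z. \<integral>\<^sup>+t. indicator A (z, t) \<partial>lborel \<partial>lborel)"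
    by (rule nn_integral_lborel_translate) measurable
  also have "\<dots> = (\<integral>\<^sup>+x. indicator A x \<partial>lborel)"
    unfolding lborel_prod[symmetric] by (subst lborel.nn_integral_fst[symmetric]) simp_all
  finally show "emeasure (distr lborel borel ?S) A = emeasure lborel A"
    using A' by simp
qed simp

lemma lborel_distr_heis_left:
  fixes g :: "('d::finite) heis"
  shows "distr lborel borel (\<lambda>x. g \<otimes>\<^bsub>heis \<kappa>\<^esub> x) = lborel"
proof -
  let ?q = "\<lambda>z. snd g + \<kappa> * Im (\<Sum>j\<in>UNIV. fst g $ j * cnj (z $ j))"
  have "?q \<in> borel_measurable borel"
    by (intro borel_measurable_continuous_onI continuous_intros)
  from lborel_distr_shear[OF this, of "fst g"] show ?thesis
    by (simp add: heis_mult ac_simps)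
qed

lemma lborel_distr_heis_right:
  fixes g :: "('d::finite) heis"
  shows "distr lborel borel (\<lambda>x. x \<otimes>\<^bsub>heis \<kappa>\<^esub> g) = lborel"
proof -
  let ?q = "\<lambda>z. snd g + \<kappa> * Im (\<Sum>j\<in>UNIV. z $ j * cnj (fst g $ j))"
  have "?q \<in> borel_measurable borel"
    by (intro borel_measurable_continuous_onI continuous_intros)
  from lborel_distr_shear[OF this, of "fst g"] show ?thesis
    by (simp add: heis_mult ac_simps)
qed

text \<open>Each point is singled out by a member of a countable basis. Countability of the lattice
  permits exchanging the sum over it with the Lebesgue integral.\<close>

lemma countable_discrete:
  fixes S :: "'a::second_countable_topology set"
  assumes "discrete S"
  shows "countable S"
proof -
  obtain B :: "'a set set" where B: "countable B" "topological_basis B"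
    using ex_countable_basis by blast
  have "\<exists>b\<in>B. b \<inter> S = {x}" if "x \<in> S" for x
  proof -
    have "x isolated_in S" using assms that by (simp add: discrete_def)
    then obtain T where T: "open T" "T \<inter> S = {x}" by (elim isolated_inE)
    then have "x \<in> T" by blast
    then obtain b where "b \<in> B" "x \<in> b" "b \<subseteq> T"
      using topological_basisE[OF B(2) T(1)] by metis
    moreover from this T(2) that have "b \<inter> S = {x}" by blast
    ultimately show ?thesis by blast
  qed
  then obtain b where b: "\<And>x. x \<in> S \<Longrightarrow> b x \<in> B \<and> b x \<inter> S = {x}" by metis
  then have "inj_on b S" by (intro inj_onI) (metis singleton_inject)
  moreover have "countable (b ` S)" using b B(1) by (meson countable_subset image_subsetI)
  ultimately show ?thesis by (rule countable_image_inj_on[rotated])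
qed

section \<open>Integration over the quotient\<close>

definition invariant :: "real \<Rightarrow> ('d::finite) heis set \<Rightarrow> ('d heis \<Rightarrow> 'b) \<Rightarrow> bool" where
  "invariant \<kappa> \<Gamma> w \<longleftrightarrow> (\<forall>g\<in>\<Gamma>. \<forall>x. w (g \<otimes>\<^bsub>heis \<kappa>\<^esub> x) = w x)"

lemma invariantD: "invariant \<kappa> \<Gamma> w \<Longrightarrow> g \<in> \<Gamma> \<Longrightarrow> w (g \<otimes>\<^bsub>heis \<kappa>\<^esub> x) = w x"
  unfolding invariant_def by blast

text \<open>No fundamental domain is fixed here, because a given one has to be compared with its
  right translates.\<close>

locale heis_lattice_domain =
  fixes \<kappa> :: real and \<Gamma> :: "('d::finite) heis set"
  assumes lattice: "heis_lattice \<kappa> \<Gamma>"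
begin

abbreviation mult (infixl "\<odot>" 70) where "x \<odot> y \<equiv> x \<otimes>\<^bsub>heis \<kappa>\<^esub> y"
abbreviation proj where "proj x \<equiv> \<Gamma> #>\<^bsub>heis \<kappa>\<^esub> x"

lemma subgroup: "subgroup \<Gamma> (heis \<kappa>)" and discrete: "discrete \<Gamma>"
  and compact: "compact_space (heis_quotient_topology \<kappa> \<Gamma>)"
  using lattice by (auto simp: heis_lattice_def)

lemma countable_\<Gamma>: "countable \<Gamma>"
  by (rule countable_discrete[OF discrete])

lemma inv_mem: "g \<in> \<Gamma> \<Longrightarrow> inv\<^bsub>heis \<kappa>\<^esub> g \<in> \<Gamma>"
  using subgroup.m_inv_closed[OF subgroup] .

lemma bij_inv: "bij_betw (\<lambda>g. inv\<^bsub>heis \<kappa>\<^esub> g) \<Gamma> \<Gamma>"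
  by (rule bij_betw_byWitness[where f' = "\<lambda>g. inv\<^bsub>heis \<kappa>\<^esub> g"])
    (auto simp: inv_mem group.inv_inv[OF group_heis])

lemma proj_mult: "g \<in> \<Gamma> \<Longrightarrow> proj (g \<odot> x) = proj x"
  using group.coset_join2[OF group_heis, of g \<kappa> \<Gamma>] group.coset_mult_assoc[OF group_heis, of \<Gamma> \<kappa> g x]
  by (simp add: subgroup)

lemma proj_eqD: "proj x = proj y \<Longrightarrow> \<exists>g\<in>\<Gamma>. y = g \<odot> x"
proof -
  assume "proj x = proj y"
  moreover have "y \<in> proj y"
    using group.rcos_self[OF group_heis _ subgroup, of y] by simp
  ultimately have "y \<in> proj x" by simp
  then show ?thesis unfolding r_coset_def by blast
qed

lemma borel_left [measurable]: "(\<lambda>x. g \<odot> x) \<in> borel \<rightarrow>\<^sub>M borel"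
  by (intro borel_measurable_continuous_onI continuous_intros)

lemma borel_right [measurable]: "(\<lambda>x. x \<odot> g) \<in> borel \<rightarrow>\<^sub>M borel"
  by (intro borel_measurable_continuous_onI continuous_intros)

text \<open>Substituting \<open>y = g x\<close> in the term of index \<open>g\<close>.\<close>

lemma unfolding_identity:
  assumes [measurable]: "A \<in> sets borel" "B \<in> sets borel"
  shows "(\<integral>\<^sup>+x. indicator A x * (\<integral>\<^sup>+g. indicator B (g \<odot> x) \<partial>count_space \<Gamma>) \<partial>lborel) =
    (\<integral>\<^sup>+y. indicator B y * (\<integral>\<^sup>+g. indicator A (g \<odot> y) \<partial>count_space \<Gamma>) \<partial>lborel)"
proof -
  have *: "(\<integral>\<^sup>+x. indicator A x * (\<integral>\<^sup>+g. indicator B (g \<odot> x) \<partial>count_space \<Gamma>) \<partial>lborel) =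
      (\<integral>\<^sup>+g. \<integral>\<^sup>+x. indicator A x * indicator B (g \<odot> x) \<partial>lborel \<partial>count_space \<Gamma>)"
    if [measurable]: "A \<in> sets borel" "B \<in> sets borel" for A B :: "'d heis set"
  proof -
    have "(\<integral>\<^sup>+x. indicator A x * (\<integral>\<^sup>+g. indicator B (g \<odot> x) \<partial>count_space \<Gamma>) \<partial>lborel) =
        (\<integral>\<^sup>+x. \<integral>\<^sup>+g. indicator A x * indicator B (g \<odot> x) \<partial>count_space \<Gamma> \<partial>lborel)"
      by (rule nn_integral_cong, rule nn_integral_cmult[symmetric]) simp
    also have "\<dots> = (\<integral>\<^sup>+g. \<integral>\<^sup>+x. indicator A x * indicator B (g \<odot> x) \<partial>lborel \<partial>count_space \<Gamma>)"
      by (rule nn_integral_count_space_nn_integral[OF countable_\<Gamma>]) measurable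
    finally show ?thesis .
  qed
  have "(\<integral>\<^sup>+x. indicator A x * (\<integral>\<^sup>+g. indicator B (g \<odot> x) \<partial>count_space \<Gamma>) \<partial>lborel) =
      (\<integral>\<^sup>+g. \<integral>\<^sup>+x. indicator A x * indicator B (g \<odot> x) \<partial>lborel \<partial>count_space \<Gamma>)"
    by (rule *) measurable
  also have "\<dots> = (\<integral>\<^sup>+g. \<integral>\<^sup>+y. indicator B y * indicator A (inv\<^bsub>heis \<kappa>\<^esub> g \<odot> y) \<partial>lborel \<partial>count_space \<Gamma>)"
  proof (rule nn_integral_cong)
    fix g
    have "(\<integral>\<^sup>+y. indicator B y * indicator A (inv\<^bsub>heis \<kappa>\<^esub> g \<odot> y) \<partial>lborel) =
        (\<integral>\<^sup>+y. indicator B y * indicator A (inv\<^bsub>heis \<kappa>\<^esub> g \<odot> y) \<partial>distr lborel borel (\<lambda>x. g \<odot> x))"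
      by (simp add: lborel_distr_heis_left)
    also have "\<dots> = (\<integral>\<^sup>+x. indicator B (g \<odot> x) * indicator A x \<partial>lborel)"
      by (subst nn_integral_distr) (simp_all add: heis_inv_cancel)
    finally show "(\<integral>\<^sup>+x. indicator A x * indicator B (g \<odot> x) \<partial>lborel) =
        (\<integral>\<^sup>+y. indicator B y * indicator A (inv\<^bsub>heis \<kappa>\<^esub> g \<odot> y) \<partial>lborel)"
      by (simp add: mult.commute)
  qed
  also have "\<dots> = (\<integral>\<^sup>+g. \<integral>\<^sup>+y. indicator B y * indicator A (g \<odot> y) \<partial>lborel \<partial>count_space \<Gamma>)"
    by (rule nn_integral_bij_count_space[OF bij_inv])
  also have "\<dots> = (\<integral>\<^sup>+y. indicator B y * (\<integral>\<^sup>+g. indicator A (g \<odot> y) \<partial>count_space \<Gamma>) \<partial>lborel)"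
    by (rule *[symmetric]) measurable
  finally show ?thesis .
qed

lemma fundamental_domain_sum:
  assumes "fundamental_domain \<kappa> \<Gamma> F"
  shows "(\<integral>\<^sup>+g. indicator F (g \<odot> x) \<partial>count_space \<Gamma>) = 1"
proof -
  have "\<exists>!g. g \<in> \<Gamma> \<and> g \<odot> x \<in> F"
    using assms unfolding fundamental_domain_def by blast
  then obtain g where g: "g \<in> \<Gamma>" "g \<odot> x \<in> F" and u: "\<And>h. h \<in> \<Gamma> \<Longrightarrow> h \<odot> x \<in> F \<Longrightarrow> h = g"
    by (metis (no_types))
  have "(\<integral>\<^sup>+g. indicator F (g \<odot> x) \<partial>count_space \<Gamma>) = (\<Sum>g\<in>{g}. indicator F (g \<odot> x))"
  proof (rule nn_integral_count_space')
    show "indicator F (h \<odot> x) = (0 :: ennreal)" if "h \<in> \<Gamma>" "h \<notin> {g}" for h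
    proof -
      have "h \<odot> x \<notin> F" using u[OF that(1)] that(2) by blast
      then show ?thesis by simp
    qed
  qed (use g(1) in simp_all)
  then show ?thesis using g by simp
qed

lemma fundamental_domain_borel: "fundamental_domain \<kappa> \<Gamma> F \<Longrightarrow> F \<in> sets borel"
  by (simp add: fundamental_domain_def)

text \<open>On \<open>F\<close> insert the factor 1, the number of translates of the point in
  \<open>F'\<close>, and unfold. Invariance of \<open>P\<close> lets its indicator leave the sum
  over the lattice; what remains counts the translates in \<open>F\<close>, again 1.\<close>

lemma fundamental_domain_emeasure_eq:
  assumes F: "fundamental_domain \<kappa> \<Gamma> F" and F': "fundamental_domain \<kappa> \<Gamma> F'"
    and P [measurable]: "P \<in> sets borel" and inv: "invariant \<kappa> \<Gamma> (\<lambda>x. x \<in> P)"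
  shows "emeasure lborel (F \<inter> P) = emeasure lborel (F' \<inter> P)"
proof -
  note [measurable] = F[THEN fundamental_domain_borel] F'[THEN fundamental_domain_borel]
  have "emeasure lborel (F \<inter> P) =
      (\<integral>\<^sup>+x. indicator (F \<inter> P) x * (\<integral>\<^sup>+g. indicator F' (g \<odot> x) \<partial>count_space \<Gamma>) \<partial>lborel)"
    by (simp add: fundamental_domain_sum[OF F'])
  also have "\<dots> = (\<integral>\<^sup>+y. indicator F' y * (\<integral>\<^sup>+g. indicator (F \<inter> P) (g \<odot> y) \<partial>count_space \<Gamma>) \<partial>lborel)"
    by (rule unfolding_identity) measurable
  also have "\<dots> = (\<integral>\<^sup>+y. indicator F' y * (\<integral>\<^sup>+g. indicator P y * indicator F (g \<odot> y) \<partial>count_space \<Gamma>) \<partial>lborel)"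
  proof (rule nn_integral_cong)
    fix y :: "'d heis"
    have "(\<integral>\<^sup>+g. indicator (F \<inter> P) (g \<odot> y) \<partial>count_space \<Gamma>) =
        (\<integral>\<^sup>+g. indicator P y * indicator F (g \<odot> y) \<partial>count_space \<Gamma>)"
    proof (rule nn_integral_cong)
      fix g assume "g \<in> space (count_space \<Gamma>)"
      then have "g \<odot> y \<in> P \<longleftrightarrow> y \<in> P"
        using inv unfolding invariant_def space_count_space by blast
      then show "(indicator (F \<inter> P) (g \<odot> y) :: ennreal) = indicator P y * indicator F (g \<odot> y)"
        by (cases "y \<in> P"; cases "g \<odot> y \<in> F") simp_all
    qed
    then show "(indicator F' y * (\<integral>\<^sup>+g. indicator (F \<inter> P) (g \<odot> y) \<partial>count_space \<Gamma>) :: ennreal) =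
        indicator F' y * (\<integral>\<^sup>+g. indicator P y * indicator F (g \<odot> y) \<partial>count_space \<Gamma>)"
      by simp
  qed
  also have "\<dots> = (\<integral>\<^sup>+y. indicator (F' \<inter> P) y \<partial>lborel)"
  proof (rule nn_integral_cong)
    fix y :: "'d heis"
    have "(\<integral>\<^sup>+g. indicator P y * indicator F (g \<odot> y) \<partial>count_space \<Gamma>) = (indicator P y :: ennreal)"
      by (subst nn_integral_cmult) (simp_all only: fundamental_domain_sum[OF F] mult_1_right, simp)
    then show "indicator F' y * (\<integral>\<^sup>+g. indicator P y * indicator F (g \<odot> y) \<partial>count_space \<Gamma>) =
        (indicator (F' \<inter> P) y :: ennreal)"
      by (simp add: indicator_inter_arith)
  qed
  finally show ?thesis by simp
qed

text \<open>The images of the balls around 0 are open, their preimages being unions of translates,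
  and they exhaust the quotient; a finite subcover bounds the radius. Compactness is used in this
  form for finite volume, bounded invariant functions and the spanning projection.\<close>

lemma cocompact_radius:
  obtains R where "\<And>x. \<exists>g\<in>\<Gamma>. g \<odot> x \<in> cball 0 R"
proof -
  let ?X = "heis_quotient_topology \<kappa> \<Gamma>"
  have rc: "proj x \<in> rcosets\<^bsub>heis \<kappa>\<^esub> \<Gamma>" for x unfolding RCOSETS_def carrier_heis by blast
  have top: "topspace ?X = rcosets\<^bsub>heis \<kappa>\<^esub> \<Gamma>"
  proof
    show "topspace ?X \<subseteq> rcosets\<^bsub>heis \<kappa>\<^esub> \<Gamma>"
      using openin_topspace[of ?X] unfolding openin_heis_quotient_topology by blast
    show "rcosets\<^bsub>heis \<kappa>\<^esub> \<Gamma> \<subseteq> topspace ?X"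
      using rc by (intro openin_subset) (simp add: openin_heis_quotient_topology)
  qed
  let ?U = "\<lambda>n::nat. proj ` ball 0 (real n)"
  have open_U: "openin ?X (?U n)" for n
    unfolding openin_heis_quotient_topology
  proof
    have "{x. proj x \<in> ?U n} = (\<Union>g\<in>\<Gamma>. (\<lambda>x. g \<odot> x) -` ball 0 (real n))"
    proof (intro subset_antisym subsetI)
      fix x assume "x \<in> {x. proj x \<in> ?U n}"
      then obtain y where y: "proj x = proj y" "y \<in> ball 0 (real n)" by blast
      then show "x \<in> (\<Union>g\<in>\<Gamma>. (\<lambda>x. g \<odot> x) -` ball 0 (real n))"
        using proj_eqD[OF y(1)] by blast
    next
      fix x assume "x \<in> (\<Union>g\<in>\<Gamma>. (\<lambda>x. g \<odot> x) -` ball 0 (real n))"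
      then obtain g where g: "g \<in> \<Gamma>" "g \<odot> x \<in> ball 0 (real n)" by blast
      then have "proj (g \<odot> x) \<in> ?U n" by blast
      then show "x \<in> {x. proj x \<in> ?U n}" unfolding proj_mult[OF g(1)] by blast
    qed
    then show "open {x. proj x \<in> ?U n}"
      by (simp only:) (intro open_UN ballI open_vimage open_ball continuous_intros)
    show "?U n \<subseteq> rcosets\<^bsub>heis \<kappa>\<^esub> \<Gamma>" using rc by blast
  qed
  have "topspace ?X \<subseteq> \<Union>(range ?U)"
  proof
    fix C assume "C \<in> topspace ?X"
    then obtain x where "C = proj x" unfolding top RCOSETS_def by blast
    moreover obtain n where "norm x < real n" using reals_Archimedean2 by blast
    then have "x \<in> ball 0 (real n)" by simp
    ultimately show "C \<in> \<Union>(range ?U)" by blast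
  qed
  moreover have "\<forall>u\<in>range ?U. openin ?X u" using open_U by blast
  ultimately obtain \<F> where \<F>: "finite \<F>" "\<F> \<subseteq> range ?U" "topspace ?X \<subseteq> \<Union>\<F>"
    using compact[unfolded compact_space_alt, rule_format, of "range ?U"] by blast
  then obtain S where S: "finite S" "\<F> = ?U ` S"
    by (meson finite_subset_image)
  \<comment> \<open>Inserting 0 makes \<open>Max\<close> meaningful without asking whether
    \<open>S\<close> is empty.\<close>
  have "\<exists>g\<in>\<Gamma>. g \<odot> x \<in> cball 0 (real (Max (insert 0 S)))" for x
  proof -
    have "proj x \<in> topspace ?X" using rc top by simp
    then obtain n y where n: "n \<in> S" and y: "y \<in> ball 0 (real n)" "proj x = proj y"
      using \<F>(3) S(2) by blast
    have "real n \<le> real (Max (insert 0 S))" using n S by simp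
    then have "y \<in> cball 0 (real (Max (insert 0 S)))" using y(1) by simp
    then show ?thesis
      using proj_eqD[OF y(2)] by blast
  qed
  then show thesis by (rule that)
qed

text \<open>Every point of \<open>F\<close> has a translate in a fixed ball, so the volume of
  \<open>F\<close> is at most the integral over \<open>F\<close> of the number of such translates;
  unfolding turns this into the volume of the ball.\<close>

lemma finite_emeasure_fundamental_domain:
  assumes F: "fundamental_domain \<kappa> \<Gamma> F"
  shows "emeasure lborel F < \<infinity>"
proof -
  note [measurable] = F[THEN fundamental_domain_borel]
  obtain R where R: "\<And>x. \<exists>g\<in>\<Gamma>. g \<odot> x \<in> cball 0 R" by (rule cocompact_radius) blast
  let ?K = "cball 0 R :: 'd heis set"
  have "emeasure lborel F = (\<integral>\<^sup>+x. indicator F x \<partial>lborel)" by simp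
  also have "\<dots> \<le> (\<integral>\<^sup>+x. indicator F x * (\<integral>\<^sup>+g. indicator ?K (g \<odot> x) \<partial>count_space \<Gamma>) \<partial>lborel)"
  proof (rule nn_integral_mono)
    fix x
    obtain g where g: "g \<in> \<Gamma>" "g \<odot> x \<in> ?K" using R by blast
    then have "1 \<le> (\<integral>\<^sup>+g. indicator ?K (g \<odot> x) \<partial>count_space \<Gamma>)"
      using sum_le_nn_integral_count_space[of "{g}" \<Gamma> "\<lambda>g. indicator ?K (g \<odot> x)"] by simp
    then show "indicator F x \<le> indicator F x * (\<integral>\<^sup>+g. indicator ?K (g \<odot> x) \<partial>count_space \<Gamma>)"
      by (auto split: split_indicator)
  qed
  also have "\<dots> = (\<integral>\<^sup>+y. indicator ?K y * (\<integral>\<^sup>+g. indicator F (g \<odot> y) \<partial>count_space \<Gamma>) \<partial>lborel)"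
    by (rule unfolding_identity) measurable
  also have "\<dots> = emeasure lborel ?K"
    by (simp add: fundamental_domain_sum[OF F])
  also have "\<dots> < \<infinity>" by (rule emeasure_lborel_cball_finite)
  finally show ?thesis .
qed

lemma invariant_bounded:
  fixes w :: "'d heis \<Rightarrow> complex"
  assumes w: "continuous_on UNIV w" and inv: "invariant \<kappa> \<Gamma> w"
  obtains M where "\<And>x. norm (w x) \<le> M"
proof -
  obtain R where R: "\<And>x. \<exists>g\<in>\<Gamma>. g \<odot> x \<in> cball 0 R" by (rule cocompact_radius) blast
  have "compact (w ` cball 0 R)"
    using continuous_on_subset[OF w] by (intro compact_continuous_image) auto
  then obtain M where M: "\<forall>y\<in>w ` cball 0 R. norm y \<le> M"
    using compact_imp_bounded bounded_iff by blast
  have "norm (w x) \<le> M" for x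
  proof -
    obtain g where g: "g \<in> \<Gamma>" "g \<odot> x \<in> cball 0 R" using R by blast
    then have "norm (w (g \<odot> x)) \<le> M" using M by blast
    moreover have "w (g \<odot> x) = w x" using inv g(1) unfolding invariant_def by blast
    ultimately show ?thesis by simp
  qed
  then show thesis by (rule that)
qed

text \<open>If all projected lattice elements were orthogonal to some \<open>a\<close>, left
  translations would preserve the component along \<open>a\<close>, and points far out in that
  direction could not be brought into the ball. Spanning is what makes dual vectors determined by
  their integer pairings.\<close>

lemma span_projection: "span (fst ` \<Gamma>) = UNIV"
proof (rule ccontr)
  assume "span (fst ` \<Gamma>) \<noteq> UNIV"
  then obtain a where a: "a \<noteq> 0" "\<And>z. z \<in> span (fst ` \<Gamma>) \<Longrightarrow> a \<bullet> z = 0"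
    using span_not_UNIV_orthogonal by metis
  obtain R where R: "\<And>x. \<exists>g\<in>\<Gamma>. g \<odot> x \<in> cball 0 R" by (rule cocompact_radius) blast
  \<comment> \<open>Chosen so that \<open>t * norm a\<close> is \<open>\<bar>R\<bar> + 1\<close>,
    just beyond the ball.\<close>
  define t where "t = (\<bar>R\<bar> + 1) / norm a"
  obtain g where g: "g \<in> \<Gamma>" "g \<odot> (t *\<^sub>R a, 0) \<in> cball 0 R" using R[of "(t *\<^sub>R a, 0)"] by blast
  have "norm (fst g + t *\<^sub>R a) \<le> norm (g \<odot> (t *\<^sub>R a, 0))"
    unfolding heis_mult fst_conv snd_conv by (rule norm_fst_le)
  also have "\<dots> \<le> R" using g by simp
  finally have "norm (fst g + t *\<^sub>R a) \<le> R" .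
  moreover have "\<bar>R\<bar> + 1 \<le> norm (fst g + t *\<^sub>R a)"
  proof -
    have ta: "t * norm a = \<bar>R\<bar> + 1" using a(1) by (simp add: t_def)
    have "a \<bullet> fst g = 0" using g(1) by (intro a(2) span_base imageI)
    then have "(t * norm a) * norm a = a \<bullet> (fst g + t *\<^sub>R a)"
      by (simp add: inner_add_right power2_norm_eq_inner[symmetric] power2_eq_square)
    also have "\<dots> \<le> norm (fst g + t *\<^sub>R a) * norm a"
      using norm_cauchy_schwarz[of a "fst g + t *\<^sub>R a"] by (simp add: mult.commute)
    finally show ?thesis
      unfolding ta using a(1) by (simp add: mult_le_cancel_right)
  qed
  ultimately show False by linarith
qed

end

section \<open>Integration by parts\<close>

lemma invariant_mult_cnj:
  assumes "invariant \<kappa> \<Gamma> u" "invariant \<kappa> \<Gamma> w"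
  shows "invariant \<kappa> \<Gamma> (\<lambda>x. u x * cnj (w x))"
  unfolding invariant_def
  by (intro ballI allI) (simp only: invariantD[OF assms(1)] invariantD[OF assms(2)])

lemma (in heis_lattice_domain) proj_measurable:
  "proj \<in> borel \<rightarrow>\<^sub>M sigma (rcosets\<^bsub>heis \<kappa>\<^esub> \<Gamma>)
     {E. E \<subseteq> rcosets\<^bsub>heis \<kappa>\<^esub> \<Gamma> \<and> {x. proj x \<in> E} \<in> sets borel}"
proof (rule measurable_measure_of)
  show "proj \<in> space borel \<rightarrow> rcosets\<^bsub>heis \<kappa>\<^esub> \<Gamma>"
    unfolding RCOSETS_def carrier_heis by blast
qed (auto simp: vimage_def)

lemma (in heis_lattice_domain) heis_quotient_cong:
  assumes F: "fundamental_domain \<kappa> \<Gamma> F" and F': "fundamental_domain \<kappa> \<Gamma> F'"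
  shows "heis_quotient \<kappa> \<Gamma> F = heis_quotient \<kappa> \<Gamma> F'"
proof (rule measure_eqI)
  fix E assume E: "E \<in> sets (heis_quotient \<kappa> \<Gamma> F)"
  have *: "emeasure (heis_quotient \<kappa> \<Gamma> G) E = emeasure lborel (G \<inter> {x. proj x \<in> E})"
    if G: "fundamental_domain \<kappa> \<Gamma> G" for G
  proof -
    have "emeasure (heis_quotient \<kappa> \<Gamma> G) E = emeasure (restrict_space lborel G) (proj -` E \<inter> space (restrict_space lborel G))"
      using E unfolding heis_quotient_def sets_distr
      by (intro emeasure_distr measurable_restrict_space1) (simp_all add: proj_measurable)
    also have "proj -` E \<inter> space (restrict_space lborel G) = G \<inter> {x. proj x \<in> E}"
      by (auto simp: space_restrict_space)
    also have "emeasure (restrict_space lborel G) (G \<inter> {x. proj x \<in> E}) = emeasure lborel (G \<inter> {x. proj x \<in> E})"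
      using fundamental_domain_borel[OF G] by (intro emeasure_restrict_space) auto
    finally show ?thesis .
  qed
  have "proj -` E \<inter> space borel \<in> sets borel"
    using E unfolding heis_quotient_def sets_distr by (rule measurable_sets[OF proj_measurable])
  then have "{x. proj x \<in> E} \<in> sets borel" by (simp add: vimage_def)
  moreover have "invariant \<kappa> \<Gamma> (\<lambda>x. x \<in> {x. proj x \<in> E})"
    unfolding invariant_def by (simp add: proj_mult)
  ultimately show "emeasure (heis_quotient \<kappa> \<Gamma> F) E = emeasure (heis_quotient \<kappa> \<Gamma> F') E"
    unfolding *[OF F] *[OF F'] by (rule fundamental_domain_emeasure_eq[OF F F'])
qed (simp add: heis_quotient_def)

locale heis_quotient_space = heis_lattice_domain \<kappa> \<Gamma> for \<kappa> :: real and \<Gamma> :: "('d::finite) heis set" +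
  fixes F :: "'d heis set"
  assumes domain: "fundamental_domain \<kappa> \<Gamma> F"
begin

abbreviation N where "N \<equiv> heis_quotient \<kappa> \<Gamma> F"
abbreviation \<mu>F where "\<mu>F \<equiv> restrict_space lborel F"

lemma borel_\<mu>F: "w \<in> borel_measurable borel \<Longrightarrow> w \<in> borel_measurable \<mu>F"
  by (intro measurable_restrict_space1) simp

lemma finite_\<mu>F: "finite_measure \<mu>F"
  using finite_emeasure_fundamental_domain[OF domain] fundamental_domain_borel[OF domain]
  by (intro finite_measureI) (simp add: space_restrict_space emeasure_restrict_space)

lemma integral_N:
  fixes \<phi> :: "'d heis set \<Rightarrow> complex"
  assumes "\<phi> \<in> borel_measurable N"
  shows "(LINT p|N. \<phi> p) = (LINT x|\<mu>F. \<phi> (proj x))"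
  using assms unfolding heis_quotient_def
  by (intro integral_distr measurable_restrict_space1) (simp_all add: proj_measurable)

text \<open>A representative of each coset is chosen, and invariance makes the choice irrelevant. A
  set of cosets is measurable as soon as its preimage in the group is Borel, so measurability is
  inherited from \<open>w\<close>.\<close>

lemma invariant_descends:
  fixes w :: "'d heis \<Rightarrow> complex"
  assumes w: "w \<in> borel_measurable borel" and inv: "invariant \<kappa> \<Gamma> w"
  obtains \<phi> where "\<phi> \<in> borel_measurable N" "\<And>x. w x = \<phi> (proj x)"
proof -
  define \<phi> where "\<phi> = (\<lambda>p. w (SOME x. proj x = p))"
  have eq: "w x = \<phi> (proj x)" for x
  proof -
    have "proj (SOME y. proj y = proj x) = proj x" by (rule someI) (rule refl)
    then obtain g where "g \<in> \<Gamma>" "x = g \<odot> (SOME y. proj y = proj x)" using proj_eqD by blast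
    then show ?thesis using inv unfolding \<phi>_def invariant_def by metis
  qed
  have "\<phi> \<in> borel_measurable N"
  proof (rule measurableI)
    fix B :: "complex set" assume B: "B \<in> sets borel"
    have "{x. proj x \<in> \<phi> -` B \<inter> rcosets\<^bsub>heis \<kappa>\<^esub> \<Gamma>} = w -` B \<inter> space borel"
      using eq unfolding RCOSETS_def carrier_heis by auto
    then have "{x. proj x \<in> \<phi> -` B \<inter> rcosets\<^bsub>heis \<kappa>\<^esub> \<Gamma>} \<in> sets borel"
      using measurable_sets[OF w B] by simp
    then have "\<phi> -` B \<inter> rcosets\<^bsub>heis \<kappa>\<^esub> \<Gamma> \<in> sets (sigma (rcosets\<^bsub>heis \<kappa>\<^esub> \<Gamma>)
        {E. E \<subseteq> rcosets\<^bsub>heis \<kappa>\<^esub> \<Gamma> \<and> {x. proj x \<in> E} \<in> sets borel})"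
      by (intro in_measure_of) auto
    then show "\<phi> -` B \<inter> space N \<in> sets N"
      unfolding heis_quotient_def sets_distr space_distr space_measure_of_conv .
  qed simp
  then show thesis using eq by (rule that)
qed

text \<open>Right translation commutes with the left action of the lattice.\<close>

lemma fundamental_domain_translate:
  "fundamental_domain \<kappa> \<Gamma> {x. x \<odot> h \<in> F}"
  unfolding fundamental_domain_def
proof
  show "{x. x \<odot> h \<in> F} \<in> sets borel"
    using measurable_sets[OF borel_right fundamental_domain_borel[OF domain], of h] by (simp add: vimage_def)
  show "\<forall>x. \<exists>!g. g \<in> \<Gamma> \<and> g \<odot> x \<in> {x. x \<odot> h \<in> F}"
  proof
    fix x
    have "\<exists>!g. g \<in> \<Gamma> \<and> g \<odot> (x \<odot> h) \<in> F"
      using domain unfolding fundamental_domain_def by blast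
    then show "\<exists>!g. g \<in> \<Gamma> \<and> g \<odot> x \<in> {x. x \<odot> h \<in> F}"
      by (simp only: heis_assoc mem_Collect_eq)
  qed
qed

text \<open>Substitution moves the right translation from \<open>w\<close> to the domain, giving the
  integral of \<open>w\<close> over \<open>?F\<close>, that is \<open>F\<close> multiplied by
  \<open>h\<close> on the right. Being another fundamental domain it induces the same measure on the
  cosets, to which \<open>w\<close> descends.\<close>

lemma integral_right_translate:
  fixes w :: "'d heis \<Rightarrow> complex"
  assumes w [measurable]: "w \<in> borel_measurable borel" and inv: "invariant \<kappa> \<Gamma> w"
  shows "(LINT x|\<mu>F. w (x \<odot> h)) = (LINT x|\<mu>F. w x)"
proof -
  let ?h = "inv\<^bsub>heis \<kappa>\<^esub> h"
  let ?F = "{x. x \<odot> ?h \<in> F}"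
  note F [measurable] = fundamental_domain_borel[OF domain]
  note F' [measurable] = fundamental_domain_borel[OF fundamental_domain_translate[of ?h]]
  obtain \<phi> where \<phi>: "\<phi> \<in> borel_measurable N" "\<And>x. w x = \<phi> (proj x)"
    using invariant_descends[OF w inv] by metis
  interpret F': heis_quotient_space \<kappa> \<Gamma> ?F
    by unfold_locales (rule fundamental_domain_translate)
  have "(LINT x|\<mu>F. w x) = (LINT p|N. \<phi> p)"
    unfolding \<phi>(2) by (rule integral_N[OF \<phi>(1), symmetric])
  also have "\<dots> = (LINT p|F'.N. \<phi> p)"
    unfolding heis_quotient_cong[OF domain fundamental_domain_translate[of ?h]] ..
  also have "\<dots> = (LINT x|F'.\<mu>F. w x)"
    unfolding \<phi>(2) using \<phi>(1)
    by (intro F'.integral_N) (simp add: heis_quotient_cong[OF domain fundamental_domain_translate[of ?h]])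
  also have "\<dots> = (LINT x|lborel. indicator ?F x *\<^sub>R w x)"
    by (rule integral_restrict_space) simp
  also have "\<dots> = (LINT x|distr lborel borel (\<lambda>x. x \<odot> h). indicator ?F x *\<^sub>R w x)"
    by (simp only: lborel_distr_heis_right)
  also have "\<dots> = (LINT x|lborel. indicator ?F (x \<odot> h) *\<^sub>R w (x \<odot> h))"
    by (rule integral_distr) measurable
  also have "\<dots> = (LINT x|lborel. indicator F x *\<^sub>R w (x \<odot> h))"
    by (simp add: indicator_def heis_inv_cancel)
  also have "\<dots> = (LINT x|\<mu>F. w (x \<odot> h))"
    by (rule integral_restrict_space[symmetric]) simp
  finally show ?thesis by simp
qed

lemma integrable_invariant:
  fixes w :: "'d heis \<Rightarrow> complex"
  assumes w: "continuous_on UNIV w" and inv: "invariant \<kappa> \<Gamma> w"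
  shows "integrable \<mu>F w"
proof -
  obtain M where "\<And>x. norm (w x) \<le> M" using invariant_bounded[OF w inv] by metis
  then show ?thesis
    by (intro finite_measure.integrable_const_bound[OF finite_\<mu>F, of _ M] borel_\<mu>F borel_measurable_continuous_onI w) simp
qed

end

section \<open>Derivatives along one-parameter subgroups\<close>

lemma heis_mult_line:
  "x \<otimes>\<^bsub>heis \<kappa>\<^esub> (\<sigma> *\<^sub>R v) = x + \<sigma> *\<^sub>R (fst v, snd v + \<kappa> * Im (\<Sum>j\<in>UNIV. fst x $ j * cnj (fst v $ j)))"
proof -
  have "(\<Sum>j\<in>UNIV. fst x $ j * cnj ((\<sigma> *\<^sub>R fst v) $ j)) = \<sigma> *\<^sub>R (\<Sum>j\<in>UNIV. fst x $ j * cnj (fst v $ j))"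
    by (simp add: scaleR_sum_right)
  then show ?thesis
    by (cases x; cases v) (simp add: heis_mult algebra_simps)
qed

lemma heis_mult_line_0: "x \<otimes>\<^bsub>heis \<kappa>\<^esub> (0 *\<^sub>R v) = x"
  unfolding heis_mult_line by (simp only: scaleR_zero_left add_0_right)

text \<open>The central correction of \<open>v\<close> with itself is the imaginary part of a real
  number, hence 0, so lines through the origin are one-parameter subgroups.\<close>

lemma heis_mult_line_add:
  "x \<otimes>\<^bsub>heis \<kappa>\<^esub> ((\<sigma> + \<sigma>') *\<^sub>R v) = (x \<otimes>\<^bsub>heis \<kappa>\<^esub> (\<sigma> *\<^sub>R v)) \<otimes>\<^bsub>heis \<kappa>\<^esub> (\<sigma>' *\<^sub>R v)"
proof -
  have "Im (\<Sum>j\<in>UNIV. fst v $ j * cnj (fst v $ j)) = 0"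
    by (simp add: mult.commute)
  moreover have "(\<Sum>j\<in>UNIV. (fst x + \<sigma> *\<^sub>R fst v) $ j * cnj (fst v $ j)) =
      (\<Sum>j\<in>UNIV. fst x $ j * cnj (fst v $ j)) + \<sigma> *\<^sub>R (\<Sum>j\<in>UNIV. fst v $ j * cnj (fst v $ j))"
    by (simp add: scaleR_sum_right distrib_right sum.distrib)
  ultimately have "Im (\<Sum>j\<in>UNIV. (fst x + \<sigma> *\<^sub>R fst v) $ j * cnj (fst v $ j)) =
      Im (\<Sum>j\<in>UNIV. fst x $ j * cnj (fst v $ j))"
    by (simp only: plus_complex.sel scaleR_complex.sel mult_zero_right add_0_right)
  then show ?thesis
    unfolding heis_mult_line[where v = v] fst_add fst_scaleR fst_conv by (simp only: scaleR_add_left add.assoc)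
qed

text \<open>\<open>vector_derivative\<close> has a value even where no derivative exists; this
  predicate records existence. It is applied to products \<open>u * cnj w\<close>, for which full
  smoothness is not established.\<close>

definition heis_differentiable :: "real \<Rightarrow> ('d::finite) heis \<Rightarrow> ('d heis \<Rightarrow> complex) \<Rightarrow> bool" where
  "heis_differentiable \<kappa> v u \<longleftrightarrow>
     (\<forall>x. ((\<lambda>\<sigma>. u (x \<otimes>\<^bsub>heis \<kappa>\<^esub> (\<sigma> *\<^sub>R v))) has_vector_derivative heis_field \<kappa> v u x) (at 0))"

lemma heis_field_eqI:
  assumes "((\<lambda>\<sigma>. u (x \<otimes>\<^bsub>heis \<kappa>\<^esub> (\<sigma> *\<^sub>R v))) has_vector_derivative D) (at 0)"
  shows "heis_field \<kappa> v u x = D"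
  unfolding heis_field_def using assms by (rule vector_derivative_at)

text \<open>Chain rule along an affine curve, whose direction is \<open>v\<close> plus a multiple of
  the central direction; the multiple is linear in \<open>x\<close>.\<close>

lemma C_infinity_heis_field_derivative:
  assumes u: "C_infinity u"
  shows "((\<lambda>\<sigma>. u (x \<otimes>\<^bsub>heis \<kappa>\<^esub> (\<sigma> *\<^sub>R v))) has_vector_derivative
    frechet_derivative u (at x) v +
      of_real (\<kappa> * Im (\<Sum>j\<in>UNIV. fst x $ j * cnj (fst v $ j))) * frechet_derivative u (at x) (0, 1)) (at 0)"
proof -
  define c where "c = \<kappa> * Im (\<Sum>j\<in>UNIV. fst x $ j * cnj (fst v $ j))"
  let ?V = "(fst v, snd v + c)" and ?D = "frechet_derivative u (at x)"
  have lin: "linear ?D"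
    using C_infinity_has_derivative[OF u] has_derivative_linear by blast
  have V: "?V = v + c *\<^sub>R (0, 1)" by (cases v) simp
  have DV: "?D ?V = ?D v + of_real c * ?D (0, 1)"
    unfolding V linear_add[OF lin] linear_scale[OF lin] by (simp add: scaleR_conv_of_real)
  have "((\<lambda>\<sigma>. u (x + \<sigma> *\<^sub>R ?V)) has_derivative (\<lambda>\<sigma>. ?D (\<sigma> *\<^sub>R ?V))) (at 0)"
  proof (rule has_derivative_compose[of "\<lambda>\<sigma>. x + \<sigma> *\<^sub>R ?V" "\<lambda>\<sigma>. \<sigma> *\<^sub>R ?V"])
    show "((\<lambda>\<sigma>. x + \<sigma> *\<^sub>R ?V) has_derivative (\<lambda>\<sigma>. \<sigma> *\<^sub>R ?V)) (at 0)"
      by (auto intro!: derivative_eq_intros)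
    show "(u has_derivative ?D) (at (x + 0 *\<^sub>R ?V))"
      using C_infinity_has_derivative[OF u] by (simp only: scaleR_zero_left add_0_right)
  qed
  then have "((\<lambda>\<sigma>. u (x + \<sigma> *\<^sub>R ?V)) has_vector_derivative ?D ?V) (at 0)"
    unfolding has_vector_derivative_def by (simp only: linear_scale[OF lin])
  then show ?thesis
    unfolding heis_mult_line DV c_def[symmetric] by simp
qed

lemma C_infinity_heis_differentiable:
  assumes "C_infinity u"
  shows "heis_differentiable \<kappa> v u"
  unfolding heis_differentiable_def heis_field_eqI[OF C_infinity_heis_field_derivative[OF assms]]
  by (intro allI C_infinity_heis_field_derivative assms)

lemma C_infinity_heis_field:
  fixes u :: "('d::finite) heis \<Rightarrow> complex"
  assumes u: "C_infinity u"
  shows "C_infinity (heis_field \<kappa> v u)"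
proof -
  let ?l = "\<lambda>x :: 'd heis. \<kappa> * Im (\<Sum>j\<in>UNIV. fst x $ j * cnj (fst v $ j))"
  have "linear ?l"
    by (rule linearI) (simp_all add: distrib_left distrib_right sum.distrib flip: scaleR_sum_right)
  then have "bounded_linear ?l" unfolding linear_conv_bounded_linear .
  moreover have "heis_field \<kappa> v u = (\<lambda>x. frechet_derivative u (at x) v + of_real (?l x) * frechet_derivative u (at x) (0, 1))"
    using heis_field_eqI[OF C_infinity_heis_field_derivative[OF u]] by blast
  ultimately show ?thesis
    by (simp only:) (intro C_infinity_add C_infinity_linear_mult C_infinity_derivative u)
qed

context heis_quotient_space
begin

lemma invariant_heis_field:
  assumes "invariant \<kappa> \<Gamma> u"
  shows "invariant \<kappa> \<Gamma> (heis_field \<kappa> v u)"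
  unfolding invariant_def heis_field_def
proof (intro ballI allI)
  fix g x assume "g \<in> \<Gamma>"
  then have "(\<lambda>\<sigma>. u ((g \<odot> x) \<odot> (\<sigma> *\<^sub>R v))) = (\<lambda>\<sigma>. u (x \<odot> (\<sigma> *\<^sub>R v)))"
    unfolding heis_assoc by (intro ext invariantD[OF assms])
  then show "vector_derivative (\<lambda>\<sigma>. u ((g \<odot> x) \<odot> (\<sigma> *\<^sub>R v))) (at 0) = vector_derivative (\<lambda>\<sigma>. u (x \<odot> (\<sigma> *\<^sub>R v))) (at 0)"
    by simp
qed

text \<open>The difference quotients of \<open>w\<close> along the flow of a left-invariant field have integral zero.\<close>

lemma integral_heis_field_zero:
  assumes w: "continuous_on UNIV w" and inv: "invariant \<kappa> \<Gamma> w"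
    and diff: "heis_differentiable \<kappa> v w" and cont: "continuous_on UNIV (heis_field \<kappa> v w)"
  shows "(LINT x|\<mu>F. heis_field \<kappa> v w x) = 0"
proof -
  let ?X = "heis_field \<kappa> v w"
  obtain M where M: "\<And>x. norm (?X x) \<le> M"
    using invariant_bounded[OF cont invariant_heis_field[OF inv]] by metis
  define t where "t = (\<lambda>i. inverse (real (Suc i)))"
  have t: "t i > 0" for i by (simp add: t_def)
  have t_lim: "t \<longlonglongrightarrow> 0" unfolding t_def by (rule LIMSEQ_inverse_real_of_nat)
  let ?s = "\<lambda>i x. (w (x \<odot> (t i *\<^sub>R v)) - w x) /\<^sub>R t i"
  \<comment> \<open>The one-parameter group law carries the derivative at 0, taken at the moved base
    point, to every parameter \<sigma>.\<close>
  have deriv: "((\<lambda>\<sigma>. w (x \<odot> (\<sigma> *\<^sub>R v))) has_vector_derivative ?X (x \<odot> (\<sigma> *\<^sub>R v))) (at \<sigma>)" for x \<sigma>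
  proof -
    have "((\<lambda>\<rho>. w ((x \<odot> (\<sigma> *\<^sub>R v)) \<odot> (\<rho> *\<^sub>R v))) has_vector_derivative ?X (x \<odot> (\<sigma> *\<^sub>R v))) (at 0)"
      using diff unfolding heis_differentiable_def by blast
    then have "((\<lambda>\<rho>. w (x \<odot> ((\<sigma> + \<rho>) *\<^sub>R v))) has_derivative (\<lambda>\<rho>. \<rho> *\<^sub>R ?X (x \<odot> (\<sigma> *\<^sub>R v)))) (at 0)"
      unfolding heis_mult_line_add has_vector_derivative_def .
    then have "((\<lambda>\<rho>. w (x \<odot> (\<rho> *\<^sub>R v))) has_derivative (\<lambda>\<rho>. \<rho> *\<^sub>R ?X (x \<odot> (\<sigma> *\<^sub>R v)))) (at \<sigma>)"
      unfolding has_derivative_at by simp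
    then show ?thesis unfolding has_vector_derivative_def .
  qed
  note x0 = heis_mult_line_0[where \<kappa> = \<kappa> and v = v]
  \<comment> \<open>Mean value inequality. The constant \<open>M\<close> can serve as dominating
    function because \<open>F\<close> has finite volume.\<close>
  have bound: "norm (?s i x) \<le> M" for i x
  proof -
    have "norm (w (x \<odot> (t i *\<^sub>R v)) - w (x \<odot> (0 *\<^sub>R v))) \<le> M * norm (t i - 0)"
    proof (rule differentiable_bound[OF convex_UNIV])
      show "((\<lambda>\<sigma>. w (x \<odot> (\<sigma> *\<^sub>R v))) has_derivative (\<lambda>\<rho>. \<rho> *\<^sub>R ?X (x \<odot> (\<sigma> *\<^sub>R v)))) (at \<sigma> within UNIV)" for \<sigma>
        using deriv[of x \<sigma>] unfolding has_vector_derivative_def by simp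
      show "onorm (\<lambda>\<rho>. \<rho> *\<^sub>R ?X (x \<odot> (\<sigma> *\<^sub>R v))) \<le> M" for \<sigma>
      proof (rule onorm_bound)
        show "0 \<le> M" using order_trans[OF norm_ge_zero M] .
        show "norm (\<rho> *\<^sub>R ?X (x \<odot> (\<sigma> *\<^sub>R v))) \<le> M * norm \<rho>" for \<rho>
          unfolding norm_scaleR real_norm_def mult.commute[of M] by (intro mult_left_mono M) simp
      qed
    qed simp_all
    then have "norm (w (x \<odot> (t i *\<^sub>R v)) - w x) \<le> M * t i"
      using t[of i] unfolding x0 by simp
    moreover have "norm (?s i x) = norm (w (x \<odot> (t i *\<^sub>R v)) - w x) / t i"
      using t[of i] unfolding norm_scaleR divide_inverse by (simp only: abs_inverse abs_of_pos mult.commute)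
    ultimately show ?thesis
      using t[of i] by (simp only: pos_divide_le_eq)
  qed
  have lim: "(\<lambda>i. ?s i x) \<longlonglongrightarrow> ?X x" for x
  proof -
    have *: "(\<lambda>h. norm (w (x \<odot> (h *\<^sub>R v)) - w x - h *\<^sub>R ?X x) / norm h) \<midarrow>0\<rightarrow> 0"
      using deriv[of x 0] unfolding has_vector_derivative_def has_derivative_at x0 by simp
    have ne: "t i \<in> UNIV - {0}" for i using t[of i] by simp
    have "(\<lambda>i. norm (w (x \<odot> (t i *\<^sub>R v)) - w x - t i *\<^sub>R ?X x) / norm (t i)) \<longlonglongrightarrow> 0"
      by (rule *[unfolded tendsto_at_iff_sequentially comp_def, rule_format, OF ne t_lim])
    moreover have "norm (w (x \<odot> (t i *\<^sub>R v)) - w x - t i *\<^sub>R ?X x) / norm (t i) = norm (?s i x - ?X x)" for i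
    proof -
      have "?s i x - ?X x = (w (x \<odot> (t i *\<^sub>R v)) - w x - t i *\<^sub>R ?X x) /\<^sub>R t i"
        using t[of i] by (simp add: scaleR_diff_right)
      then show ?thesis unfolding norm_scaleR real_norm_def divide_inverse
        by (simp only: norm_scaleR abs_inverse mult.commute)
    qed
    ultimately have "(\<lambda>i. norm (?s i x - ?X x)) \<longlonglongrightarrow> 0" by simp
    then show ?thesis by (rule Lim_null[THEN iffD2, OF tendsto_norm_zero_cancel])
  qed
  have shift_cont: "continuous_on UNIV (\<lambda>x. w (x \<odot> h))" for h
    by (rule continuous_on_compose2[OF w]) (auto intro!: continuous_intros)
  have shift_inv: "invariant \<kappa> \<Gamma> (\<lambda>x. w (x \<odot> h))" for h
    unfolding invariant_def heis_assoc by (intro ballI allI invariantD[OF inv])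
  have conv: "(\<lambda>i. LINT x|\<mu>F. ?s i x) \<longlonglongrightarrow> (LINT x|\<mu>F. ?X x)"
  proof (rule integral_dominated_convergence[where w = "\<lambda>_. M"])
    show "?X \<in> borel_measurable \<mu>F" by (intro borel_\<mu>F borel_measurable_continuous_onI cont)
    show "?s i \<in> borel_measurable \<mu>F" for i
      by (intro borel_\<mu>F borel_measurable_continuous_onI continuous_intros shift_cont w)
    show "integrable \<mu>F (\<lambda>_. M)" by (rule finite_measure.integrable_const[OF finite_\<mu>F])
  qed (use lim bound in auto)
  \<comment> \<open>Right translation does not change the integral, so the two terms of the
    difference quotient cancel.\<close>
  have zero: "(LINT x|\<mu>F. ?s i x) = 0" for i
  proof -
    have "(LINT x|\<mu>F. ?s i x) = ((LINT x|\<mu>F. w (x \<odot> (t i *\<^sub>R v))) - (LINT x|\<mu>F. w x)) /\<^sub>R t i"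
      using integrable_invariant[OF shift_cont shift_inv] integrable_invariant[OF w inv] by simp
    also have "(LINT x|\<mu>F. w (x \<odot> (t i *\<^sub>R v))) = (LINT x|\<mu>F. w x)"
      by (rule integral_right_translate[OF borel_measurable_continuous_onI[OF w] inv])
    finally show ?thesis by simp
  qed
  show ?thesis
    using LIMSEQ_unique[OF conv[unfolded zero] tendsto_const] .
qed

lemma integrable_inner_invariant:
  assumes "C_infinity u" "invariant \<kappa> \<Gamma> u" "C_infinity w" "invariant \<kappa> \<Gamma> w"
  shows "integrable \<mu>F (\<lambda>x. u x * cnj (w x))"
proof (rule integrable_invariant)
  show "continuous_on UNIV (\<lambda>x. u x * cnj (w x))"
    using assms by (intro continuous_intros C_infinity_continuous)
  show "invariant \<kappa> \<Gamma> (\<lambda>x. u x * cnj (w x))"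
    by (rule invariant_mult_cnj[OF assms(2,4)])
qed

text \<open>The field applied to \<open>u * cnj w\<close> has integral zero, and the product rule
  splits it; differentiation in a real parameter commutes with conjugation.\<close>

lemma integral_heis_field_by_parts:
  assumes u: "C_infinity u" "invariant \<kappa> \<Gamma> u" and w: "C_infinity w" "invariant \<kappa> \<Gamma> w"
  shows "(LINT x|\<mu>F. heis_field \<kappa> v u x * cnj (w x)) = - (LINT x|\<mu>F. u x * cnj (heis_field \<kappa> v w x))"
proof -
  let ?p = "\<lambda>x. u x * cnj (w x)"
  let ?D = "\<lambda>x. u x * cnj (heis_field \<kappa> v w x) + heis_field \<kappa> v u x * cnj (w x)"
  note x0 = heis_mult_line_0[where \<kappa> = \<kappa> and v = v]
  have deriv: "((\<lambda>\<sigma>. ?p (x \<odot> (\<sigma> *\<^sub>R v))) has_vector_derivative ?D x) (at 0)" for x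
  proof -
    have "((\<lambda>\<sigma>. u (x \<odot> (\<sigma> *\<^sub>R v))) has_vector_derivative heis_field \<kappa> v u x) (at 0)"
      "((\<lambda>\<sigma>. w (x \<odot> (\<sigma> *\<^sub>R v))) has_vector_derivative heis_field \<kappa> v w x) (at 0)"
      by (rule C_infinity_heis_differentiable[unfolded heis_differentiable_def, rule_format],
          rule u w)+
    from has_vector_derivative_mult[OF this(1) has_vector_derivative_cnj[OF this(2)]]
    show ?thesis unfolding x0 .
  qed
  have D: "heis_field \<kappa> v ?p = ?D"
    by (rule ext, rule heis_field_eqI, rule deriv)
  have X: "C_infinity (heis_field \<kappa> v u)" "invariant \<kappa> \<Gamma> (heis_field \<kappa> v u)"
    "C_infinity (heis_field \<kappa> v w)" "invariant \<kappa> \<Gamma> (heis_field \<kappa> v w)"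
    using u w by (auto intro: C_infinity_heis_field invariant_heis_field)
  have "(LINT x|\<mu>F. heis_field \<kappa> v ?p x) = 0"
  proof (rule integral_heis_field_zero)
    show "continuous_on UNIV ?p"
      using u w by (intro continuous_intros C_infinity_continuous)
    show "continuous_on UNIV (heis_field \<kappa> v ?p)"
      unfolding D using u w X by (intro continuous_intros C_infinity_continuous)
    show "heis_differentiable \<kappa> v ?p"
      unfolding heis_differentiable_def D by (rule allI, rule deriv)
    show "invariant \<kappa> \<Gamma> ?p"
      by (rule invariant_mult_cnj[OF u(2) w(2)])
  qed
  then have "(LINT x|\<mu>F. u x * cnj (heis_field \<kappa> v w x)) + (LINT x|\<mu>F. heis_field \<kappa> v u x * cnj (w x)) = 0"
    unfolding D Bochner_Integration.integral_add[OF integrable_inner_invariant[OF u X(3,4)]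
      integrable_inner_invariant[OF X(1,2) w]] .
  then show ?thesis by (rule minus_unique[symmetric])
qed

section \<open>Symmetry of the operators on the quotient\<close>

lemma invariant_lift: "invariant \<kappa> \<Gamma> (\<lambda>x. f (proj x))"
  unfolding invariant_def by (intro ballI allI) (simp only: proj_mult)

lemma l2_inner_lift:
  assumes "f \<in> l2 N" "g \<in> l2 N"
  shows "l2_inner N f g = (LINT x|\<mu>F. f (proj x) * cnj (g (proj x)))"
  unfolding l2_inner_def using l2_integrable_mult_cnj[OF assms] by (intro integral_N) simp

lemma T_op_antisymmetric: "l2_symmetric N (- 1) (T_op \<kappa> \<tau> \<Gamma> F)"
  unfolding T_op_def quotient_operator_def
proof (rule l2_symmetric_closure, unfold l2_symmetric_def, clarify)
  fix f g f' g' :: "'d heis set \<Rightarrow> complex"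
  let ?u = "\<lambda>x. f (proj x)" and ?w = "\<lambda>x. f' (proj x)"
  assume u: "C_infinity ?u" and g: "(\<lambda>x. g (proj x)) = heis_T \<kappa> \<tau> ?u"
    and w: "C_infinity ?w" and g': "(\<lambda>x. g' (proj x)) = heis_T \<kappa> \<tau> ?w"
    and mem: "f \<in> l2 N" "g \<in> l2 N" "f' \<in> l2 N" "g' \<in> l2 N"
  have "l2_inner N g f' = (LINT x|\<mu>F. of_real \<tau> * (heis_field \<kappa> (0, 1) ?u x * cnj (?w x)))"
    unfolding l2_inner_lift[OF mem(2,3)] fun_cong[OF g] heis_T_def by (simp add: mult.assoc)
  also have "\<dots> = of_real \<tau> * - (LINT x|\<mu>F. ?u x * cnj (heis_field \<kappa> (0, 1) ?w x))"
    by (simp add: integral_heis_field_by_parts u w invariant_lift)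
  also have "\<dots> = - (LINT x|\<mu>F. ?u x * cnj (of_real \<tau> * heis_field \<kappa> (0, 1) ?w x))"
    by (simp add: mult.left_commute)
  also have "\<dots> = - 1 * l2_inner N f g'"
    unfolding l2_inner_lift[OF mem(1,4)] fun_cong[OF g'] heis_T_def by simp
  finally show "l2_inner N g f' = - 1 * l2_inner N f g'" .
qed

text \<open>One integration by parts in each square. Conjugation turns the resulting form into the
  same form with \<open>u\<close> and \<open>w\<close> exchanged, as \<open>s\<close> is real, and
  symmetry of the sublaplacian is read off.\<close>

lemma integral_sublaplacian:
  assumes u: "C_infinity u" "invariant \<kappa> \<Gamma> u" and w: "C_infinity w" "invariant \<kappa> \<Gamma> w"
  shows "(LINT x|\<mu>F. heis_sublaplacian \<kappa> s u x * cnj (w x)) =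
    of_real s * (\<Sum>j\<in>UNIV. (LINT x|\<mu>F. heis_field \<kappa> (axis j 1, 0) u x * cnj (heis_field \<kappa> (axis j 1, 0) w x)) +
      (LINT x|\<mu>F. heis_field \<kappa> (axis j \<i>, 0) u x * cnj (heis_field \<kappa> (axis j \<i>, 0) w x)))"
proof -
  let ?X = "\<lambda>j. heis_field \<kappa> (axis j 1, 0)" and ?Y = "\<lambda>j. heis_field \<kappa> (axis j \<i>, 0)"
  have field: "C_infinity (heis_field \<kappa> v u)" "invariant \<kappa> \<Gamma> (heis_field \<kappa> v u)" for v
    using u by (auto intro: C_infinity_heis_field invariant_heis_field)
  have field2: "C_infinity (heis_field \<kappa> v (heis_field \<kappa> v u))" "invariant \<kappa> \<Gamma> (heis_field \<kappa> v (heis_field \<kappa> v u))" for v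
    by (rule C_infinity_heis_field[OF field(1)], rule invariant_heis_field[OF field(2)])
  have int: "integrable \<mu>F (\<lambda>x. heis_field \<kappa> v (heis_field \<kappa> v u) x * cnj (w x))" for v
    by (rule integrable_inner_invariant[OF field2 w])
  have "(LINT x|\<mu>F. heis_sublaplacian \<kappa> s u x * cnj (w x)) =
      (LINT x|\<mu>F. - of_real s * (\<Sum>j\<in>UNIV. ?X j (?X j u) x * cnj (w x) + ?Y j (?Y j u) x * cnj (w x)))"
    unfolding heis_sublaplacian_def by (simp add: sum_distrib_right distrib_right mult.assoc)
  also have "\<dots> = - of_real s * (\<Sum>j\<in>UNIV. (LINT x|\<mu>F. ?X j (?X j u) x * cnj (w x)) + (LINT x|\<mu>F. ?Y j (?Y j u) x * cnj (w x)))"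
    by (simp add: int)
  also have "\<dots> = of_real s * (\<Sum>j\<in>UNIV. (LINT x|\<mu>F. ?X j u x * cnj (?X j w x)) + (LINT x|\<mu>F. ?Y j u x * cnj (?Y j w x)))"
    unfolding integral_heis_field_by_parts[OF field w] by (simp add: sum.distrib sum_negf sum_subtractf algebra_simps)
  finally show ?thesis .
qed

lemma L0_op_symmetric: "l2_symmetric N 1 (L0_op \<kappa> s \<Gamma> F)"
  unfolding L0_op_def quotient_operator_def
proof (rule l2_symmetric_closure, unfold l2_symmetric_def, clarify)
  fix f g f' g' :: "'d heis set \<Rightarrow> complex"
  let ?u = "\<lambda>x. f (proj x)" and ?w = "\<lambda>x. f' (proj x)"
  assume u: "C_infinity ?u" and g: "(\<lambda>x. g (proj x)) = heis_sublaplacian \<kappa> s ?u"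
    and w: "C_infinity ?w" and g': "(\<lambda>x. g' (proj x)) = heis_sublaplacian \<kappa> s ?w"
    and mem: "f \<in> l2 N" "g \<in> l2 N" "f' \<in> l2 N" "g' \<in> l2 N"
  have swap: "cnj (LINT x|\<mu>F. a x * cnj (b x)) = (LINT x|\<mu>F. b x * cnj (a x))" for a b
    by (subst Bochner_Integration.integral_cnj[symmetric]) (simp add: mult.commute)
  have "l2_inner N g f' = (LINT x|\<mu>F. heis_sublaplacian \<kappa> s ?u x * cnj (?w x))"
    unfolding l2_inner_lift[OF mem(2,3)] fun_cong[OF g] ..
  also have "\<dots> = cnj (LINT x|\<mu>F. heis_sublaplacian \<kappa> s ?w x * cnj (?u x))"
    unfolding integral_sublaplacian[OF u invariant_lift w invariant_lift]
      integral_sublaplacian[OF w invariant_lift u invariant_lift]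
    by (simp add: swap)
  also have "\<dots> = l2_inner N f g'"
    unfolding l2_inner_lift[OF mem(1,4)] fun_cong[OF g'] by (rule swap)
  finally show "l2_inner N g f' = 1 * l2_inner N f g'" by simp
qed

text \<open>\<open>T\<close> is antisymmetric and \<i> changes sign under conjugation, so \<i>
  \<alpha> \<open>T\<close> is symmetric. The summands are closures already; their sum on the common
  domain is closed once more, and symmetry passes to it.\<close>

lemma L_op_symmetric: "l2_symmetric N 1 (L_op \<kappa> s \<tau> \<Gamma> F \<alpha>)"
  unfolding L_op_def
proof (rule l2_symmetric_closure, unfold l2_symmetric_def, clarify)
  fix f g h f' g' h' :: "'d heis set \<Rightarrow> complex"
  assume L: "(f, g) \<in> L0_op \<kappa> s \<Gamma> F" "(f', g') \<in> L0_op \<kappa> s \<Gamma> F"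
    and T: "(f, h) \<in> T_op \<kappa> \<tau> \<Gamma> F" "(f', h') \<in> T_op \<kappa> \<tau> \<Gamma> F"
  have mem: "f \<in> l2 N" "g \<in> l2 N" "h \<in> l2 N" "f' \<in> l2 N" "g' \<in> l2 N" "h' \<in> l2 N"
    using L T l2_closure_subset_l2 unfolding L0_op_def T_op_def quotient_operator_def by blast+
  have "l2_inner N (\<lambda>x. g x + \<i> * of_real \<alpha> * h x) f' = l2_inner N g f' + \<i> * of_real \<alpha> * l2_inner N h f'"
    by (simp add: l2_inner_add_left l2_inner_cmult_left l2_cmult mem)
  also have "\<dots> = l2_inner N f g' - \<i> * of_real \<alpha> * l2_inner N f h'"
    using l2_symmetricD[OF L0_op_symmetric L(1) L(2)] l2_symmetricD[OF T_op_antisymmetric T(1) T(2)] mem by simp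
  also have "\<dots> = l2_inner N f (\<lambda>x. g' x + \<i> * of_real \<alpha> * h' x)"
    by (simp add: l2_inner_add_right l2_inner_cmult_right l2_cmult mem)
  finally show "l2_inner N (\<lambda>x. g x + \<i> * of_real \<alpha> * h x) f' = 1 * l2_inner N f (\<lambda>x. g' x + \<i> * of_real \<alpha> * h' x)"
    by simp
qed

text \<open>Eigenvalue \<open>snd p\<close> of \<open>inverse \<i>\<close> times \<open>T\<close>
  means that \<open>T\<close> multiplies \<open>f\<close> by \<open>\<i> * snd p\<close>; a further
  factor \<i> \<alpha> produces the minus sign.\<close>

lemma joint_eigenvector_L_op:
  assumes "joint_eigenvector \<kappa> s \<tau> \<Gamma> F p f"
  shows "eigenvector N (L_op \<kappa> s \<tau> \<Gamma> F \<alpha>) (fst p - \<alpha> * snd p) f"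
proof -
  have f: "f \<in> l2 N" "l2_norm N f \<noteq> 0" and L: "(f, \<lambda>x. of_real (fst p) * f x) \<in> L0_op \<kappa> s \<Gamma> F"
    and iT: "(f, \<lambda>x. of_real (snd p) * f x) \<in> iT_op \<kappa> \<tau> \<Gamma> F"
    using assms by (auto simp: joint_eigenvector_def eigenvector_def)
  obtain h where T: "(f, h) \<in> T_op \<kappa> \<tau> \<Gamma> F" and h: "(\<lambda>x. of_real (snd p) * f x) = (\<lambda>x. inverse \<i> * h x)"
    using iT unfolding iT_op_def by blast
  have "h x = \<i> * (of_real (snd p) * f x)" for x
    using fun_cong[OF h, of x] by simp
  then have eq: "(\<lambda>x. of_real (fst p) * f x + \<i> * of_real \<alpha> * h x) = (\<lambda>x. of_real (fst p - \<alpha> * snd p) * f x)"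
    by (auto simp: algebra_simps)
  have "(f, \<lambda>x. of_real (fst p - \<alpha> * snd p) * f x) \<in> L_op \<kappa> s \<tau> \<Gamma> F \<alpha>"
    unfolding L_op_def
  proof (intro l2_closure_superset l2_cmult f(1))
    show "(f, \<lambda>x. of_real (fst p - \<alpha> * snd p) * f x) \<in>
        {(f, \<lambda>x. g x + \<i> * of_real \<alpha> * h x) | f g h. (f, g) \<in> L0_op \<kappa> s \<Gamma> F \<and> (f, h) \<in> T_op \<kappa> \<tau> \<Gamma> F}"
      unfolding eq[symmetric]
      by (rule CollectI, rule exI[of _ f], rule exI[of _ "\<lambda>x. of_real (fst p) * f x"], rule exI[of _ h])
        (simp add: L T)
  qed
  with f show ?thesis by (simp add: eigenvector_def)
qed

lemma zero_in_kernel: "(\<lambda>x. 0) \<in> l2_kernel N (L_op \<kappa> s \<tau> \<Gamma> F \<alpha>)"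
proof -
  have field: "heis_field \<kappa> v (\<lambda>x. 0) = (\<lambda>x. 0)" for v :: "'d heis"
    unfolding heis_field_def by simp
  have "(\<lambda>x. 0, \<lambda>x. 0) \<in> L0_op \<kappa> s \<Gamma> F" "(\<lambda>x. 0, \<lambda>x. 0) \<in> T_op \<kappa> \<tau> \<Gamma> F"
    unfolding L0_op_def T_op_def quotient_operator_def
    by (intro l2_closure_superset l2_zero; simp add: C_infinity_zero heis_sublaplacian_def[abs_def] heis_T_def[abs_def] field)+
  then have "(\<lambda>x. 0, \<lambda>x. 0) \<in> L_op \<kappa> s \<tau> \<Gamma> F \<alpha>"
    unfolding L_op_def
    by (intro l2_closure_superset l2_zero CollectI exI[of _ "\<lambda>x. 0"]) simp
  then show ?thesis by (simp add: l2_kernel_def l2_zero)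
qed

end

section \<open>Convergence of the spectral sums\<close>

lemma nn_integral_count_space_subset_mono:
  fixes f :: "'i \<Rightarrow> ennreal"
  assumes "J \<subseteq> I" "\<And>i. i \<in> J \<Longrightarrow> f i \<le> g i"
  shows "(\<integral>\<^sup>+i. f i \<partial>count_space J) \<le> (\<integral>\<^sup>+i. g i \<partial>count_space I)"
proof (rule nn_integral_count_space_leI)
  fix S assume S: "finite S" "S \<subseteq> J"
  then have "sum f S \<le> sum g S" using assms by (intro sum_mono) auto
  also have "\<dots> \<le> (\<integral>\<^sup>+i. g i \<partial>count_space I)"
    using S assms by (intro sum_le_nn_integral_count_space) auto
  finally show "sum f S \<le> (\<integral>\<^sup>+i. g i \<partial>count_space I)" .
qed

lemma nn_integral_count_space_Plus:
  fixes f :: "'i + 'j \<Rightarrow> ennreal"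
  shows "(\<integral>\<^sup>+x. f x \<partial>count_space (I <+> J)) = (\<integral>\<^sup>+i. f (Inl i) \<partial>count_space I) + (\<integral>\<^sup>+j. f (Inr j) \<partial>count_space J)"
proof -
  have "(\<integral>\<^sup>+x. f x \<partial>count_space (I <+> J)) =
      (\<integral>\<^sup>+x. f x * indicator (Inl ` I) x + f x * indicator (Inr ` J) x \<partial>count_space UNIV)"
    by (subst nn_integral_count_space_indicator) (auto intro!: nn_integral_cong split: split_indicator)
  also have "\<dots> = (\<integral>\<^sup>+x. f x \<partial>count_space (Inl ` I)) + (\<integral>\<^sup>+x. f x \<partial>count_space (Inr ` J))"
    by (subst nn_integral_add) (simp_all add: nn_integral_count_space_indicator)
  also have "(\<integral>\<^sup>+x. f x \<partial>count_space (Inl ` I)) = (\<integral>\<^sup>+i. f (Inl i) \<partial>count_space I)"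
    by (rule nn_integral_bij_count_space[symmetric]) (simp add: bij_betw_def)
  also have "(\<integral>\<^sup>+x. f x \<partial>count_space (Inr ` J)) = (\<integral>\<^sup>+j. f (Inr j) \<partial>count_space J)"
    by (rule nn_integral_bij_count_space[symmetric]) (simp add: bij_betw_def)
  finally show ?thesis .
qed

section \<open>Counting vectors of the dual lattice\<close>

lemma emeasure_count_space_le_card:
  assumes "S \<subseteq> T" "finite T" "card T \<le> n"
  shows "emeasure (count_space UNIV) S \<le> of_nat n"
proof -
  have "finite S" "card S \<le> n"
    using finite_subset[OF assms(1,2)] order_trans[OF card_mono[OF assms(2,1)] assms(3)] by auto
  then show ?thesis by simp
qed

text \<open>Since \<open>B\<close> spans, a vector is determined by its inner products with
  \<open>B\<close>, here integers between \<open>- M\<close> and \<open>M\<close>, which leaves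
  \<open>2 * M + 1\<close> choices for each element of \<open>B\<close>.\<close>

lemma dual_basis_card_le:
  fixes B :: "'a::euclidean_space set"
  assumes B: "finite B" "span B = UNIV"
  shows "emeasure (count_space UNIV) {\<xi>. \<forall>\<mu>\<in>B. \<xi> \<bullet> \<mu> \<in> \<int> \<and> \<bar>\<xi> \<bullet> \<mu>\<bar> \<le> real M} \<le> of_nat ((2 * M + 1) ^ card B)"
proof -
  let ?D = "{\<xi>. \<forall>\<mu>\<in>B. \<xi> \<bullet> \<mu> \<in> \<int> \<and> \<bar>\<xi> \<bullet> \<mu>\<bar> \<le> real M}"
  let ?T = "B \<rightarrow>\<^sub>E {- int M..int M}"
  define \<phi> where "\<phi> = (\<lambda>\<xi>. restrict (\<lambda>\<mu>. \<lfloor>\<xi> \<bullet> \<mu>\<rfloor>) B)"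
  have sub: "\<phi> ` ?D \<subseteq> ?T"
  proof (intro image_subsetI PiE_I)
    fix \<xi> \<mu> assume *: "\<xi> \<in> ?D" "\<mu> \<in> B"
    then obtain k where "\<xi> \<bullet> \<mu> = of_int k" by (auto elim: Ints_cases)
    moreover have "\<bar>\<xi> \<bullet> \<mu>\<bar> \<le> real M" using * by auto
    ultimately have "\<bar>k\<bar> \<le> int M" "\<lfloor>\<xi> \<bullet> \<mu>\<rfloor> = k" by linarith+
    then show "\<phi> \<xi> \<mu> \<in> {- int M..int M}" using * by (auto simp: \<phi>_def)
  qed (simp add: \<phi>_def)
  have inj: "inj_on \<phi> ?D"
  proof (rule inj_onI)
    fix \<xi> \<eta> assume *: "\<xi> \<in> ?D" "\<eta> \<in> ?D" "\<phi> \<xi> = \<phi> \<eta>"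
    have zero: "(\<xi> - \<eta>) \<bullet> \<mu> = 0" if "\<mu> \<in> B" for \<mu>
    proof -
      have "\<lfloor>\<xi> \<bullet> \<mu>\<rfloor> = \<lfloor>\<eta> \<bullet> \<mu>\<rfloor>"
        using fun_cong[OF *(3), of \<mu>] that by (simp add: \<phi>_def)
      moreover have "\<xi> \<bullet> \<mu> \<in> \<int>" "\<eta> \<bullet> \<mu> \<in> \<int>" using * that by auto
      ultimately show ?thesis by (auto elim!: Ints_cases simp: inner_diff_left)
    qed
    have "orthogonal (\<xi> - \<eta>) (\<xi> - \<eta>)"
    proof (rule orthogonal_to_span)
      show "\<xi> - \<eta> \<in> span B" by (simp add: B(2))
      show "orthogonal (\<xi> - \<eta>) y" if "y \<in> B" for y
        unfolding orthogonal_def by (rule zero[OF that])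
    qed
    then show "\<xi> = \<eta>" by (simp add: orthogonal_self)
  qed
  have T: "finite ?T" "card ?T = (2 * M + 1) ^ card B"
  proof -
    show "finite ?T" by (rule finite_PiE[OF B(1)]) simp
    have "nat (int M - (- int M) + 1) = 2 * M + 1" by linarith
    then show "card ?T = (2 * M + 1) ^ card B" by (simp only: card_PiE[OF B(1)] card_atLeastAtMost_int prod_constant)
  qed
  have "finite ?D" "card ?D \<le> (2 * M + 1) ^ card B"
    using inj_on_finite[OF inj sub T(1)] card_inj_on_le[OF inj sub T(1)] T(2) by simp_all
  then show ?thesis
    by (rule emeasure_count_space_le_card[OF subset_refl])
qed

text \<open>The crude count of dual vectors used here costs one power, hence \<open>+ 1\<close> in the exponent.\<close>

lemma dual_lattice_sum_finite:
  fixes \<Lambda> :: "'a::euclidean_space set"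
  assumes \<Lambda>: "span \<Lambda> = UNIV" and p: "p > real DIM('a) + 1"
  shows "(\<integral>\<^sup>+\<xi>. ennreal (norm \<xi> powr - p) \<partial>count_space {\<xi>. \<forall>\<mu>\<in>\<Lambda>. \<xi> \<bullet> \<mu> \<in> \<int>}) < \<infinity>"
proof -
  let ?D = "{\<xi>. \<forall>\<mu>\<in>\<Lambda>. \<xi> \<bullet> \<mu> \<in> \<int>}"
  obtain B where "B \<subseteq> \<Lambda>" "independent B" "\<Lambda> \<subseteq> span B"
    by (rule maximal_independent_subset)
  moreover from this have "span B = UNIV"
    using span_minimal[OF _ subspace_span] \<Lambda> by blast
  ultimately have B: "B \<subseteq> \<Lambda>" "independent B" "span B = UNIV" by auto
  then have fin: "finite B" by (simp add: independent_imp_finite)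
  have "card B = dim (span B)"
    using B(2) by (simp add: dim_eq_card_independent)
  then have card: "card B = DIM('a)" by (simp add: B(3))
  \<comment> \<open>By Cauchy-Schwarz \<open>norm \<xi> * R\<close> bounds the sum
    \<open>h \<xi>\<close> of the absolute pairings with \<open>B\<close>. As \<open>h\<close> is
    integer-valued, grouping by its value leaves a sum over the naturals.\<close>
  define R where "R = (\<Sum>\<mu>\<in>B. norm \<mu>)"
  define h where "h = (\<lambda>\<xi>. \<Sum>\<mu>\<in>B. nat \<bar>\<lfloor>\<xi> \<bullet> \<mu>\<rfloor>\<bar>)"
  have h: "real (h \<xi>) = (\<Sum>\<mu>\<in>B. \<bar>\<xi> \<bullet> \<mu>\<bar>)" if "\<xi> \<in> ?D" for \<xi>
    unfolding h_def of_nat_sum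
  proof (rule sum.cong)
    fix \<mu> assume "\<mu> \<in> B"
    then have "\<xi> \<bullet> \<mu> \<in> \<int>" using that B by auto
    then show "real (nat \<bar>\<lfloor>\<xi> \<bullet> \<mu>\<rfloor>\<bar>) = \<bar>\<xi> \<bullet> \<mu>\<bar>" by (auto elim!: Ints_cases)
  qed simp
  \<comment> \<open>At \<xi> = 0 the left side is 0 by the convention for \<open>powr\<close>;
    elsewhere \<open>h \<xi>\<close> is positive because a vector orthogonal to \<open>B\<close>
    vanishes.\<close>
  have le: "norm \<xi> powr - p \<le> R powr p * real (h \<xi>) powr - p" if \<xi>: "\<xi> \<in> ?D" for \<xi>
  proof (cases "\<xi> = 0")
    case False
    have "real (h \<xi>) \<noteq> 0"
    proof
      assume "real (h \<xi>) = 0"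
      then have zero: "\<xi> \<bullet> \<mu> = 0" if "\<mu> \<in> B" for \<mu>
        using that fin unfolding h[OF \<xi>] by (subst (asm) sum_nonneg_eq_0_iff) auto
      have "orthogonal \<xi> \<xi>"
      proof (rule orthogonal_to_span)
        show "\<xi> \<in> span B" by (simp add: B(3))
        show "orthogonal \<xi> y" if "y \<in> B" for y
          unfolding orthogonal_def by (rule zero[OF that])
      qed
      with False show False by (simp add: orthogonal_self)
    qed
    then have pos: "real (h \<xi>) > 0" by simp
    have "real (h \<xi>) \<le> (\<Sum>\<mu>\<in>B. norm \<xi> * norm \<mu>)"
      unfolding h[OF \<xi>] by (intro sum_mono Cauchy_Schwarz_ineq2)
    also have "\<dots> = norm \<xi> * R" by (simp add: R_def sum_distrib_left)
    finally have hR: "real (h \<xi>) \<le> norm \<xi> * R" .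
    with pos have "0 < norm \<xi> * R" by linarith
    then have R: "R > 0" by (simp add: zero_less_mult_iff)
    have "(norm \<xi> * R) powr - p \<le> real (h \<xi>) powr - p"
      using hR pos p by (intro powr_mono2') auto
    then show ?thesis
      using R False by (simp add: powr_mult powr_minus field_simps)
  qed simp
  let ?n = "real DIM('a)"
  have "(\<integral>\<^sup>+\<xi>. ennreal (norm \<xi> powr - p) \<partial>count_space ?D) \<le>
      (\<integral>\<^sup>+\<xi>. ennreal (R powr p * real (h \<xi>) powr - p) \<partial>count_space ?D)"
    using le by (intro nn_integral_mono ennreal_leI) auto
  also have "\<dots> = (\<integral>\<^sup>+M. emeasure (count_space UNIV) {\<xi>\<in>?D. h \<xi> = M} * ennreal (R powr p * real M powr - p) \<partial>count_space UNIV)"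
    by (rule nn_integral_count_space_fibres)
  also have "\<dots> \<le> (\<integral>\<^sup>+M. ennreal (3 powr ?n * R powr p * real M powr (?n - p)) \<partial>count_space UNIV)"
  proof (rule nn_integral_mono)
    fix M
    show "emeasure (count_space UNIV) {\<xi>\<in>?D. h \<xi> = M} * ennreal (R powr p * real M powr - p) \<le>
        ennreal (3 powr ?n * R powr p * real M powr (?n - p))"
    \<comment> \<open>For \<open>M \<ge> 1\<close> the \<open>2 * M + 1\<close> choices are at most
      \<open>3 * M\<close>; at \<open>M = 0\<close> the weight is 0 because
      \<open>0 powr - p\<close> is 0.\<close>
    proof (cases "M = 0")
      case False
      have "{\<xi>\<in>?D. h \<xi> = M} \<subseteq> {\<xi>. \<forall>\<mu>\<in>B. \<xi> \<bullet> \<mu> \<in> \<int> \<and> \<bar>\<xi> \<bullet> \<mu>\<bar> \<le> real M}"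
      proof safe
        fix \<xi> \<mu> assume *: "\<forall>\<mu>\<in>\<Lambda>. \<xi> \<bullet> \<mu> \<in> \<int>" "\<mu> \<in> B"
        then show "\<xi> \<bullet> \<mu> \<in> \<int>" using B by auto
        show "\<bar>\<xi> \<bullet> \<mu>\<bar> \<le> real (h \<xi>)"
          using h[of \<xi>] * member_le_sum[of \<mu> B "\<lambda>\<mu>. \<bar>\<xi> \<bullet> \<mu>\<bar>"] fin by simp
      qed
      then have "emeasure (count_space UNIV) {\<xi>\<in>?D. h \<xi> = M} \<le> of_nat ((2 * M + 1) ^ card B)"
        by (rule order_trans[OF emeasure_mono dual_basis_card_le[OF fin B(3)]]) simp
      also have "\<dots> \<le> ennreal ((3 * real M) powr ?n)"
      proof -
        have "real ((2 * M + 1) ^ card B) \<le> (3 * real M) ^ card B"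
          using of_nat_mono[OF power_mono[of "2 * M + 1" "3 * M" "card B"], where 'a = real] False by simp
        then show ?thesis
          using False by (simp add: ennreal_of_nat_eq_real_of_nat card powr_realpow ennreal_leI)
      qed
      finally have "emeasure (count_space UNIV) {\<xi>\<in>?D. h \<xi> = M} * ennreal (R powr p * real M powr - p) \<le>
          ennreal ((3 * real M) powr ?n) * ennreal (R powr p * real M powr - p)"
        by (rule mult_right_mono) simp
      also have "\<dots> = ennreal (3 powr ?n * R powr p * real M powr (?n - p))"
        using False by (simp add: ennreal_mult[symmetric] powr_mult powr_diff powr_minus divide_inverse ac_simps)
      finally show ?thesis .
    qed simp
  qed
  also have "\<dots> < \<infinity>"
    using p unfolding nn_integral_count_space_nat infinity_ennreal_def less_top[symmetric]
    by (intro ennreal_suminf_neq_top summable_mult) (auto simp: summable_real_powr_iff)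
  finally show ?thesis .
qed

section \<open>The eigenvalues with nonzero central frequency\<close>

lemma summable_Suc_powr: "s < -1 \<Longrightarrow> summable (\<lambda>j. real (Suc j) powr s)"
  using summable_Suc_iff[of "\<lambda>j. real j powr s"] by (simp add: summable_real_powr_iff)

text \<open>The first family of Folland's list, separated from the group. The index \<open>m\<close>
  only carries multiplicity: \<open>folland_eigenvalue\<close> ignores it.\<close>

definition folland_index :: "nat \<Rightarrow> nat \<Rightarrow> (int \<times> nat \<times> nat) set" where
  "folland_index d K = {(n, j, m). n \<noteq> 0 \<and> m < nat \<bar>n\<bar> ^ d * K * ((j + d - 1) choose (d - 1))}"

definition folland_eigenvalue :: "real \<Rightarrow> nat \<Rightarrow> real \<Rightarrow> int \<times> nat \<times> nat \<Rightarrow> real" where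
  "folland_eigenvalue c d \<alpha> = (\<lambda>(n, j, m). pi / (2 * c) * (real_of_int \<bar>n\<bar> * (real d + 2 * real j) - \<alpha> * real_of_int n))"

lemma folland_eigenvalue_eq:
  "folland_eigenvalue c d \<alpha> (n, j, m) =
     pi / (2 * c) * (real (nat \<bar>n\<bar>) * (real d + 2 * real j - \<alpha> * real_of_int (sgn n)))"
  by (simp add: folland_eigenvalue_def sgn_if algebra_simps)

text \<open>For \<open>j \<ge> 1\<close> the factor \<open>d + 2 j - \<alpha> sgn n\<close> is at
  least \<open>2 j\<close>, hence at least \<open>j + 1\<close>. For \<open>j = 0\<close> it is
  \<open>d - \<alpha>\<close> or \<open>d + \<alpha>\<close>, nonnegative by the bounds on \<alpha>:
  two values, each zero or positive.\<close>

lemma folland_eigenvalue_ge: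
  assumes c: "c > 0" and \<alpha>: "- real d \<le> \<alpha>" "\<alpha> \<le> real d"
  obtains B where "B > 0"
    and "\<And>n j m. folland_eigenvalue c d \<alpha> (n, j, m) \<noteq> 0 \<Longrightarrow>
           B * (real (nat \<bar>n\<bar>) * real (Suc j)) \<le> folland_eigenvalue c d \<alpha> (n, j, m)"
proof -
  \<comment> \<open>A vanishing \<open>d - \<alpha>\<close> or \<open>d + \<alpha>\<close> is
    replaced by 1, so that the minimum \<delta> stays positive.\<close>
  let ?\<delta> = "\<lambda>x. if x = 0 then 1 else x"
  define \<delta> where "\<delta> = min 1 (min (?\<delta> (real d - \<alpha>)) (?\<delta> (real d + \<alpha>)))"
  have \<delta>: "\<delta> > 0" "\<delta> \<le> 1" using \<alpha> by (auto simp: \<delta>_def)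
  have *: "\<delta> * real (Suc j) \<le> real d + 2 * real j - \<alpha> * s"
    if "real d + 2 * real j - \<alpha> * s \<noteq> 0" "s = 1 \<or> s = -1" for j s
  proof (cases j)
    case 0
    then show ?thesis using that \<alpha> by (auto simp: \<delta>_def)
  next
    case (Suc i)
    have "\<delta> * real (Suc j) \<le> 1 * real (Suc j)" using \<delta> by (intro mult_right_mono) auto
    moreover have "real (Suc j) \<le> real d + 2 * real j - \<alpha> * s" using that \<alpha> Suc by auto
    ultimately show ?thesis unfolding mult_1_left by (rule order_trans)
  qed
  show thesis
  proof
    show "pi / (2 * c) * \<delta> > 0" using c \<delta> by simp
    fix n j m assume nz: "folland_eigenvalue c d \<alpha> (n, j, m) \<noteq> 0"
    then have s: "real_of_int (sgn n) = 1 \<or> real_of_int (sgn n) = -1"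
      and "real d + 2 * real j - \<alpha> * real_of_int (sgn n) \<noteq> 0"
      by (auto simp: folland_eigenvalue_eq sgn_if)
    then have "pi / (2 * c) * (real (nat \<bar>n\<bar>) * (\<delta> * real (Suc j))) \<le> folland_eigenvalue c d \<alpha> (n, j, m)"
      unfolding folland_eigenvalue_eq using * c by (intro mult_left_mono) auto
    then show "pi / (2 * c) * \<delta> * (real (nat \<bar>n\<bar>) * real (Suc j)) \<le> folland_eigenvalue c d \<alpha> (n, j, m)"
      by (simp add: algebra_simps)
  qed
qed

text \<open>Grouped by \<open>\<bar>n\<bar>\<close> and \<open>j\<close>, the sum is bounded by a
  product of sums with exponents \<open>d - r\<close> and \<open>d - 1 - r\<close>. The first is the
  one that requires \<open>r > d + 1\<close>.\<close>

lemma folland_sum_finite: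
  assumes d: "d \<ge> 1" and c: "c > 0" and \<alpha>: "- real d \<le> \<alpha>" "\<alpha> \<le> real d" and r: "r > real d + 1"
  shows "(\<integral>\<^sup>+x. (if folland_eigenvalue c d \<alpha> x = 0 then 0 else ennreal (inverse (folland_eigenvalue c d \<alpha> x) powr r))
            \<partial>count_space (folland_index d K)) < \<infinity>"
proof -
  let ?I = "folland_index d K" and ?lam = "folland_eigenvalue c d \<alpha>"
  obtain B where B: "B > 0"
    and ge: "\<And>n j m. ?lam (n, j, m) \<noteq> 0 \<Longrightarrow> B * (real (nat \<bar>n\<bar>) * real (Suc j)) \<le> ?lam (n, j, m)"
    by (rule folland_eigenvalue_ge[OF c \<alpha>]) blast
  define h where "h = (\<lambda>(n, j, m :: nat). (nat \<bar>n\<bar>, j :: nat))"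
  let ?G = "\<lambda>(N, j). ennreal (B powr - r * real N powr - r * real (Suc j) powr - r)"
  \<comment> \<open>The factor 2 accounts for the sign of \<open>n\<close>,
    \<open>d ^ (d - 1)\<close> for the binomial coefficient, and \<open>B\<close> for the eigenvalue
    bound.\<close>
  define C where "C = 2 * real K * real d ^ (d - 1) * B powr - r"
  have "C \<ge> 0" by (simp add: C_def)
  have "(\<integral>\<^sup>+x. (if ?lam x = 0 then 0 else ennreal (inverse (?lam x) powr r)) \<partial>count_space ?I) \<le>
      (\<integral>\<^sup>+x. ?G (h x) \<partial>count_space ?I)"
  proof (rule nn_integral_mono)
    fix x :: "int \<times> nat \<times> nat" assume "x \<in> space (count_space ?I)"
    then obtain n j m where x: "x = (n, j, m)" and n: "n \<noteq> 0"
      by (cases x) (auto simp: folland_index_def)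
    have "inverse (?lam x) powr r \<le> B powr - r * real (nat \<bar>n\<bar>) powr - r * real (Suc j) powr - r" if "?lam x \<noteq> 0"
    proof -
      have pos: "0 < B * (real (nat \<bar>n\<bar>) * real (Suc j))"
        using B n by simp
      have "inverse (?lam x) powr r = ?lam x powr - r"
        using ge[of n j m] that pos by (simp add: x powr_minus inverse_powr)
      also have "\<dots> \<le> (B * (real (nat \<bar>n\<bar>) * real (Suc j))) powr - r"
        using ge[of n j m] that pos r unfolding x by (intro powr_mono2') auto
      also have "\<dots> = B powr - r * real (nat \<bar>n\<bar>) powr - r * real (Suc j) powr - r"
        using B by (simp add: powr_mult)
      finally show ?thesis .
    qed
    then show "(if ?lam x = 0 then 0 else ennreal (inverse (?lam x) powr r)) \<le> ?G (h x)"
      by (auto simp: x h_def intro: ennreal_leI)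
  qed
  also have "\<dots> = (\<integral>\<^sup>+y. emeasure (count_space UNIV) {x\<in>?I. h x = y} * ?G y \<partial>count_space UNIV)"
    by (rule nn_integral_count_space_fibres)
  also have "\<dots> \<le> (\<integral>\<^sup>+y. (case y of (N, j) \<Rightarrow>
      ennreal (C * (real N powr (real d - r) * real (Suc j) powr (real d - 1 - r)))) \<partial>count_space UNIV)"
  proof (rule nn_integral_mono)
    fix y :: "nat \<times> nat"
    obtain N j where y: "y = (N, j)" by (cases y)
    let ?b = "(j + d - 1) choose (d - 1)"
    show "emeasure (count_space UNIV) {x\<in>?I. h x = y} * ?G y \<le>
      (case y of (N, j) \<Rightarrow> ennreal (C * (real N powr (real d - r) * real (Suc j) powr (real d - 1 - r))))"
    proof (cases "N = 0")
      case False
      have "{x\<in>?I. h x = y} \<subseteq> {int N, - int N} \<times> {j} \<times> {..<N ^ d * K * ?b}"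
        by (auto simp: y h_def folland_index_def)
      then have "emeasure (count_space UNIV) {x\<in>?I. h x = y} \<le> of_nat (2 * (N ^ d * K * ?b))"
      proof (rule emeasure_count_space_le_card)
        show "finite ({int N, - int N} \<times> {j} \<times> {..<N ^ d * K * ?b})"
          by (intro finite_cartesian_product) auto
        have "card {int N, - int N} = 2" using False by simp
        then show "card ({int N, - int N} \<times> {j} \<times> {..<N ^ d * K * ?b}) \<le> 2 * (N ^ d * K * ?b)"
          unfolding card_cartesian_product by simp
      qed
      also have "\<dots> \<le> ennreal (2 * real K * real d ^ (d - 1) * (real N powr real d * real (Suc j) powr (real d - 1)))"
      proof -
        have d1: "real (d - 1) = real d - 1" using d by (simp add: of_nat_diff)
        \<comment> \<open>The bound of \<open>n choose k\<close> by \<open>n ^ k\<close>; then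
          \<open>j + d - 1 \<le> d * Suc j\<close> makes the base a multiple of
          \<open>Suc j\<close>.\<close>
        have "?b \<le> (j + d - 1) ^ (d - 1)"
          using d by (intro binomial_le_pow) auto
        also have "\<dots> \<le> (d * Suc j) ^ (d - 1)"
        proof (rule power_mono)
          show "j + d - 1 \<le> d * Suc j"
            using mult_le_mono1[OF d, of j] unfolding mult_Suc_right mult_1_left by linarith
        qed simp
        finally have "real ?b \<le> real ((d * Suc j) ^ (d - 1))" by (rule of_nat_mono)
        also have "\<dots> = real d ^ (d - 1) * real (Suc j) powr (real d - 1)"
          unfolding of_nat_power of_nat_mult power_mult_distrib
          using powr_realpow[of "real (Suc j)" "d - 1"] unfolding d1 by (simp del: of_nat_Suc)
        finally have "2 * (real N ^ d * real K) * real ?b \<le>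
            2 * (real N ^ d * real K) * (real d ^ (d - 1) * real (Suc j) powr (real d - 1))"
          by (intro mult_left_mono) auto
        then show ?thesis
          unfolding ennreal_of_nat_eq_real_of_nat using False
          by (intro ennreal_leI) (simp add: powr_realpow algebra_simps)
      qed
      finally have "emeasure (count_space UNIV) {x\<in>?I. h x = y} * ?G y \<le>
          ennreal (2 * real K * real d ^ (d - 1) * (real N powr real d * real (Suc j) powr (real d - 1))) * ?G y"
        by (rule mult_right_mono) simp
      also have "\<dots> = ennreal (2 * real K * real d ^ (d - 1) * (real N powr real d * real (Suc j) powr (real d - 1)) *
          (B powr - r * real N powr - r * real (Suc j) powr - r))"
        unfolding y prod.case by (subst ennreal_mult[symmetric]) auto
      also have "\<dots> = ennreal (C * (real N powr (real d - r) * real (Suc j) powr (real d - 1 - r)))"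
        using powr_add[of "real N" "real d" "- r"] powr_add[of "real (Suc j)" "real d - 1" "- r"]
        by (simp add: C_def algebra_simps del: of_nat_Suc)
      finally show ?thesis by (simp add: y)
    qed (simp add: y)
  qed
  also have "\<dots> = (\<integral>\<^sup>+N. \<integral>\<^sup>+j. ennreal (C * (real N powr (real d - r) * real (Suc j) powr (real d - 1 - r)))
      \<partial>count_space UNIV \<partial>count_space UNIV)"
    by (subst nn_integral_fst_count_space[symmetric]) simp
  also have "\<dots> = (\<integral>\<^sup>+N. \<integral>\<^sup>+j. ennreal C * ennreal (real N powr (real d - r)) * ennreal (real (Suc j) powr (real d - 1 - r))
      \<partial>count_space UNIV \<partial>count_space UNIV)"
    using \<open>C \<ge> 0\<close> by (simp add: ennreal_mult mult.assoc del: of_nat_Suc)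
  also have "\<dots> = ennreal C * (\<integral>\<^sup>+N. ennreal (real N powr (real d - r)) \<partial>count_space UNIV) *
      (\<integral>\<^sup>+j. ennreal (real (Suc j) powr (real d - 1 - r)) \<partial>count_space UNIV)"
    by (simp add: nn_integral_cmult nn_integral_multc del: of_nat_Suc)
  also have "\<dots> < \<infinity>"
  proof -
    have "(\<Sum>N. ennreal (real N powr (real d - r))) \<noteq> top_class.top"
      using r by (intro ennreal_suminf_neq_top) (auto simp: summable_real_powr_iff)
    moreover have "(\<Sum>j. ennreal (real (Suc j) powr (real d - 1 - r))) \<noteq> top_class.top"
      using r by (intro ennreal_suminf_neq_top summable_Suc_powr) auto
    ultimately have "(\<integral>\<^sup>+N. ennreal (real N powr (real d - r)) \<partial>count_space UNIV) < \<infinity>"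
      "(\<integral>\<^sup>+j. ennreal (real (Suc j) powr (real d - 1 - r)) \<partial>count_space UNIV) < \<infinity>"
      unfolding nn_integral_count_space_nat infinity_ennreal_def less_top[symmetric] by blast+
    then show ?thesis by (simp add: ennreal_mult_less_top)
  qed
  finally show ?thesis .
qed

text \<open>A single \<open>j\<close> suffices. For \<open>n > 0\<close> the choice
  \<open>j = 0\<close> would fail at \<alpha> = \<open>d\<close>, where these eigenvalues vanish;
  \<open>j = 1\<close> has the positive factor \<open>d + 2 - \<alpha>\<close>. Each
  \<open>n\<close> carries at least \<open>n ^ d\<close> indices, and \<open>n powr (d - r)\<close>
  is not summable for \<open>r \<le> d + 1\<close>.\<close>

lemma folland_sum_infinite:
  assumes d: "d \<ge> 1" and c: "c > 0" and \<alpha>: "- real d \<le> \<alpha>" "\<alpha> \<le> real d" and r: "r \<le> real d + 1" and K: "K > 0"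
  shows "(\<integral>\<^sup>+x. (if folland_eigenvalue c d \<alpha> x = 0 then 0 else ennreal (inverse (folland_eigenvalue c d \<alpha> x) powr r))
            \<partial>count_space (folland_index d K)) = \<infinity>"
proof -
  let ?I = "folland_index d K" and ?lam = "folland_eigenvalue c d \<alpha>"
  let ?J = "{(n, j, m). (n, j, m) \<in> ?I \<and> n > 0 \<and> j = 1}"
  define h where "h = (\<lambda>(n, j :: nat, m :: nat). nat n)"
  define C where "C = (inverse (pi / (2 * c) * (real d + 2 - \<alpha>))) powr r"
  have C: "C > 0" using c \<alpha> by (simp add: C_def)
  have "\<infinity> = (\<Sum>N. ennreal (C * real N powr (real d - r)))"
  proof (rule ccontr)
    assume "\<infinity> \<noteq> (\<Sum>N. ennreal (C * real N powr (real d - r)))"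
    then have "summable (\<lambda>N. C * real N powr (real d - r))"
      using C by (intro summable_suminf_not_top) auto
    then have "summable (\<lambda>N. real N powr (real d - r))"
      using C by (simp add: summable_cmult_iff)
    then show False using r by (simp add: summable_real_powr_iff)
  qed
  also have "\<dots> = (\<integral>\<^sup>+N. ennreal (C * real N powr (real d - r)) \<partial>count_space UNIV)"
    by (rule nn_integral_count_space_nat[symmetric])
  also have "\<dots> \<le> (\<integral>\<^sup>+N. emeasure (count_space UNIV) {x\<in>?J. h x = N} * ennreal (C * real N powr - r) \<partial>count_space UNIV)"
  proof (rule nn_integral_mono)
    fix N
    show "ennreal (C * real N powr (real d - r)) \<le> emeasure (count_space UNIV) {x\<in>?J. h x = N} * ennreal (C * real N powr - r)"
    proof (cases "N = 0")
      case False
      let ?b = "(1 + d - 1) choose (d - 1)"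
      have "{x\<in>?J. h x = N} = (\<lambda>m. (int N, 1, m)) ` {..<N ^ d * K * ?b}"
        using False by (auto simp: h_def folland_index_def image_iff)
      then have "emeasure (count_space UNIV) {x\<in>?J. h x = N} = of_nat (N ^ d * K * ?b)"
        by (simp add: card_image inj_on_def)
      \<comment> \<open>The binomial coefficient is \<open>d choose (d - 1)\<close>, which is
        positive, and so is \<open>K\<close>.\<close>
      moreover have "N ^ d * 1 \<le> N ^ d * (K * ?b)"
        using K d by (intro mult_le_mono) (auto simp: Suc_le_eq)
      ultimately have "ennreal (real N powr real d) \<le> emeasure (count_space UNIV) {x\<in>?J. h x = N}"
        using False by (simp add: powr_realpow ennreal_of_nat_eq_real_of_nat mult.assoc flip: of_nat_power of_nat_mult)
      then have "ennreal (real N powr real d) * ennreal (C * real N powr - r) \<le>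
          emeasure (count_space UNIV) {x\<in>?J. h x = N} * ennreal (C * real N powr - r)"
        by (rule mult_right_mono) simp
      moreover have "ennreal (real N powr real d) * ennreal (C * real N powr - r) = ennreal (C * real N powr (real d - r))"
        using powr_add[of "real N" "real d" "- r"] C by (simp add: ennreal_mult[symmetric] algebra_simps)
      ultimately show ?thesis by simp
    qed simp
  qed
  also have "\<dots> = (\<integral>\<^sup>+x. ennreal (C * real (h x) powr - r) \<partial>count_space ?J)"
    by (rule nn_integral_count_space_fibres[symmetric])
  also have "\<dots> \<le> (\<integral>\<^sup>+x. (if ?lam x = 0 then 0 else ennreal (inverse (?lam x) powr r)) \<partial>count_space ?I)"
  proof (rule nn_integral_count_space_subset_mono)
    fix x assume "x \<in> ?J"
    then obtain n m where x: "x = (n, 1, m)" and n: "n > 0" by auto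
    let ?a = "pi / (2 * c) * (real d + 2 - \<alpha>)"
    have lam: "?lam x = ?a * real (nat n)"
      using n by (simp add: x folland_eigenvalue_eq)
    have a: "?a > 0" using c \<alpha> by simp
    have "inverse (?lam x) powr r = C * real (h x) powr - r"
      unfolding lam C_def inverse_mult_distrib using a n
      by (subst powr_mult) (simp_all add: x h_def powr_minus inverse_powr)
    moreover have "?lam x > 0" unfolding lam by (rule mult_pos_pos[OF a]) (simp add: n)
    ultimately show "ennreal (C * real (h x) powr - r) \<le> (if ?lam x = 0 then 0 else ennreal (inverse (?lam x) powr r))"
      by simp
  qed auto
  finally show ?thesis by (simp add: top_unique)
qed

theorem theorem2:
  fixes \<kappa> s \<tau> c \<alpha> r :: real
    and K :: nat
    and \<Gamma> F :: "('d::finite) heis set"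
    and e :: "nat \<Rightarrow> 'd heis set \<Rightarrow> complex"
    and ev :: "nat \<Rightarrow> real"
  assumes "\<kappa> \<noteq> 0" and "s > 0" and "\<tau> \<noteq> 0"
    and "heis_lattice \<kappa> \<Gamma>"
    and "fundamental_domain \<kappa> \<Gamma> F"
    and "c > 0" and "heis_center \<kappa> \<Gamma> = {(0, c * of_int k) | k. True}"
    and "K > 0" and "folland_spectrum \<kappa> s \<tau> \<Gamma> F c K"
    and "- real CARD('d) \<le> \<alpha>" and "\<alpha> \<le> real CARD('d)"
    and "green_basis \<kappa> s \<tau> \<Gamma> F \<alpha> e ev"
    and "r \<ge> 1"
  shows "schatten_norm (heis_quotient \<kappa> \<Gamma> F) (green_op \<kappa> s \<tau> \<Gamma> F \<alpha> e ev) r < \<infinity>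
           \<longleftrightarrow> r > real CARD('d) + 1"
proof -
  interpret heis_quotient_space \<kappa> \<Gamma> F
    by unfold_locales (rule assms)+
  let ?d = "CARD('d)" and ?D = "dual_lattice (fst ` \<Gamma>)" and ?A = "L_op \<kappa> s \<tau> \<Gamma> F \<alpha>"
  let ?I = "folland_index ?d K"
  have d: "?d \<ge> 1" by (simp add: Suc_le_eq)
  obtain b where basis: "l2_orthonormal_basis N (l2 N) (?I <+> ?D) b"
    and b_Inl: "\<forall>(n, j, m)\<in>?I. joint_eigenvector \<kappa> s \<tau> \<Gamma> F
              (pi * of_int \<bar>n\<bar> / (2 * c) * (real ?d + 2 * real j), pi * of_int n / (2 * c)) (b (Inl (n, j, m)))"
    and b_Inr: "\<forall>\<xi>\<in>?D. joint_eigenvector \<kappa> s \<tau> \<Gamma> F (pi / 2 * (norm \<xi>)\<^sup>2, 0) (b (Inr \<xi>))"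
    using assms(9) unfolding folland_spectrum_def Let_def folland_index_def[symmetric] by (elim exE conjE)
  define lam where "lam = case_sum (folland_eigenvalue c ?d \<alpha>) (\<lambda>\<xi> :: complex ^ 'd. pi / 2 * (norm \<xi>)\<^sup>2)"
  have eig: "eigenvector N ?A (lam x) (b x)" if x: "x \<in> ?I <+> ?D" for x
  proof (cases x)
    case (Inl y)
    then obtain n j m where y: "x = Inl (n, j, m)" "(n, j, m) \<in> ?I"
      using x by (cases y) auto
    then have "eigenvector N ?A (pi * of_int \<bar>n\<bar> / (2 * c) * (real ?d + 2 * real j) - \<alpha> * (pi * of_int n / (2 * c))) (b x)"
      using b_Inl joint_eigenvector_L_op by fastforce
    moreover have "pi * of_int \<bar>n\<bar> / (2 * c) * (real ?d + 2 * real j) - \<alpha> * (pi * of_int n / (2 * c)) = lam x"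
      by (simp add: y lam_def folland_eigenvalue_def right_diff_distrib mult.assoc mult.left_commute)
    ultimately show ?thesis by simp
  next
    case (Inr \<xi>)
    then have "joint_eigenvector \<kappa> s \<tau> \<Gamma> F (pi / 2 * (norm \<xi>)\<^sup>2, 0) (b x)"
      using x b_Inr by auto
    from joint_eigenvector_L_op[OF this] show ?thesis
      by (simp add: Inr lam_def)
  qed
  interpret diagonalized_operator N ?A "?I <+> ?D" b lam e ev
  proof
    show "l2_symmetric N 1 ?A" by (rule L_op_symmetric)
  qed (use basis eig assms(12) in \<open>auto simp: green_basis_def Let_def\<close>)
  have green: "green_op \<kappa> s \<tau> \<Gamma> F \<alpha> e ev = green"
    unfolding green_op_def green_def Let_def ..
  define S where "S = (\<Sum>\<^sub>\<infinity>\<mu>\<in>{\<mu>. \<exists>f. eigenvector N green \<mu> f}. eigen_multiplicity N green \<mu> * ennreal (\<mu> powr r))"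
  let ?S1 = "\<integral>\<^sup>+x. (if folland_eigenvalue c ?d \<alpha> x = 0 then 0 else ennreal (inverse (folland_eigenvalue c ?d \<alpha> x) powr r))
      \<partial>count_space ?I"
  let ?S2 = "\<integral>\<^sup>+\<xi>. (if pi / 2 * (norm \<xi>)\<^sup>2 = 0 then 0 else ennreal (inverse (pi / 2 * (norm \<xi>)\<^sup>2) powr r))
      \<partial>count_space ?D"
  have S: "S = ?S1 + ?S2"
    unfolding S_def green_schatten_sum[OF zero_in_kernel] nn_integral_count_space_Plus lam_def sum.case ..
  have "schatten_norm N green r < \<infinity> \<longleftrightarrow> S < \<infinity>"
    unfolding schatten_norm_def Let_def S_def[symmetric] by (simp add: less_top[symmetric])
  also have "S < \<infinity> \<longleftrightarrow> r > real ?d + 1"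
  proof
    assume "S < \<infinity>"
    \<comment> \<open>The dual lattice only adds a nonnegative amount, so divergence of
      \<open>?S1\<close> is decisive.\<close>
    then have "?S1 < \<infinity>" unfolding S by auto
    then show "r > real ?d + 1"
      using folland_sum_infinite[OF d assms(6,10,11) _ assms(8), of r] by (cases "r \<le> real ?d + 1") auto
  next
    assume r: "r > real ?d + 1"
    have D: "?D = {\<xi>. \<forall>\<mu>\<in>fst ` \<Gamma>. \<xi> \<bullet> \<mu> \<in> \<int>}"
      by (simp add: dual_lattice_def)
    have power: "inverse (pi / 2 * (norm \<xi>)\<^sup>2) powr r = (2 / pi) powr r * norm \<xi> powr - (2 * r)"
      if "\<xi> \<noteq> 0" for \<xi> :: "complex ^ 'd"
    proof -
      have "inverse (pi / 2 * (norm \<xi>)\<^sup>2) = (2 / pi) * norm \<xi> powr - 2"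
        using that by (simp add: powr_minus field_simps)
      then show ?thesis
        by (simp only:) (subst powr_mult, simp_all add: powr_powr)
    qed
    have "?S2 \<le> (\<integral>\<^sup>+\<xi>. ennreal ((2 / pi) powr r) * ennreal (norm \<xi> powr - (2 * r)) \<partial>count_space ?D)"
    proof (rule nn_integral_mono)
      fix \<xi> :: "complex ^ 'd"
      show "(if pi / 2 * (norm \<xi>)\<^sup>2 = 0 then 0 else ennreal (inverse (pi / 2 * (norm \<xi>)\<^sup>2) powr r)) \<le>
          ennreal ((2 / pi) powr r) * ennreal (norm \<xi> powr - (2 * r))"
      proof (cases "\<xi> = 0")
        case False
        then have "(pi / 2 * (norm \<xi>)\<^sup>2 = 0) = False" by simp
        then show ?thesis
          by (simp only: if_False power[OF False] ennreal_mult[OF powr_ge_zero powr_ge_zero] order_refl)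
      qed simp
    qed
    also have "\<dots> = ennreal ((2 / pi) powr r) * (\<integral>\<^sup>+\<xi>. ennreal (norm \<xi> powr - (2 * r)) \<partial>count_space ?D)"
      by (simp add: nn_integral_cmult)
    \<comment> \<open>The real dimension of \<open>complex ^ 'd\<close> is
      \<open>2 * CARD('d)\<close>, and \<open>r > CARD('d) + 1\<close> puts \<open>2 * r\<close>
      above the required \<open>2 * CARD('d) + 1\<close>.\<close>
    also have "\<dots> < \<infinity>"
      using dual_lattice_sum_finite[OF span_projection, of "2 * r"] r
      unfolding D by (simp add: ennreal_mult_less_top)
    finally have "?S2 < \<infinity>" .
    then show "S < \<infinity>"
      using folland_sum_finite[OF d assms(6,10,11) r] unfolding S by simp
  qed
  finally show ?thesis unfolding green .
qed

end
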